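(* Let $(\Omega,\mathcal F,\mathbb P)$ be a complete probability space and let $(W,\|\cdot\|_W)$ be a separable real Banach space of type $2$. Let $(Y_m)_{m\in\mathbb N}\subseteq L^2(\Omega;W)$, let $N_n:\Omega\to\mathbb N$ be $\mathcal F$-$2^{\mathbb N}$-measurable for each $n\in\mathbb N$, and let $(\theta_n)_{n\in\mathbb N}\subseteq(0,\infty)$. Assume that (i) $(Y_m)_{m\in\mathbb N}$ is i.i.d. and $\mathbb EY_1=0$; and (ii) $\lim_{n\to\infty}\theta_n=\infty$ and $\lim_{n\to\infty}\frac{N_n}{\theta_n}=1$ in probability. Then both limits $$\lim_{n\to\infty}\frac1{\sqrt{\theta_n}}\sum_{k=1}^{N_n}Y_k=\lim_{n\to\infty}\frac1{\sqrt{N_n}}\sum_{k=1}^{N_n}Y_k=Z$$ hold in distribution (in $W$), where $Z\sim N_W(0,\mathrm{Cov}_W(Y_1))$.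
   Context: $\mathbb N=\{1,2,\dots\}$. $L^2(\Omega;W)$ is the space of (classes of) Borel measurable $Y:\Omega\to W$ with $\mathbb E\|Y\|_W^2<\infty$. $W$ is of type $2$ if there is $C>0$ with $\mathbb E\|\sum_{k=1}^nX_k\|_W^2\le C\sum_{k=1}^n\mathbb E\|X_k\|_W^2$ for all $n\in\mathbb N$ and all independent centered $X_1,\dots,X_n\in L^2(\Omega;W)$. A $W$-valued random variable $Y$ is Gaussian if $\langle Y,\psi\rangle$ is real Gaussian (constants allowed) for every $\psi$ in the dual $W'$. For $Y\in L^2(\Omega;W)$, $\mathrm{Cov}_W(Y):W'\times W'\to\mathbb R$ is $\mathrm{Cov}_W(Y)(\psi_1,\psi_2):=\mathbb E(\langle Y-\mathbb EY,\psi_1\rangle\langle Y-\mathbb EY,\psi_2\rangle)$. $Z\sim N_W(\mu,Q)$ means $Z$ is Gaussian with mean $\mu$ and covariance $Q$. $Y_n\to Y$ in distribution means $\mathbb Ef(Y_n)\to\mathbb Ef(Y)$ for all bounded continuous $f:W\to\mathbb R$. *)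

theory Defs
  imports "HOL-Probability.Probability"
begin

text \<open>
  Separable real Banach spaces are types of class \<open>{banach, second_countable_topology}\<close>, and the
  dual space of \<open>'w\<close> is the type \<open>'w \<Rightarrow>\<^sub>L real\<close> of bounded linear functionals. Sequences indexed by
  the positive integers are functions on \<^typ>\<open>nat\<close> that are only constrained at indices \<open>\<ge> 1\<close>.
\<close>

definition L2 :: "'a measure \<Rightarrow> ('a \<Rightarrow> 'w::{banach, second_countable_topology}) set" where
  "L2 M = {X. X \<in> borel_measurable M \<and> integrable M (\<lambda>\<omega>. (norm (X \<omega>))\<^sup>2)}"

definition type_2 ::
  "'a measure \<Rightarrow> 'w::{banach, second_countable_topology} itself \<Rightarrow> bool" where
  "type_2 M (_ :: 'w itself) \<longleftrightarrow>
    (\<exists>C>0. \<forall>n\<ge>1. \<forall>X :: nat \<Rightarrow> 'a \<Rightarrow> 'w.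
      (\<forall>k\<in>{1..n}. X k \<in> L2 M \<and> (\<integral>\<omega>. X k \<omega> \<partial>M) = 0) \<longrightarrow>
      prob_space.indep_vars M (\<lambda>_. borel) X {1..n} \<longrightarrow>
      (\<integral>\<omega>. (norm (\<Sum>k=1..n. X k \<omega>))\<^sup>2 \<partial>M) \<le> C * (\<Sum>k=1..n. \<integral>\<omega>. (norm (X k \<omega>))\<^sup>2 \<partial>M))"

definition iid_seq :: "'a measure \<Rightarrow> (nat \<Rightarrow> 'a \<Rightarrow> 'w::topological_space) \<Rightarrow> bool" where
  "iid_seq M Y \<longleftrightarrow>
    prob_space.indep_vars M (\<lambda>_. borel) Y {1..} \<and>
    (\<forall>m\<ge>1. distr M borel (Y m) = distr M borel (Y 1))"

text \<open>The second alternative is the degenerate Gaussian distribution with variance zero.\<close>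

definition real_gaussian :: "'b measure \<Rightarrow> ('b \<Rightarrow> real) \<Rightarrow> bool" where
  "real_gaussian P X \<longleftrightarrow>
    X \<in> borel_measurable P \<and>
    ((\<exists>\<mu> \<sigma>. \<sigma> > 0 \<and> distributed P lborel X (normal_density \<mu> \<sigma>)) \<or>
     (\<exists>c. AE \<omega> in P. X \<omega> = c))"

definition gaussian ::
  "'b measure \<Rightarrow> ('b \<Rightarrow> 'w::{banach, second_countable_topology}) \<Rightarrow> bool" where
  "gaussian P Y \<longleftrightarrow>
    Y \<in> borel_measurable P \<and>
    (\<forall>\<psi> :: 'w \<Rightarrow>\<^sub>L real. real_gaussian P (\<lambda>\<omega>. blinfun_apply \<psi> (Y \<omega>)))"

definition covariance ::
  "'b measure \<Rightarrow> ('b \<Rightarrow> 'w::{banach, second_countable_topology}) \<Rightarrow>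
    ('w \<Rightarrow>\<^sub>L real) \<Rightarrow> ('w \<Rightarrow>\<^sub>L real) \<Rightarrow> real" where
  "covariance P Y = (\<lambda>\<psi>1 \<psi>2.
    \<integral>\<omega>. blinfun_apply \<psi>1 (Y \<omega> - (\<integral>\<omega>'. Y \<omega>' \<partial>P)) *
        blinfun_apply \<psi>2 (Y \<omega> - (\<integral>\<omega>'. Y \<omega>' \<partial>P)) \<partial>P)"

text \<open>
  The probability space carrying \<open>Z\<close> is a parameter, since only the law of \<open>Z\<close> matters.
  Membership in \<^const>\<open>L2\<close> ensures that the mean and covariance are well defined, not
  values of \<^const>\<open>lebesgue_integral\<close> at a non-integrable function.
\<close>

definition normal_rv ::
  "'b measure \<Rightarrow> ('b \<Rightarrow> 'w::{banach, second_countable_topology}) \<Rightarrow> 'w \<Rightarrow>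
    (('w \<Rightarrow>\<^sub>L real) \<Rightarrow> ('w \<Rightarrow>\<^sub>L real) \<Rightarrow> real) \<Rightarrow> bool" where
  "normal_rv P Z \<mu> Q \<longleftrightarrow>
    prob_space P \<and> Z \<in> L2 P \<and> gaussian P Z \<and> (\<integral>\<omega>. Z \<omega> \<partial>P) = \<mu> \<and> covariance P Z = Q"

definition tendsto_in_prob :: "'a measure \<Rightarrow> (nat \<Rightarrow> 'a \<Rightarrow> real) \<Rightarrow> real \<Rightarrow> bool" where
  "tendsto_in_prob M X c \<longleftrightarrow>
    (\<forall>n\<ge>1. X n \<in> borel_measurable M) \<and>
    (\<forall>\<epsilon>>0. (\<lambda>n. measure M {\<omega>\<in>space M. \<bar>X n \<omega> - c\<bar> > \<epsilon>}) \<longlonglongrightarrow> 0)"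

text \<open>The variables \<open>X n\<close> and the limit \<open>Z\<close> may live on different probability spaces.\<close>

definition tendsto_in_distribution ::
  "'a measure \<Rightarrow> (nat \<Rightarrow> 'a \<Rightarrow> 'w::topological_space) \<Rightarrow> 'b measure \<Rightarrow> ('b \<Rightarrow> 'w) \<Rightarrow> bool" where
  "tendsto_in_distribution M X P Z \<longleftrightarrow>
    (\<forall>n\<ge>1. X n \<in> borel_measurable M) \<and> Z \<in> borel_measurable P \<and>
    (\<forall>f :: 'w \<Rightarrow> real. continuous_on UNIV f \<longrightarrow> bounded (range f) \<longrightarrow>
      (\<lambda>n. \<integral>\<omega>. f (X n \<omega>) \<partial>M) \<longlonglongrightarrow> (\<integral>\<omega>. f (Z \<omega>) \<partial>P))"

end

theory Submission
  imports Defs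
begin

text \<open>
  Write \<open>S n\<close> for the partial sums. Characteristic functionals of \<open>S n / sqrt n\<close> converge by the
  scalar central limit theorem. Type 2 bounds \<open>E (norm (S n))\<^sup>2\<close> by \<open>C * n * E (norm (Y 1))\<^sup>2\<close>; applied
  to \<open>Y - \<phi> Y\<close> with \<open>\<phi>\<close> simple, this makes \<open>S n / sqrt n\<close> uniformly close in probability to a variable in
  a finite-dimensional subspace, hence uniformly tight. On a tight family, trigonometric polynomials
  in the functionals determine weak convergence by Stone--Weierstrass, which gives the central limit
  theorem for every Gaussian \<open>Z\<close> with the right covariance, without Prokhorov's theorem.

  Such a \<open>Z\<close> exists: Gaussian counterparts of the simple approximations of \<open>Y 1\<close> are built from one
  sequence of independent standard normals, and the central limit theorem transfers the type 2 bound
  to them, so that they form a Cauchy sequence in \<open>L2\<close>.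

  The random index is handled as in Anscombe's theorem: \<open>N n\<close> lies with high probability in a window
  of length \<open>\<delta> * \<theta> n\<close> around \<open>\<theta> n\<close>, over which Ottaviani's maximal inequality and the type 2 bound
  keep the fluctuation of the partial sums of order \<open>sqrt (\<delta> * \<theta> n)\<close>.
\<close>

section \<open>Separation of points by functionals\<close>

text \<open>\<open>type_2\<close> speaks only of variables on \<open>M\<close>, while the Gaussian
  approximants are built on a separate product space. The inequality is therefore never applied to
  them: each approximant has the limit law of normalized sums of \<open>h (X k)\<close> on
  \<open>M\<close> for a map \<open>h\<close> of finite range, and the bound passes to that limit.
  This is also why all approximations are maps on \<open>'w\<close> composed with the given
  sequence, which keeps independence and equality of laws.

  Separation of points is needed twice: for Stone--Weierstrass, and to see that a Bochner mean
  vanishes once all its functionals do.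

  The random sums are compared in probability with sums at a deterministic index. Bounded continuous
  test functions need not be uniformly continuous, so closeness in probability alone is not enough;
  tightness of the deterministic sums closes this gap.\<close>

definition sublinear :: "('w::real_normed_vector \<Rightarrow> real) \<Rightarrow> bool" where
  "sublinear p \<longleftrightarrow> (\<forall>x y. p (x + y) \<le> p x + p y) \<and> (\<forall>t\<ge>0. \<forall>x. p (t *\<^sub>R x) = t * p x)"

text \<open>
  Hahn--Banach without partial functionals: a minimal sublinear functional \<open>p\<close> equals \<open>slide p x\<close> for
  every \<open>x\<close>, and this makes it additive.
\<close>

definition slide :: "('w::real_normed_vector \<Rightarrow> real) \<Rightarrow> 'w \<Rightarrow> 'w \<Rightarrow> real" where
  "slide p x y = (INF t\<in>{0..}. p (y + t *\<^sub>R x) - t * p x)"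

lemma sublinear_zero: "sublinear p \<Longrightarrow> p 0 = 0"
proof -
  assume "sublinear p"
  then have "p (0 *\<^sub>R 0) = 0 * p 0" unfolding sublinear_def by blast
  then show ?thesis by simp
qed

lemma sublinear_add: "sublinear p \<Longrightarrow> p (x + y) \<le> p x + p y"
  unfolding sublinear_def by blast

lemma sublinear_scale: "sublinear p \<Longrightarrow> t \<ge> 0 \<Longrightarrow> p (t *\<^sub>R x) = t * p x"
  unfolding sublinear_def by blast

lemma sublinear_ge: "sublinear p \<Longrightarrow> - p (- x) \<le> p x"
proof -
  assume p: "sublinear p"
  then have "p (x + - x) \<le> p x + p (- x)" by (rule sublinear_add)
  then show ?thesis using sublinear_zero[OF p] by simp
qed

text \<open>The bound does not depend on \<open>t\<close>, so the infimum in \<open>slide\<close> is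
  taken over a set that is bounded below.\<close>

lemma slide_bound:
  assumes "sublinear p" "t \<ge> 0"
  shows "- p (- y) \<le> p (y + t *\<^sub>R x) - t * p x"
proof -
  have "t * p x = p ((y + t *\<^sub>R x) + (- y))"
    using sublinear_scale[OF assms] by simp
  also have "\<dots> \<le> p (y + t *\<^sub>R x) + p (- y)"
    using assms(1) by (rule sublinear_add)
  finally show ?thesis by simp
qed

lemma slide_le:
  assumes "sublinear p" "t \<ge> 0"
  shows "slide p x y \<le> p (y + t *\<^sub>R x) - t * p x"
  unfolding slide_def using assms
  by (intro cINF_lower bdd_belowI2[where m = "- p (- y)"] slide_bound) auto

lemma slide_greatest:
  assumes "\<And>t. t \<ge> 0 \<Longrightarrow> c \<le> p (y + t *\<^sub>R x) - t * p x"
  shows "c \<le> slide p x y"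
  unfolding slide_def using assms by (intro cINF_greatest) auto

lemma slide_le_self: "sublinear p \<Longrightarrow> slide p x y \<le> p y"
  using slide_le[of p 0 x y] by simp

lemma sublinear_slide:
  assumes p: "sublinear p"
  shows "sublinear (slide p x)"
proof -
  have add: "slide p x (y + z) \<le> slide p x y + slide p x z" for y z
  proof -
    \<comment> \<open>The shifts \<open>s\<close> and \<open>t\<close> of the two infima merge into
      the single shift \<open>s + t\<close>; taking the infima one variable at a time then gives
      subadditivity.\<close>
    have "slide p x (y + z) - (p (y + s *\<^sub>R x) - s * p x) \<le> p (z + t *\<^sub>R x) - t * p x"
      if "s \<ge> 0" "t \<ge> 0" for s t
    proof -
      have "slide p x (y + z) \<le> p ((y + z) + (s + t) *\<^sub>R x) - (s + t) * p x"
        using that by (intro slide_le p) auto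
      also have "(y + z) + (s + t) *\<^sub>R x = (y + s *\<^sub>R x) + (z + t *\<^sub>R x)"
        by (simp add: algebra_simps)
      also have "p \<dots> \<le> p (y + s *\<^sub>R x) + p (z + t *\<^sub>R x)"
        using p by (rule sublinear_add)
      finally show ?thesis by (simp add: algebra_simps)
    qed
    then have "slide p x (y + z) - (p (y + s *\<^sub>R x) - s * p x) \<le> slide p x z" if "s \<ge> 0" for s
      using that by (intro slide_greatest) auto
    then have "slide p x (y + z) - slide p x z \<le> slide p x y"
      by (intro slide_greatest) (simp add: algebra_simps)
    then show ?thesis by simp
  qed
  have le: "slide p x (c *\<^sub>R y) \<le> c * slide p x y" if "c > 0" for c y
  proof -
    have "slide p x (c *\<^sub>R y) / c \<le> p (y + t *\<^sub>R x) - t * p x" if "t \<ge> 0" for t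
    proof -
      have "slide p x (c *\<^sub>R y) \<le> p (c *\<^sub>R y + (c * t) *\<^sub>R x) - c * t * p x"
        using that \<open>c > 0\<close> by (intro slide_le p) auto
      also have "c *\<^sub>R y + (c * t) *\<^sub>R x = c *\<^sub>R (y + t *\<^sub>R x)"
        by (simp add: algebra_simps)
      also have "p \<dots> = c * p (y + t *\<^sub>R x)"
        using p \<open>c > 0\<close> by (intro sublinear_scale) auto
      finally show ?thesis using \<open>c > 0\<close> by (simp add: field_simps)
    qed
    then have "slide p x (c *\<^sub>R y) / c \<le> slide p x y" by (intro slide_greatest)
    then show ?thesis using that by (simp add: field_simps)
  qed
  \<comment> \<open>The reverse inequality is \<open>le\<close> for the inverse factor, applied at
    \<open>c *\<^sub>R y\<close>.\<close>
  have ge: "c * slide p x y \<le> slide p x (c *\<^sub>R y)" if "c > 0" for c y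
    using le[of "inverse c" "c *\<^sub>R y"] that by (simp add: field_simps)
  have "slide p x 0 = 0"
  proof (rule antisym)
    show "slide p x 0 \<le> 0"
      using slide_le_self[OF p, of x 0] sublinear_zero[OF p] by simp
    show "0 \<le> slide p x 0"
      by (intro slide_greatest) (simp add: sublinear_scale[OF p])
  qed
  then have "slide p x (c *\<^sub>R y) = c * slide p x y" if "c \<ge> 0" for c y
    using that le[of c y] ge[of c y] by (cases "c = 0") auto
  with add show ?thesis unfolding sublinear_def by blast
qed

lemma linear_of_minimal_sublinear:
  assumes p: "sublinear p" and min: "\<And>q. sublinear q \<Longrightarrow> (\<And>x. q x \<le> p x) \<Longrightarrow> q = p"
  shows "linear p"
proof
  have slide: "slide p x = p" for x
    using p by (intro min sublinear_slide slide_le_self)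
  show add: "p (y + x) = p y + p x" for y x
  proof (rule antisym)
    show "p (y + x) \<le> p y + p x" using p by (rule sublinear_add)
    \<comment> \<open>The term \<open>t = 1\<close> of the infimum: since
      \<open>slide p x = p\<close>, it reads \<open>p y \<le> p (y + x) - p x\<close>.\<close>
    show "p y + p x \<le> p (y + x)" using slide_le[OF p, of 1 x y] by (simp add: slide)
  qed
  have neg: "p (- x) = - p x" for x
    using add[of x "- x"] sublinear_zero[OF p] by simp
  show "p (r *\<^sub>R x) = r *\<^sub>R p x" for r x
  proof (cases "r \<ge> 0")
    case True
    then show ?thesis by (simp add: sublinear_scale[OF p])
  next
    case False
    then have "p ((- r) *\<^sub>R x) = (- r) * p x"
      using p by (intro sublinear_scale) auto
    then show ?thesis using neg[of "r *\<^sub>R x"] by simp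
  qed
qed

lemma linear_below_sublinear:
  fixes p :: "'w::real_normed_vector \<Rightarrow> real"
  assumes p: "sublinear p"
  shows "\<exists>l. linear l \<and> (\<forall>x. l x \<le> p x)"
proof -
  define A where "A = {q. sublinear q \<and> (\<forall>x. q x \<le> p x)}"
  \<comment> \<open>The order is reversed: a maximal element for \<open>R\<close> is a pointwise
    minimal sublinear functional, and upper bounds of chains are pointwise infima.\<close>
  define R where "R = (\<lambda>q r :: 'w \<Rightarrow> real. \<forall>x. r x \<le> q x)"
  have "\<exists>m\<in>A. \<forall>a\<in>A. R m a \<longrightarrow> a = m"
  proof (rule predicate_Zorn)
    show "partial_order_on A (relation_of R A)"
      by (rule partial_order_on_relation_ofI) (auto simp: R_def fun_eq_iff intro: order_trans antisym)
    fix C assume C: "C \<in> Chains (relation_of R A)"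
    then have CA: "q \<in> A" if "q \<in> C" for q
      using that unfolding Chains_def relation_of_def by auto
    show "\<exists>u\<in>A. \<forall>a\<in>C. R a u"
    proof (cases "C = {}")
      case True
      then show ?thesis using p by (intro bexI[of _ p]) (auto simp: A_def)
    next
      case False
      define u where "u x = (INF q\<in>C. q x)" for x
      \<comment> \<open>A lower bound common to the whole chain, so that the pointwise infimum
        \<open>u\<close> is a genuine one.\<close>
      have "- p (- x) \<le> q x" if "q \<in> C" for q x
      proof -
        have "- p (- x) \<le> - q (- x)" using CA[OF that] by (simp add: A_def)
        also have "\<dots> \<le> q x" using CA[OF that] by (intro sublinear_ge) (simp add: A_def)
        finally show ?thesis .
      qed
      then have bdd: "bdd_below ((\<lambda>q. q x) ` C)" for x
        by (intro bdd_belowI2)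
      have u_le: "u x \<le> q x" if "q \<in> C" for q x
        unfolding u_def using that bdd by (intro cINF_lower)
      have u_ge: "c \<le> u x" if "\<And>q. q \<in> C \<Longrightarrow> c \<le> q x" for c x
        unfolding u_def using that False by (intro cINF_greatest)
      have "u (x + y) \<le> u x + u y" for x y
      proof -
        have "u (x + y) - q x \<le> r y" if "q \<in> C" "r \<in> C" for q r
        proof -
          \<comment> \<open>Comparability in the chain: the smaller of \<open>q\<close> and
            \<open>r\<close> serves at both points, so two near-minimizers are replaced by one
            sublinear functional.\<close>
          have "\<exists>s\<in>C. s x \<le> q x \<and> s y \<le> r y"
          proof -
            from C that have "(q, r) \<in> relation_of R A \<or> (r, q) \<in> relation_of R A"
              unfolding Chains_def by blast
            then show ?thesis using that unfolding relation_of_def R_def by blast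
          qed
          then obtain s where s: "s \<in> C" "s x \<le> q x" "s y \<le> r y" by blast
          have "u (x + y) \<le> s (x + y)" using s by (intro u_le)
          also have "\<dots> \<le> s x + s y"
            using CA[OF s(1)] by (intro sublinear_add) (simp add: A_def)
          finally show ?thesis using s by simp
        qed
        then have "u (x + y) - q x \<le> u y" if "q \<in> C" for q using that by (intro u_ge)
        then have "u (x + y) - u y \<le> u x" by (intro u_ge) (simp add: algebra_simps)
        then show ?thesis by simp
      qed
      moreover have "u (t *\<^sub>R x) = t * u x" if "t \<ge> 0" for t x
      proof -
        have hom: "q (t *\<^sub>R x) = t * q x" if "q \<in> C" for q
          using CA[OF that] \<open>t \<ge> 0\<close> by (intro sublinear_scale) (simp_all add: A_def)
        show ?thesis
        proof (cases "t = 0")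
          case True
          have "u 0 = (INF q\<in>C. 0)" unfolding u_def
            using CA by (intro INF_cong) (auto simp: A_def intro: sublinear_zero)
          then show ?thesis using True False by simp
        next
          case nz: False
          show ?thesis
          proof (rule antisym)
            have "u (t *\<^sub>R x) / t \<le> u x"
              using nz that hom u_le[of _ "t *\<^sub>R x"] by (intro u_ge) (auto simp: field_simps)
            then show "u (t *\<^sub>R x) \<le> t * u x" using nz that by (simp add: field_simps)
            show "t * u x \<le> u (t *\<^sub>R x)"
              by (intro u_ge) (metis that hom u_le mult_left_mono)
          qed
        qed
      qed
      ultimately have "sublinear u" unfolding sublinear_def by blast
      moreover have "u x \<le> p x" for x
      proof -
        obtain q where "q \<in> C" using False by blast
        then show ?thesis using u_le[of q x] CA[of q] unfolding A_def by (auto intro: order_trans)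
      qed
      ultimately show ?thesis using u_le by (intro bexI[of _ u]) (auto simp: A_def R_def)
    qed
  qed
  then obtain m where m: "m \<in> A" and min: "\<And>a. a \<in> A \<Longrightarrow> R m a \<Longrightarrow> a = m" by blast
  have "linear m"
  proof (rule linear_of_minimal_sublinear)
    show "sublinear m" using m by (simp add: A_def)
    fix q assume "sublinear q" "\<And>x. q x \<le> m x"
    then show "q = m" using m by (intro min) (auto simp: A_def R_def intro: order_trans)
  qed
  then show ?thesis using m by (auto simp: A_def)
qed

text \<open>Domination by \<open>slide norm x\<close> replaces the extension of a functional from
  the line through \<open>x\<close>: the slid norm at \<open>- x\<close> is at most
  \<open>- norm x\<close>, so a linear functional below it satisfies \<open>l x \<ge> norm x\<close>
  and is still bounded by the norm.\<close>

lemma blinfun_separates: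
  fixes x :: "'w::real_normed_vector"
  assumes "x \<noteq> 0"
  obtains \<psi> :: "'w \<Rightarrow>\<^sub>L real" where "blinfun_apply \<psi> x = 1"
proof -
  have n: "sublinear (norm :: 'w \<Rightarrow> real)"
    unfolding sublinear_def by (auto intro: norm_triangle_ineq)
  obtain l where l: "linear l" and le: "\<And>y. l y \<le> slide norm x y"
    using linear_below_sublinear[OF sublinear_slide[OF n, of x]] by blast
  have le': "l y \<le> norm y" for y
    using le[of y] slide_le_self[OF n, of x y] by simp
  have "\<bar>l y\<bar> \<le> norm y" for y
    using le'[of y] le'[of "- y"] linear_neg[OF l, of y] by simp
  then have bl: "bounded_linear l"
    using l by (intro bounded_linear_intro[where K = 1]) (auto simp: linear_add linear_scale)
  have "slide norm x (- x) \<le> - norm x"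
    using slide_le[OF n, of 1 x "- x"] by simp
  then have "l x \<ge> norm x" using le[of "- x"] linear_neg[OF l, of x] by simp
  then have "l x > 0" using assms by (metis less_le_trans zero_less_norm_iff)
  then have "blinfun_apply ((1 / l x) *\<^sub>R Blinfun l) x = 1"
    using bl by (simp add: scaleR_blinfun.rep_eq bounded_linear_Blinfun_apply)
  then show ?thesis by (rule that)
qed

section \<open>Trigonometric polynomials\<close>

text \<open>The complex span of the characters of the dual. Products need no rule, as characters
  multiply by adding functionals; with linear operations only, convergence of integrals follows from
  that of characteristic functionals by induction.\<close>

inductive_set trig_poly :: "('w::real_normed_vector \<Rightarrow> complex) set" where
  iexp: "(\<lambda>x. iexp (blinfun_apply \<psi> x)) \<in> trig_poly"
| scale: "f \<in> trig_poly \<Longrightarrow> (\<lambda>x. c * f x) \<in> trig_poly"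
| add: "f \<in> trig_poly \<Longrightarrow> g \<in> trig_poly \<Longrightarrow> (\<lambda>x. f x + g x) \<in> trig_poly"

lemma trig_poly_const: "(\<lambda>_. c) \<in> trig_poly"
  using trig_poly.scale[OF trig_poly.iexp[of 0], of c] by simp

lemma trig_poly_mult_iexp:
  assumes "f \<in> trig_poly"
  shows "(\<lambda>x. iexp (blinfun_apply \<psi> x) * f x) \<in> trig_poly"
  using assms
proof induction
  case (iexp \<phi>)
  have "(\<lambda>x. iexp (blinfun_apply \<psi> x) * iexp (blinfun_apply \<phi> x)) = (\<lambda>x. iexp (blinfun_apply (\<psi> + \<phi>) x))"
    by (simp add: plus_blinfun.rep_eq exp_add[symmetric] distrib_left)
  then show ?case using trig_poly.iexp by metis
next
  case (scale f c)
  then show ?case using trig_poly.scale[of _ c] by (simp add: mult.left_commute)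
next
  case (add f g)
  then show ?case using trig_poly.add by (simp add: distrib_left)
qed

lemma trig_poly_mult:
  assumes "f \<in> trig_poly" "g \<in> trig_poly"
  shows "(\<lambda>x. f x * g x) \<in> trig_poly"
  using assms
proof induction
  case (iexp \<psi>)
  then show ?case by (rule trig_poly_mult_iexp)
next
  case (scale f c)
  then show ?case using trig_poly.scale[of _ c] by (simp add: mult.assoc)
next
  case (add f1 f2)
  then show ?case using trig_poly.add by (simp add: distrib_right)
qed

lemma continuous_on_trig_poly:
  assumes "f \<in> trig_poly"
  shows "continuous_on A f"
  using assms by induction (auto intro!: continuous_intros)

lemma bounded_trig_poly:
  assumes "f \<in> trig_poly"
  shows "\<exists>B. \<forall>x. norm (f x) \<le> B"
  using assms
proof induction
  case (iexp \<psi>)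
  then show ?case by (auto intro!: exI[of _ 1])
next
  case (scale f c)
  then obtain B where "\<And>x. norm (f x) \<le> B" by blast
  then show ?case by (auto intro!: exI[of _ "norm c * B"] mult_left_mono simp: norm_mult)
next
  case (add f g)
  obtain B where "\<And>x. norm (f x) \<le> B" using add.IH(1) by blast
  moreover obtain B' where "\<And>x. norm (g x) \<le> B'" using add.IH(2) by blast
  ultimately show ?case by (intro exI[of _ "B + B'"] allI norm_triangle_mono)
qed

text \<open>Stone--Weierstrass is applied to a ring of real functions, hence the restriction to
  members with real values.\<close>

definition real_trig_poly :: "('w::real_normed_vector \<Rightarrow> real) set" where
  "real_trig_poly = {g. (\<lambda>x. complex_of_real (g x)) \<in> trig_poly}"

lemma continuous_on_real_trig_poly:
  assumes "g \<in> real_trig_poly" shows "continuous_on A g"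
proof -
  have "continuous_on A (\<lambda>x. Re (complex_of_real (g x)))"
    using assms unfolding real_trig_poly_def
    by (intro continuous_on_Re continuous_on_trig_poly) simp
  then show ?thesis by simp
qed

lemma bounded_real_trig_poly:
  "g \<in> real_trig_poly \<Longrightarrow> \<exists>B. \<forall>x. \<bar>g x\<bar> \<le> B"
  using bounded_trig_poly[of "\<lambda>x. complex_of_real (g x)"] unfolding real_trig_poly_def by simp

lemma real_trig_poly_separates:
  fixes x y :: "'w::real_normed_vector"
  assumes "x \<noteq> y"
  shows "\<exists>g\<in>real_trig_poly. g x \<noteq> g y"
proof -
  obtain \<phi> :: "'w \<Rightarrow>\<^sub>L real" where \<phi>: "blinfun_apply \<phi> (x - y) = 1"
    using assms blinfun_separates[of "x - y"] by auto
  \<comment> \<open>With \<open>\<phi> (x - y) = 1\<close> the phases differ by exactly 1, where the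
    cosine is not 1; an arbitrary nonzero difference could be a multiple of the period.\<close>
  define g where "g z = cos (blinfun_apply \<phi> z - blinfun_apply \<phi> x)" for z
  define c where "c = blinfun_apply \<phi> x"
  have eq: "(\<lambda>z. complex_of_real (g z)) = (\<lambda>z. (iexp (- c) / 2) * iexp (blinfun_apply \<phi> z) + (iexp c / 2) * iexp (blinfun_apply (- \<phi>) z))"
    unfolding g_def c_def
    by (simp add: fun_eq_iff uminus_blinfun.rep_eq cos_of_real[symmetric] cos_exp_eq exp_add[symmetric] exp_diff exp_minus field_simps)
  have "g \<in> real_trig_poly"
    unfolding real_trig_poly_def mem_Collect_eq eq by (intro trig_poly.intros)
  moreover have "g x = 1" "g y = cos 1"
    using \<phi> by (auto simp: g_def blinfun.diff_right) (metis cos_minus minus_diff_eq)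
  moreover have "cos 1 \<noteq> (1::real)" using cos_monotone_0_pi[of 0 1] pi_gt3 by simp
  ultimately show ?thesis by metis
qed

lemma real_trig_poly_const: "(\<lambda>_. c) \<in> real_trig_poly"
  unfolding real_trig_poly_def by (simp add: trig_poly_const)

lemma real_trig_poly_add:
  "f \<in> real_trig_poly \<Longrightarrow> g \<in> real_trig_poly \<Longrightarrow> (\<lambda>x. f x + g x) \<in> real_trig_poly"
  unfolding real_trig_poly_def by (simp add: trig_poly.add)

lemma real_trig_poly_mult:
  "f \<in> real_trig_poly \<Longrightarrow> g \<in> real_trig_poly \<Longrightarrow> (\<lambda>x. f x * g x) \<in> real_trig_poly"
  unfolding real_trig_poly_def by (simp add: trig_poly_mult)

lemma real_polynomial_function_compose_real_trig_poly:
  assumes "real_polynomial_function (p :: real \<Rightarrow> real)" "g \<in> real_trig_poly"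
  shows "(\<lambda>x. p (g x)) \<in> real_trig_poly"
  using assms(1)
proof induction
  case (linear f)
  then obtain c where "f = (\<lambda>x. x * c)"
    using real_bounded_linear by blast
  then show ?case by (simp add: real_trig_poly_mult real_trig_poly_const assms(2))
qed (simp_all add: real_trig_poly_const real_trig_poly_add real_trig_poly_mult)

lemma function_ring_on_real_trig_poly:
  assumes "compact K"
  shows "function_ring_on (real_trig_poly :: ('w::real_normed_vector \<Rightarrow> real) set) K"
  by (intro function_ring_on.intro assms continuous_on_real_trig_poly real_trig_poly_const
      real_trig_poly_add real_trig_poly_mult real_trig_poly_separates)

text \<open>Truncation is nonexpansive and fixes \<open>y\<close>, so it never worsens an
  approximation to a function bounded by \<open>B\<close>.\<close>

lemma truncate_dist_le:
  fixes y t B :: real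
  assumes "\<bar>y\<bar> \<le> B"
  shows "\<bar>max (-B) (min B t) - y\<bar> \<le> \<bar>t - y\<bar>"
proof -
  have "-B \<le> y" "y \<le> B" "0 \<le> B" using assms by auto
  moreover consider "t > B" | "t < -B" | "-B \<le> t" "t \<le> B" by linarith
  ultimately show ?thesis by cases (simp_all add: max_def min_def)
qed

lemma abs_truncate_le:
  assumes "(B::real) \<ge> 0"
  shows "\<bar>max (-B) (min B t)\<bar> \<le> B"
  using assms by (simp add: abs_le_iff)

text \<open>
  Stone--Weierstrass only controls \<open>g\<close> on \<open>K\<close>. The global bound comes from composing with a
  polynomial that approximates the truncation at level \<open>B\<close> on the range of \<open>g\<close>.
\<close>

lemma real_trig_poly_approx:
  fixes f :: "'w::real_normed_vector \<Rightarrow> real"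
  assumes K: "compact K" and f: "continuous_on UNIV f" and B: "\<And>x. \<bar>f x\<bar> \<le> B" and e: "e > 0"
  shows "\<exists>g\<in>real_trig_poly. (\<forall>x\<in>K. \<bar>f x - g x\<bar> < e) \<and> (\<forall>x. \<bar>g x\<bar> \<le> B + e)"
proof -
  interpret function_ring_on "real_trig_poly :: ('w \<Rightarrow> real) set" K
    using K by (rule function_ring_on_real_trig_poly)
  have "continuous_on K f" using f by (rule continuous_on_subset) simp
  then obtain h where h: "h \<in> real_trig_poly" and "\<forall>x\<in>K. \<bar>f x - h x\<bar> < e / 2"
    using Stone_Weierstrass_basic[of f "e / 2"] half_gt_zero[OF e] by blast
  then have hK: "\<bar>f x - h x\<bar> < e / 2" if "x \<in> K" for x using that by blast
  obtain G where G: "\<And>x. \<bar>h x\<bar> \<le> G" using bounded_real_trig_poly[OF h] by blast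
  have cont: "continuous_on {-G..G} (\<lambda>t. max (-B) (min B t))"
    by (intro continuous_intros)
  obtain p where p: "real_polynomial_function p"
    "\<And>t. t \<in> {-G..G} \<Longrightarrow> \<bar>max (-B) (min B t) - p t\<bar> < e / 2"
    by (rule Stone_Weierstrass_real_polynomial_function[OF compact_Icc cont half_gt_zero[OF e]])
       (rule that)
  have pg: "\<bar>max (-B) (min B (h x)) - p (h x)\<bar> < e / 2" for x
  proof (rule p(2))
    show "h x \<in> {-G..G}" using G[of x] by (simp add: abs_le_iff minus_le_iff[of G])
  qed
  have B0: "B \<ge> 0" using order_trans[OF abs_ge_zero B] .
  have 1: "\<bar>f x - p (h x)\<bar> < e" if "x \<in> K" for x
  proof -
    define c where "c = max (-B) (min B (h x))"
    have "\<bar>c - f x\<bar> \<le> \<bar>h x - f x\<bar>" unfolding c_def by (rule truncate_dist_le[OF B])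
    moreover have "\<bar>c - p (h x)\<bar> < e / 2" unfolding c_def by (rule pg)
    moreover note hK[OF that]
    ultimately show ?thesis by linarith
  qed
  have 2: "\<bar>p (h x)\<bar> \<le> B + e" for x
  proof -
    define c where "c = max (-B) (min B (h x))"
    have "\<bar>c\<bar> \<le> B" unfolding c_def by (rule abs_truncate_le[OF B0])
    moreover have "\<bar>c - p (h x)\<bar> < e / 2" unfolding c_def by (rule pg)
    ultimately show ?thesis using e by linarith
  qed
  show ?thesis
    by (rule bexI[OF _ real_polynomial_function_compose_real_trig_poly[OF p(1) h]])
       (simp add: 1 2)
qed

section \<open>Weak convergence from tightness and characteristic functionals\<close>

definition char_fun :: "'b measure \<Rightarrow> ('b \<Rightarrow> 'w::real_normed_vector) \<Rightarrow> ('w \<Rightarrow>\<^sub>L real) \<Rightarrow> complex" where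
  "char_fun P Z \<psi> = (\<integral>w. iexp (blinfun_apply \<psi> (Z w)) \<partial>P)"

definition uniformly_tight :: "'a measure \<Rightarrow> (nat \<Rightarrow> 'a \<Rightarrow> 'w::topological_space) \<Rightarrow> bool" where
  "uniformly_tight M X \<longleftrightarrow>
    (\<forall>e>0. \<exists>K. compact K \<and> (\<forall>n\<ge>1. measure M {w\<in>space M. X n w \<notin> K} \<le> e))"

lemma measurable_blinfun_apply [measurable (raw)]:
  fixes Z :: "'b \<Rightarrow> 'w::real_normed_vector" and \<psi> :: "'w \<Rightarrow>\<^sub>L real"
  assumes "Z \<in> borel_measurable P"
  shows "(\<lambda>w. blinfun_apply \<psi> (Z w)) \<in> borel_measurable P"
  by (rule measurable_compose[OF assms borel_measurable_continuous_onI]) (intro continuous_intros)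

lemma (in prob_space) integrable_bounded_continuous:
  fixes f :: "'w::topological_space \<Rightarrow> 'c::{banach, second_countable_topology}"
  assumes "continuous_on UNIV f" "\<And>x. norm (f x) \<le> B" "X \<in> borel_measurable M"
  shows "integrable M (\<lambda>w. f (X w))"
proof (rule integrable_const_bound[of _ B])
  show "(\<lambda>w. f (X w)) \<in> borel_measurable M"
    by (rule measurable_compose[OF assms(3) borel_measurable_continuous_onI[OF assms(1)]])
qed (simp add: assms(2))

text \<open>Ulam's theorem: the law of \<open>Z\<close> is a finite Borel measure on a complete
  separable metric space, hence inner regular with respect to compact sets.\<close>

lemma (in prob_space) tight_single:
  fixes Z :: "'a \<Rightarrow> 'w::{banach, second_countable_topology}"
  assumes Z[measurable]: "Z \<in> borel_measurable M" and e: "e > 0"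
  shows "\<exists>K. compact K \<and> prob {w\<in>space M. Z w \<notin> K} \<le> e"
proof -
  interpret D: prob_space "distr M borel Z" using Z by (rule prob_space_distr)
  have "emeasure (distr M borel Z) UNIV =
      (SUP K\<in>{K. K \<subseteq> UNIV \<and> compact K}. emeasure (distr M borel Z) K)"
    using D.emeasure_finite by (intro inner_regular) (auto simp: less_top)
  then have "ennreal (1 - e) < (SUP K\<in>{K. K \<subseteq> UNIV \<and> compact K}. emeasure (distr M borel Z) K)"
    using D.emeasure_space_1 e by (simp add: ennreal_less_one_iff)
  then obtain K where K: "compact K" "ennreal (1 - e) < emeasure (distr M borel Z) K"
    unfolding less_SUP_iff by auto
  have [measurable]: "K \<in> sets borel" using K(1) by (intro borel_closed compact_imp_closed)
  have "1 - e < D.prob K"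
  proof (rule ccontr)
    assume "\<not> 1 - e < D.prob K"
    then have "emeasure (distr M borel Z) K \<le> ennreal (1 - e)"
      by (simp add: D.emeasure_eq_measure ennreal_leI)
    then show False using K(2) by simp
  qed
  also have "D.prob K = prob {w\<in>space M. Z w \<in> K}"
    by (subst measure_distr) (auto simp: vimage_def Int_def intro!: arg_cong[where f = prob])
  also have "\<dots> = 1 - prob {w\<in>space M. Z w \<notin> K}"
    by (subst prob_neg[symmetric]) (auto)
  finally show ?thesis using K(1) by (intro exI[of _ K]) auto
qed

text \<open>The crude extra error \<open>b\<close> is paid only on the exceptional event
  \<open>Q\<close>, which in the applications means leaving a compact set or two variables being far
  apart.\<close>

lemma (in prob_space) expectation_diff_le:
  fixes f g :: "'a \<Rightarrow> real"
  assumes f: "integrable M f" and g: "integrable M g" and A: "{w\<in>space M. Q w} \<in> events"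
    and le: "\<And>w. w \<in> space M \<Longrightarrow> \<not> Q w \<Longrightarrow> \<bar>f w - g w\<bar> \<le> a"
    and le': "\<And>w. w \<in> space M \<Longrightarrow> Q w \<Longrightarrow> \<bar>f w - g w\<bar> \<le> a + b"
  shows "\<bar>expectation f - expectation g\<bar> \<le> a + b * prob {w\<in>space M. Q w}"
proof -
  let ?I = "indicator {w\<in>space M. Q w} :: 'a \<Rightarrow> real"
  have I: "integrable M ?I" using A by (simp add: integrable_indicator_iff emeasure_eq_measure)
  have "\<bar>expectation f - expectation g\<bar> = \<bar>expectation (\<lambda>w. f w - g w)\<bar>"
    using f g by simp
  also have "\<dots> \<le> expectation (\<lambda>w. \<bar>f w - g w\<bar>)" by (rule integral_abs_bound)
  also have "\<dots> \<le> expectation (\<lambda>w. a + b * ?I w)"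
  proof (rule integral_mono)
    show "\<bar>f w - g w\<bar> \<le> a + b * ?I w" if "w \<in> space M" for w
      using le[OF that] le'[OF that] that by (cases "Q w") simp_all
  qed (use f g I in simp_all)
  also have "\<dots> = a + b * prob {w\<in>space M. Q w}"
    using I A by (simp add: prob_space)
  finally show ?thesis .
qed

lemma tendsto_integral_trig_poly:
  fixes X :: "nat \<Rightarrow> 'a \<Rightarrow> 'w::{banach, second_countable_topology}"
  assumes M: "prob_space M" and P: "prob_space P"
    and X: "\<And>n. n \<ge> 1 \<Longrightarrow> X n \<in> borel_measurable M" and Z: "Z \<in> borel_measurable P"
    and conv: "\<And>\<psi>. (\<lambda>n. char_fun M (X n) \<psi>) \<longlonglongrightarrow> char_fun P Z \<psi>"
    and f: "f \<in> trig_poly"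
  shows "(\<lambda>n. \<integral>w. f (X n w) \<partial>M) \<longlonglongrightarrow> (\<integral>w. f (Z w) \<partial>P)"
proof -
  interpret M: prob_space M by fact
  interpret P: prob_space P by fact
  have intM: "integrable M (\<lambda>w. g (X n w))" if "g \<in> trig_poly" "n \<ge> 1" for g n
    using bounded_trig_poly[OF that(1)] M.integrable_bounded_continuous[OF continuous_on_trig_poly[OF that(1)] _ X[OF that(2)]]
    by blast
  have intP: "integrable P (\<lambda>w. g (Z w))" if "g \<in> trig_poly" for g
    using bounded_trig_poly[OF that(1)] P.integrable_bounded_continuous[OF continuous_on_trig_poly[OF that(1)] _ Z]
    by blast
  show ?thesis
    using f
  proof induction
    case (iexp \<psi>)
    then show ?case using conv[of \<psi>] unfolding char_fun_def .
  next
    case (scale f c)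
    then show ?case by (simp add: tendsto_mult_left)
  next
    case (add f g)
    have "(\<lambda>n. (\<integral>w. f (X n w) \<partial>M) + (\<integral>w. g (X n w) \<partial>M)) \<longlonglongrightarrow> (\<integral>w. f (Z w) \<partial>P) + (\<integral>w. g (Z w) \<partial>P)"
      by (intro tendsto_add add.IH)
    moreover have "\<forall>\<^sub>F n in sequentially. (\<integral>w. f (X n w) \<partial>M) + (\<integral>w. g (X n w) \<partial>M) = (\<integral>w. f (X n w) + g (X n w) \<partial>M)"
      using eventually_ge_at_top[of 1]
    proof eventually_elim
      case (elim n)
      then show ?case using intM[OF add.hyps(1) elim] intM[OF add.hyps(2) elim] by simp
    qed
    ultimately have "(\<lambda>n. \<integral>w. f (X n w) + g (X n w) \<partial>M) \<longlonglongrightarrow> (\<integral>w. f (Z w) \<partial>P) + (\<integral>w. g (Z w) \<partial>P)"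
      by (rule Lim_transform_eventually)
    then show ?case using intP add.hyps by simp
  qed
qed

text \<open>The constant \<open>D\<close> may depend on the test function but not on
  \<open>e\<close>, so an error proportional to \<open>e\<close> is as good as \<open>e\<close>
  itself.\<close>

lemma tendsto_of_approximation:
  fixes a :: "nat \<Rightarrow> real"
  assumes D: "D \<ge> 0"
    and ap: "\<And>e. e > 0 \<Longrightarrow> e \<le> 1 \<Longrightarrow> \<exists>b c. b \<longlonglongrightarrow> c \<and> (\<forall>\<^sub>F n in sequentially. \<bar>a n - b n\<bar> \<le> D * e) \<and> \<bar>l - c\<bar> \<le> D * e"
  shows "a \<longlonglongrightarrow> l"
proof (rule tendstoI)
  fix r :: real assume r: "r > 0"
  define e where "e = min 1 (r / (3 * (D + 1)))"
  have e: "e > 0" "e \<le> 1" using r D by (auto simp: e_def)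
  have "D * e \<le> D * (r / (3 * (D + 1)))" using D by (intro mult_left_mono) (auto simp: e_def)
  also have "\<dots> < r / 3" using D r by (simp add: field_simps)
  finally have De: "D * e < r / 3" .
  obtain b c where b: "b \<longlonglongrightarrow> c" and ev: "\<forall>\<^sub>F n in sequentially. \<bar>a n - b n\<bar> \<le> D * e" and l: "\<bar>l - c\<bar> \<le> D * e"
    using ap[OF e] by blast
  have "0 < r / 3" using r by simp
  then have "\<forall>\<^sub>F n in sequentially. dist (b n) c < r / 3" by (rule tendstoD[OF b])
  with ev show "\<forall>\<^sub>F n in sequentially. dist (a n) l < r"
  proof eventually_elim
    case (elim n)
    then show ?case using l De unfolding dist_real_def by linarith
  qed
qed

lemma tendsto_in_distributionI:
  fixes X :: "nat \<Rightarrow> 'a \<Rightarrow> 'w::{banach, second_countable_topology}"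
  assumes M: "prob_space M" and P: "prob_space P"
    and X: "\<And>n. n \<ge> 1 \<Longrightarrow> X n \<in> borel_measurable M" and Z: "Z \<in> borel_measurable P"
    and tight: "uniformly_tight M X"
    and conv: "\<And>\<psi>. (\<lambda>n. char_fun M (X n) \<psi>) \<longlonglongrightarrow> char_fun P Z \<psi>"
  shows "tendsto_in_distribution M X P Z"
  unfolding tendsto_in_distribution_def
proof (intro conjI allI impI)
  fix f :: "'w \<Rightarrow> real" assume f: "continuous_on UNIV f" and "bounded (range f)"
  interpret M: prob_space M by fact
  interpret P: prob_space P by fact
  obtain B where B: "\<And>x. \<bar>f x\<bar> \<le> B" using \<open>bounded (range f)\<close> unfolding bounded_iff by auto
  have B0: "B \<ge> 0" using order_trans[OF abs_ge_zero B] .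
  show "(\<lambda>n. \<integral>w. f (X n w) \<partial>M) \<longlonglongrightarrow> (\<integral>w. f (Z w) \<partial>P)"
  proof (rule tendsto_of_approximation[where D = "2 * B + 2"])
    fix e :: real assume e: "e > 0" "e \<le> 1"
    obtain K1 where K1: "compact K1" "\<And>n. n \<ge> 1 \<Longrightarrow> M.prob {w\<in>space M. X n w \<notin> K1} \<le> e"
      using tight e unfolding uniformly_tight_def by blast
    obtain K2 where K2: "compact K2" "P.prob {w\<in>space P. Z w \<notin> K2} \<le> e"
      using P.tight_single[OF Z e(1)] by blast
    \<comment> \<open>One compact set for the sequence and for the limit, since the same
      trigonometric polynomial has to approximate \<open>f\<close> on both sides.\<close>
    define K where "K = K1 \<union> K2"
    have K: "compact K" unfolding K_def by (intro compact_Un K1 K2)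
    have Kb[measurable]: "K \<in> sets borel" "K1 \<in> sets borel" "K2 \<in> sets borel"
      using K K1(1) K2(1) by (auto intro: borel_closed compact_imp_closed)
    obtain g where g: "g \<in> real_trig_poly" "\<And>x. x \<in> K \<Longrightarrow> \<bar>f x - g x\<bar> < e" "\<And>x. \<bar>g x\<bar> \<le> B + e"
      using real_trig_poly_approx[OF K f B e(1)] by blast
    have g': "(\<lambda>x. complex_of_real (g x)) \<in> trig_poly" using g(1) unfolding real_trig_poly_def by simp
    have "(\<lambda>n. \<integral>w. complex_of_real (g (X n w)) \<partial>M) \<longlonglongrightarrow> (\<integral>w. complex_of_real (g (Z w)) \<partial>P)"
      by (rule tendsto_integral_trig_poly[OF M P X Z conv g'])
    then have lim: "(\<lambda>n. \<integral>w. g (X n w) \<partial>M) \<longlonglongrightarrow> (\<integral>w. g (Z w) \<partial>P)"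
      by (simp add: tendsto_of_real_iff)
    have gc: "continuous_on UNIV g" by (rule continuous_on_real_trig_poly[OF g(1)])
    \<comment> \<open>Outside \<open>K\<close> nothing is known of \<open>g\<close> except its
      global bound \<open>B + e\<close>, which is what keeps the mass off \<open>K\<close>
      cheap.\<close>
    have fg: "\<bar>f x - g x\<bar> \<le> e + 2 * B" for x
    proof -
      have "\<bar>f x - g x\<bar> \<le> \<bar>f x\<bar> + \<bar>g x\<bar>" by (rule abs_triangle_ineq4)
      then show ?thesis using B[of x] g(3)[of x] by linarith
    qed
    have fgK: "\<bar>f x - g x\<bar> \<le> e" if "\<not> x \<notin> K" for x using g(2)[of x] that by auto
    have De: "e + 2 * B * e \<le> (2 * B + 2) * e" using e by (simp add: algebra_simps)
    have "\<bar>(\<integral>w. f (X n w) \<partial>M) - (\<integral>w. g (X n w) \<partial>M)\<bar> \<le> (2 * B + 2) * e" if n: "n \<ge> 1" for n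
    proof -
      note [measurable] = X[OF n]
      have "\<bar>(\<integral>w. f (X n w) \<partial>M) - (\<integral>w. g (X n w) \<partial>M)\<bar> \<le> e + 2 * B * M.prob {w\<in>space M. X n w \<notin> K}"
      proof (rule M.expectation_diff_le)
        show "integrable M (\<lambda>w. f (X n w))"
          by (rule M.integrable_bounded_continuous[of f B, OF f _ X[OF n]]) (simp add: B)
        show "integrable M (\<lambda>w. g (X n w))"
          by (rule M.integrable_bounded_continuous[of g "B + e", OF gc _ X[OF n]]) (simp add: g(3))
      qed (use fg fgK in simp_all)
      also have "M.prob {w\<in>space M. X n w \<notin> K} \<le> M.prob {w\<in>space M. X n w \<notin> K1}"
        by (intro M.finite_measure_mono) (auto simp: K_def)
      also have "\<dots> \<le> e" by (rule K1(2)[OF n])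
      finally show ?thesis using B0 De by (simp add: mult_left_mono)
    qed
    then have ev: "\<forall>\<^sub>F n in sequentially. \<bar>(\<integral>w. f (X n w) \<partial>M) - (\<integral>w. g (X n w) \<partial>M)\<bar> \<le> (2 * B + 2) * e"
      by (rule eventually_mono[OF eventually_ge_at_top[of 1]])
    note [measurable] = Z
    have "\<bar>(\<integral>w. f (Z w) \<partial>P) - (\<integral>w. g (Z w) \<partial>P)\<bar> \<le> e + 2 * B * P.prob {w\<in>space P. Z w \<notin> K}"
    proof (rule P.expectation_diff_le)
      show "integrable P (\<lambda>w. f (Z w))"
        by (rule P.integrable_bounded_continuous[of f B, OF f _ Z]) (simp add: B)
      show "integrable P (\<lambda>w. g (Z w))"
        by (rule P.integrable_bounded_continuous[of g "B + e", OF gc _ Z]) (simp add: g(3))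
    qed (use fg fgK in simp_all)
    also have "P.prob {w\<in>space P. Z w \<notin> K} \<le> P.prob {w\<in>space P. Z w \<notin> K2}"
      by (intro P.finite_measure_mono) (auto simp: K_def)
    also have "\<dots> \<le> e" by (rule K2(2))
    finally have "\<bar>(\<integral>w. f (Z w) \<partial>P) - (\<integral>w. g (Z w) \<partial>P)\<bar> \<le> (2 * B + 2) * e"
      using B0 De by (simp add: mult_left_mono)
    with lim ev show "\<exists>b c. b \<longlonglongrightarrow> c \<and> (\<forall>\<^sub>F n in sequentially. \<bar>(\<integral>w. f (X n w) \<partial>M) - b n\<bar> \<le> (2 * B + 2) * e) \<and>
        \<bar>(\<integral>w. f (Z w) \<partial>P) - c\<bar> \<le> (2 * B + 2) * e" by blast
  qed (use B0 in simp)
qed (use X Z in auto)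

text \<open>Unlike in uniform continuity on \<open>K\<close>, the point \<open>y\<close> may lie off
  \<open>K\<close>: a perturbed variable is close to \<open>K\<close> but need not be in it.\<close>

lemma compact_continuous_near:
  fixes f :: "'w::metric_space \<Rightarrow> real"
  assumes K: "compact K" and f: "continuous_on UNIV f" and e: "e > 0"
  shows "\<exists>d>0. \<forall>x\<in>K. \<forall>y. dist y x < d \<longrightarrow> \<bar>f y - f x\<bar> < e"
proof (rule ccontr)
  assume "\<not> ?thesis"
  then have "\<exists>x\<in>K. \<exists>y. dist y x < 1 / Suc n \<and> \<not> \<bar>f y - f x\<bar> < e" for n
    by (metis divide_pos_pos of_nat_0_less_iff zero_less_Suc zero_less_one)
  then obtain x y where x: "\<And>n. x n \<in> K" and d: "\<And>n::nat. dist (y n) (x n) < 1 / Suc n"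
    and far: "\<And>n. \<not> \<bar>f (y n) - f (x n)\<bar> < e" by metis
  obtain l r where l: "l \<in> K" "strict_mono r" "(x \<circ> r) \<longlonglongrightarrow> l"
    using K x unfolding compact_def by metis
  have "(\<lambda>n. dist (y n) (x n)) \<longlonglongrightarrow> 0"
    using d by (intro tendsto_sandwich[OF _ _ tendsto_const LIMSEQ_Suc[OF lim_1_over_n]])
       (auto intro!: always_eventually less_imp_le)
  then have "((\<lambda>n. dist (y n) (x n)) \<circ> r) \<longlonglongrightarrow> 0" using l(2) by (rule LIMSEQ_subseq_LIMSEQ)
  then have "(\<lambda>n. dist (y (r n)) (x (r n)) + dist (x (r n)) l) \<longlonglongrightarrow> 0 + 0"
    using l(3) by (intro tendsto_add) (simp_all add: o_def tendsto_dist_iff[symmetric])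
  then have "(\<lambda>n. dist (y (r n)) l) \<longlonglongrightarrow> 0"
    by (intro tendsto_sandwich[where f = "\<lambda>_. 0" and g = "\<lambda>n. dist (y (r n)) l"])
       (simp_all add: dist_triangle)
  then have yl: "(y \<circ> r) \<longlonglongrightarrow> l"
    by (subst tendsto_dist_iff) (simp add: o_def)
  have c: "isCont f l" using f by (simp add: continuous_on_eq_continuous_at)
  have "(\<lambda>n. f ((y \<circ> r) n) - f ((x \<circ> r) n)) \<longlonglongrightarrow> f l - f l"
    by (intro tendsto_diff isCont_tendsto_compose[OF c] yl l(3))
  then have "\<forall>\<^sub>F n in sequentially. dist (f ((y \<circ> r) n) - f ((x \<circ> r) n)) 0 < e"
    using tendstoD e by fastforce
  then show False using far by (auto simp: eventually_sequentially)
qed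

text \<open>A Slutsky argument for test functions that are continuous but perhaps not uniformly so:
  tightness confines \<open>X\<close> to a compact set, near which \<open>f\<close> varies uniformly
  little.\<close>

lemma tendsto_in_distribution_perturb:
  fixes X :: "nat \<Rightarrow> 'a \<Rightarrow> 'w::{banach, second_countable_topology}"
  assumes M: "prob_space M"
    and V: "\<And>n. n \<ge> 1 \<Longrightarrow> V n \<in> borel_measurable M"
    and tight: "uniformly_tight M X"
    and conv: "tendsto_in_distribution M X P Z"
    and close: "\<And>e. e > 0 \<Longrightarrow> (\<lambda>n. measure M {w\<in>space M. dist (V n w) (X n w) > e}) \<longlonglongrightarrow> 0"
  shows "tendsto_in_distribution M V P Z"
  unfolding tendsto_in_distribution_def
proof (intro conjI allI impI)
  interpret M: prob_space M by fact
  have X: "\<And>n. n \<ge> 1 \<Longrightarrow> X n \<in> borel_measurable M" using conv unfolding tendsto_in_distribution_def by blast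
  fix f :: "'w \<Rightarrow> real" assume f: "continuous_on UNIV f" and bf: "bounded (range f)"
  obtain B where B: "\<And>x. \<bar>f x\<bar> \<le> B" using bf unfolding bounded_iff by auto
  have B0: "B \<ge> 0" using order_trans[OF abs_ge_zero B] .
  have lim: "(\<lambda>n. \<integral>w. f (X n w) \<partial>M) \<longlonglongrightarrow> (\<integral>w. f (Z w) \<partial>P)"
    using conv f bf unfolding tendsto_in_distribution_def by blast
  show "(\<lambda>n. \<integral>w. f (V n w) \<partial>M) \<longlonglongrightarrow> (\<integral>w. f (Z w) \<partial>P)"
  proof (rule tendsto_of_approximation[where D = "4 * B + 1"])
    fix e :: real assume e: "e > 0" "e \<le> 1"
    obtain K where K: "compact K" "\<And>n. n \<ge> 1 \<Longrightarrow> M.prob {w\<in>space M. X n w \<notin> K} \<le> e"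
      using tight e unfolding uniformly_tight_def by blast
    have Kb[measurable]: "K \<in> sets borel"
      using K(1) by (auto intro: borel_closed compact_imp_closed)
    obtain d where d: "d > 0" "\<And>x y. x \<in> K \<Longrightarrow> dist y x < d \<Longrightarrow> \<bar>f y - f x\<bar> < e"
      using compact_continuous_near[OF K(1) f e(1)] by blast
    have "\<forall>\<^sub>F n in sequentially. M.prob {w\<in>space M. dist (V n w) (X n w) > d / 2} < e"
      using order_tendstoD(2)[OF close[of "d / 2"]] d(1) e(1) by simp
    then have ev: "\<forall>\<^sub>F n in sequentially. \<bar>(\<integral>w. f (V n w) \<partial>M) - (\<integral>w. f (X n w) \<partial>M)\<bar> \<le> (4 * B + 1) * e"
      using eventually_ge_at_top[of 1]
    proof eventually_elim
      case (elim n)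
      note [measurable] = X[OF elim(2)] V[OF elim(2)]
      \<comment> \<open>\<open>d / 2\<close> rather than \<open>d\<close>: off \<open>?Q\<close> the
        distance satisfies only a weak inequality, while the choice of \<open>d\<close> calls for a
        strict one.\<close>
      let ?Q = "\<lambda>w. X n w \<notin> K \<or> dist (V n w) (X n w) > d / 2"
      have fx: "\<bar>f x - f y\<bar> \<le> e + 2 * B" for x y
      proof -
        have "\<bar>f x - f y\<bar> \<le> \<bar>f x\<bar> + \<bar>f y\<bar>" by (rule abs_triangle_ineq4)
        then show ?thesis using B[of x] B[of y] e(1) by linarith
      qed
      have "\<bar>(\<integral>w. f (V n w) \<partial>M) - (\<integral>w. f (X n w) \<partial>M)\<bar> \<le> e + 2 * B * M.prob {w\<in>space M. ?Q w}"
      proof (intro M.expectation_diff_le)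
        show "integrable M (\<lambda>w. f (V n w))"
          by (rule M.integrable_bounded_continuous[of f B, OF f _ V[OF elim(2)]]) (simp add: B)
        show "integrable M (\<lambda>w. f (X n w))"
          by (rule M.integrable_bounded_continuous[of f B, OF f _ X[OF elim(2)]]) (simp add: B)
        show "\<bar>f (V n w) - f (X n w)\<bar> \<le> e" if "\<not> ?Q w" for w
          using that d(1) by (intro less_imp_le d(2)) auto
        show "\<bar>f (V n w) - f (X n w)\<bar> \<le> e + 2 * B" for w by (rule fx)
      qed measurable
      also have "M.prob {w\<in>space M. ?Q w} \<le> M.prob ({w\<in>space M. X n w \<notin> K} \<union> {w\<in>space M. dist (V n w) (X n w) > d / 2})"
        by (intro M.finite_measure_mono) auto
      also have "\<dots> \<le> M.prob {w\<in>space M. X n w \<notin> K} + M.prob {w\<in>space M. dist (V n w) (X n w) > d / 2}"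
        by (intro measure_Un_le) measurable
      also have "\<dots> \<le> e + e" using K(2)[OF elim(2)] elim(1) by linarith
      finally show ?case using B0 by (simp add: mult_left_mono mult_right_mono algebra_simps)
    qed
    show "\<exists>b c. b \<longlonglongrightarrow> c \<and> (\<forall>\<^sub>F n in sequentially. \<bar>(\<integral>w. f (V n w) \<partial>M) - b n\<bar> \<le> (4 * B + 1) * e) \<and>
        \<bar>(\<integral>w. f (Z w) \<partial>P) - c\<bar> \<le> (4 * B + 1) * e"
      using lim ev e(1) B0 by (intro exI[of _ "\<lambda>n. \<integral>w. f (X n w) \<partial>M"] exI[of _ "\<integral>w. f (Z w) \<partial>P"]) simp
  qed (use B0 in simp)
qed (use V conv in \<open>auto simp: tendsto_in_distribution_def\<close>)

section \<open>Square-integrable and Gaussian random variables\<close>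

abbreviation second_moment :: "'a measure \<Rightarrow> ('a \<Rightarrow> 'w::real_normed_vector) \<Rightarrow> real" where
  "second_moment M V \<equiv> \<integral>w. (norm (V w))\<^sup>2 \<partial>M"

lemma L2_measurable: "X \<in> L2 M \<Longrightarrow> X \<in> borel_measurable M"
  by (simp add: L2_def)

lemma L2_integrable_norm_power2: "X \<in> L2 M \<Longrightarrow> integrable M (\<lambda>w. (norm (X w))\<^sup>2)"
  by (simp add: L2_def)

lemma L2_bound:
  assumes X: "X \<in> borel_measurable M" and g: "integrable M g" and le: "\<And>w. (norm (X w))\<^sup>2 \<le> g w"
  shows "X \<in> L2 M"
  unfolding L2_def mem_Collect_eq
proof
  show "integrable M (\<lambda>w. (norm (X w))\<^sup>2)"
  proof (rule Bochner_Integration.integrable_bound[OF g])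
    show "(\<lambda>w. (norm (X w))\<^sup>2) \<in> borel_measurable M" using X by measurable
    show "AE w in M. norm ((norm (X w))\<^sup>2) \<le> norm (g w)"
      using order_trans[OF le abs_ge_self] by (intro AE_I2) simp
  qed
qed (rule X)

lemma power2_norm_add_le:
  fixes x y :: "'w::real_normed_vector"
  shows "(norm (x + y))\<^sup>2 \<le> 2 * (norm x)\<^sup>2 + 2 * (norm y)\<^sup>2"
proof -
  have "(norm (x + y))\<^sup>2 \<le> (norm x + norm y)\<^sup>2"
    by (intro power_mono norm_triangle_ineq norm_ge_zero)
  also have "\<dots> \<le> 2 * (norm x)\<^sup>2 + 2 * (norm y)\<^sup>2"
    using sum_squares_bound[of "norm x" "norm y"] by (simp add: power2_sum)
  finally show ?thesis .
qed

lemma power2_norm_diff_le: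
  fixes x y :: "'w::real_normed_vector"
  shows "(norm (x - y))\<^sup>2 \<le> 2 * (norm x)\<^sup>2 + 2 * (norm y)\<^sup>2"
  using power2_norm_add_le[of x "- y"] by simp

lemma L2_add:
  assumes X: "X \<in> L2 M" and Y: "Y \<in> L2 M"
  shows "(\<lambda>w. X w + Y w) \<in> L2 M"
proof (rule L2_bound[where g = "\<lambda>w. 2 * (norm (X w))\<^sup>2 + 2 * (norm (Y w))\<^sup>2"])
  note [measurable] = L2_measurable[OF X] L2_measurable[OF Y]
  show "(\<lambda>w. X w + Y w) \<in> borel_measurable M" by measurable
qed (use X Y power2_norm_add_le in \<open>simp_all add: L2_def\<close>)

lemma L2_diff:
  assumes X: "X \<in> L2 M" and Y: "Y \<in> L2 M"
  shows "(\<lambda>w. X w - Y w) \<in> L2 M"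
proof (rule L2_bound[where g = "\<lambda>w. 2 * (norm (X w))\<^sup>2 + 2 * (norm (Y w))\<^sup>2"])
  note [measurable] = L2_measurable[OF X] L2_measurable[OF Y]
  show "(\<lambda>w. X w - Y w) \<in> borel_measurable M" by measurable
qed (use X Y power2_norm_diff_le in \<open>simp_all add: L2_def\<close>)

lemma L2_scaleR:
  fixes g :: "'a \<Rightarrow> real"
  assumes g: "g \<in> L2 M"
  shows "(\<lambda>w. g w *\<^sub>R x) \<in> L2 M"
proof (rule L2_bound[where g = "\<lambda>w. (norm (g w))\<^sup>2 * (norm x)\<^sup>2"])
  note [measurable] = L2_measurable[OF g]
  show "(\<lambda>w. g w *\<^sub>R x) \<in> borel_measurable M" by measurable
qed (use g in \<open>simp_all add: L2_def power_mult_distrib\<close>)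

lemma L2_zero: "(\<lambda>_. 0) \<in> L2 M"
  by (simp add: L2_def)

lemma L2_sum: "(\<And>i. i \<in> I \<Longrightarrow> X i \<in> L2 M) \<Longrightarrow> (\<lambda>w. \<Sum>i\<in>I. X i w) \<in> L2 M"
  by (induction I rule: infinite_finite_induct) (simp_all add: L2_zero L2_add)

lemma (in prob_space) L2_const: "(\<lambda>_. c) \<in> L2 M"
  by (simp add: L2_def)

lemma (in prob_space) L2_integrable:
  assumes X: "X \<in> L2 M"
  shows "integrable M X"
proof (rule Bochner_Integration.integrable_bound)
  show "integrable M (\<lambda>w. 1 + (norm (X w))\<^sup>2)"
    using L2_integrable_norm_power2[OF X] by simp
  have "norm x \<le> norm (1 + (norm x)\<^sup>2)" for x :: 'b
  proof -
    have "2 * norm x \<le> 1 + (norm x)\<^sup>2" using sum_squares_bound[of 1 "norm x"] by simp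
    then have "norm x \<le> 1 + (norm x)\<^sup>2" using norm_ge_zero[of x] by linarith
    then show ?thesis by simp
  qed
  then show "AE w in M. norm (X w) \<le> norm (1 + (norm (X w))\<^sup>2)" by simp
qed (rule L2_measurable[OF X])

lemma L2_integrable_mult:
  fixes X :: "'a \<Rightarrow> 'w::{banach, second_countable_topology}"
  assumes X: "X \<in> L2 M"
  shows "integrable M (\<lambda>w. blinfun_apply \<psi>1 (X w) * blinfun_apply \<psi>2 (X w) :: real)"
proof (rule Bochner_Integration.integrable_bound)
  note [measurable] = L2_measurable[OF X]
  show "integrable M (\<lambda>w. (norm \<psi>1 * norm \<psi>2) * (norm (X w))\<^sup>2)"
    using L2_integrable_norm_power2[OF X] by simp
  show "(\<lambda>w. blinfun_apply \<psi>1 (X w) * blinfun_apply \<psi>2 (X w)) \<in> borel_measurable M" by measurable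
  have "norm (blinfun_apply \<psi>1 x * blinfun_apply \<psi>2 x) \<le> norm ((norm \<psi>1 * norm \<psi>2) * (norm x)\<^sup>2)" for x
  proof -
    have "\<bar>blinfun_apply \<psi>1 x\<bar> * \<bar>blinfun_apply \<psi>2 x\<bar> \<le> (norm \<psi>1 * norm x) * (norm \<psi>2 * norm x)"
      using norm_blinfun[of \<psi>1 x] norm_blinfun[of \<psi>2 x] by (intro mult_mono) auto
    then show ?thesis by (simp add: abs_mult power2_eq_square mult_ac)
  qed
  then show "AE w in M. norm (blinfun_apply \<psi>1 (X w) * blinfun_apply \<psi>2 (X w)) \<le> norm ((norm \<psi>1 * norm \<psi>2) * (norm (X w))\<^sup>2)"
    by (intro AE_I2)
qed

section \<open>Variances of functionals and Gaussian laws\<close>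

definition functional_var :: "'b measure \<Rightarrow> ('b \<Rightarrow> 'w::real_normed_vector) \<Rightarrow> ('w \<Rightarrow>\<^sub>L real) \<Rightarrow> real" where
  "functional_var P X \<psi> = (\<integral>w. (blinfun_apply \<psi> (X w))\<^sup>2 \<partial>P)"

text \<open>Characteristic functionals show only the diagonal of the covariance form; polarization
  recovers the other values, so that whole covariances can be identified.\<close>

lemma covariance_polarization:
  fixes X :: "'b \<Rightarrow> 'w::{banach, second_countable_topology}"
  assumes X: "X \<in> L2 P" and mean: "(\<integral>w. X w \<partial>P) = 0"
  shows "covariance P X \<psi>1 \<psi>2 =
    (functional_var P X (\<psi>1 + \<psi>2) - functional_var P X \<psi>1 - functional_var P X \<psi>2) / 2"
proof -
  have "functional_var P X (\<psi>1 + \<psi>2) =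
    (\<integral>w. (blinfun_apply \<psi>1 (X w))\<^sup>2 + (blinfun_apply \<psi>2 (X w))\<^sup>2 + 2 * (blinfun_apply \<psi>1 (X w) * blinfun_apply \<psi>2 (X w)) \<partial>P)"
    by (simp add: functional_var_def plus_blinfun.rep_eq power2_sum mult.assoc)
  also have "\<dots> = functional_var P X \<psi>1 + functional_var P X \<psi>2 + 2 * covariance P X \<psi>1 \<psi>2"
    using L2_integrable_mult[OF X, of \<psi>1 \<psi>1] L2_integrable_mult[OF X, of \<psi>2 \<psi>2] L2_integrable_mult[OF X, of \<psi>1 \<psi>2]
    by (simp add: functional_var_def covariance_def mean power2_eq_square)
  finally show ?thesis by simp
qed

lemma functional_var_covariance:
  fixes X :: "'b \<Rightarrow> 'w::{banach, second_countable_topology}"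
  assumes "(\<integral>w. X w \<partial>P) = 0"
  shows "covariance P X \<psi> \<psi> = functional_var P X \<psi>"
  using assms by (simp add: covariance_def functional_var_def power2_eq_square)

lemma (in prob_space) integral_iexp_gaussian:
  assumes X: "real_gaussian M X" and mean: "expectation X = 0"
  shows "(\<integral>w. iexp (X w) \<partial>M) = exp (- (expectation (\<lambda>w. (X w)\<^sup>2)) / 2)"
proof -
  have [measurable]: "X \<in> borel_measurable M" using X unfolding real_gaussian_def by blast
  from X consider (nondeg) \<mu> \<sigma> where "\<sigma> > 0" "distributed M lborel X (normal_density \<mu> \<sigma>)"
    | (deg) c where "AE w in M. X w = c" unfolding real_gaussian_def by blast
  then show ?thesis
  proof cases
    case nondeg
    have \<mu>: "\<mu> = 0" using normal_distributed_expectation[OF nondeg] mean by simp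
    have var: "expectation (\<lambda>w. (X w)\<^sup>2) = \<sigma>\<^sup>2"
      using normal_distributed_variance[OF nondeg] mean by simp
    have "distributed M lborel (\<lambda>w. (X w - \<mu>) / \<sigma>) std_normal_density"
      by (rule normal_standard_normal_convert[OF nondeg(1), THEN iffD1, OF nondeg(2)])
    then have "distr M borel (\<lambda>w. X w / \<sigma>) = std_normal_distribution"
      unfolding distributed_def \<mu> by (simp cong: distr_cong)
    \<comment> \<open>Evaluation at \<open>\<sigma>\<close> undoes the division by
      \<open>\<sigma>\<close>, so the standard normal characteristic function suffices.\<close>
    then have "char (distr M borel (\<lambda>w. X w / \<sigma>)) \<sigma> = exp (- \<sigma>\<^sup>2 / 2)"
      by (simp add: char_std_normal_distribution)
    moreover have "char (distr M borel (\<lambda>w. X w / \<sigma>)) \<sigma> = (\<integral>w. iexp (X w) \<partial>M)"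
      unfolding char_def using nondeg(1) by (subst integral_distr) auto
    ultimately show ?thesis by (simp add: var)
  next
    case deg
    have "expectation X = expectation (\<lambda>_. c)" using deg by (intro integral_cong_AE) auto
    then have c: "c = 0" using mean by (simp add: prob_space)
    have "expectation (\<lambda>w. (X w)\<^sup>2) = expectation (\<lambda>_. 0)" using deg c by (intro integral_cong_AE) auto
    moreover have "(\<integral>w. iexp (X w) \<partial>M) = (\<integral>w. 1 \<partial>M)" using deg c by (intro integral_cong_AE) auto
    ultimately show ?thesis by (simp add: prob_space)
  qed
qed

text \<open>Levy uniqueness applied to \<open>X / sqrt s\<close>; the moments are read off the
  identified law. The case \<open>s = 0\<close> is separate because a point mass has no density and
  falls under the second alternative of \<open>real_gaussian\<close>.\<close>

lemma (in prob_space) gaussian_of_integral_iexp: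
  assumes X[measurable]: "X \<in> borel_measurable M" and s: "s \<ge> 0"
    and char: "\<And>t. (\<integral>w. iexp (t * X w) \<partial>M) = exp (- (t\<^sup>2 * s) / 2)"
  shows "real_gaussian M X" "expectation X = 0" "expectation (\<lambda>w. (X w)\<^sup>2) = s"
proof -
  have "real_gaussian M X \<and> expectation X = 0 \<and> expectation (\<lambda>w. (X w)\<^sup>2) = s"
  proof (cases "s = 0")
    case True
    interpret R: prob_space "return borel 0 :: real measure" by (rule prob_space_return) simp
    have "distr M borel X = return borel 0"
    proof (rule Levy_uniqueness)
      show "char (distr M borel X) = char (return borel 0)"
        unfolding char_def
        by (intro ext, subst integral_distr, simp, simp, subst integral_return, simp, simp)
           (simp add: char True flip: of_real_mult)
      show "real_distribution (return borel 0 :: real measure)"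
        by unfold_locales simp
    qed simp
    moreover have "AE x in return borel (0::real). x = 0" by (subst AE_return) auto
    ultimately have "AE x in distr M borel X. x = 0" by (simp only:)
    then have ae: "AE w in M. X w = 0" by (simp add: AE_distr_iff)
    have "expectation X = expectation (\<lambda>_. 0)" using ae by (intro integral_cong_AE) auto
    moreover have "expectation (\<lambda>w. (X w)\<^sup>2) = expectation (\<lambda>_. 0)" using ae by (intro integral_cong_AE) auto
    ultimately show ?thesis using ae True by (auto simp: real_gaussian_def)
  next
    case False
    define \<sigma> where "\<sigma> = sqrt s"
    have \<sigma>: "\<sigma> > 0" "\<sigma>\<^sup>2 = s" using False s by (auto simp: \<sigma>_def)
    have "distr M borel (\<lambda>w. X w / \<sigma>) = std_normal_distribution"
    proof (rule Levy_uniqueness)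
      show "char (distr M borel (\<lambda>w. X w / \<sigma>)) = char std_normal_distribution"
      proof
        fix t
        have "char (distr M borel (\<lambda>w. X w / \<sigma>)) t = (\<integral>w. iexp (t / \<sigma> * X w) \<partial>M)"
          unfolding char_def by (subst integral_distr) auto
        also have "\<dots> = exp (- ((t / \<sigma>)\<^sup>2 * s) / 2)" by (rule char)
        also have "(t / \<sigma>)\<^sup>2 * s = t\<^sup>2" using \<sigma> False by (simp add: power_divide)
        finally show "char (distr M borel (\<lambda>w. X w / \<sigma>)) t = char std_normal_distribution t"
          by (simp add: char_std_normal_distribution)
      qed
    qed (auto simp: real_dist_normal_dist)
    then have "distributed M lborel (\<lambda>w. (X w - 0) / \<sigma>) std_normal_density"
      unfolding distributed_def by (simp cong: distr_cong)
    then have d: "distributed M lborel X (normal_density 0 \<sigma>)"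
      by (rule normal_standard_normal_convert[OF \<sigma>(1), THEN iffD2])
    have m: "expectation X = 0" by (rule normal_distributed_expectation[OF \<sigma>(1) d])
    have "expectation (\<lambda>w. (X w)\<^sup>2) = s"
      using normal_distributed_variance[OF \<sigma>(1) d] \<sigma> m by simp
    with m d \<sigma> show ?thesis unfolding real_gaussian_def using X by blast
  qed
  then show "real_gaussian M X" "expectation X = 0" "expectation (\<lambda>w. (X w)\<^sup>2) = s" by blast+
qed

lemma char_fun_normal_rv:
  fixes Z :: "'b \<Rightarrow> 'w::{banach, second_countable_topology}" and Y :: "'a \<Rightarrow> 'w"
  assumes Z: "normal_rv P Z 0 (covariance M Y)" and Y: "(\<integral>w. Y w \<partial>M) = 0"
  shows "char_fun P Z \<psi> = exp (- functional_var M Y \<psi> / 2)"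
proof -
  interpret P: prob_space P using Z by (simp add: normal_rv_def)
  have ZL: "Z \<in> L2 P" and g: "gaussian P Z" and m: "(\<integral>w. Z w \<partial>P) = 0" and cov: "covariance P Z = covariance M Y"
    using Z by (auto simp: normal_rv_def)
  have "P.expectation (\<lambda>w. blinfun_apply \<psi> (Z w)) = blinfun_apply \<psi> (\<integral>w. Z w \<partial>P)"
    by (intro integral_bounded_linear blinfun.bounded_linear_right P.L2_integrable ZL)
  then have "P.expectation (\<lambda>w. blinfun_apply \<psi> (Z w)) = 0" by (simp add: m blinfun.zero_right)
  then have "char_fun P Z \<psi> = exp (- functional_var P Z \<psi> / 2)"
    unfolding char_fun_def functional_var_def
    using g unfolding gaussian_def by (intro P.integral_iexp_gaussian) auto
  also have "functional_var P Z \<psi> = functional_var M Y \<psi>"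
    using functional_var_covariance[OF m, of \<psi>] functional_var_covariance[OF Y, of \<psi>] cov by simp
  finally show ?thesis .
qed

text \<open>Testing on \<open>t *\<^sub>R \<psi>\<close> for all \<open>t\<close> yields the whole
  characteristic function of the scalar variable \<open>\<psi> (Z w)\<close>, hence its law, mean
  and variance.\<close>

lemma normal_rvI:
  fixes Z :: "'b \<Rightarrow> 'w::{banach, second_countable_topology}" and Y :: "'a \<Rightarrow> 'w"
  assumes P: "prob_space P" and Z: "Z \<in> L2 P" and Y: "Y \<in> L2 M" and mean: "(\<integral>w. Y w \<partial>M) = 0"
    and char: "\<And>\<psi>. char_fun P Z \<psi> = exp (- functional_var M Y \<psi> / 2)"
  shows "normal_rv P Z 0 (covariance M Y)"
proof -
  interpret P: prob_space P by fact
  have char_t: "(\<integral>w. iexp (t * blinfun_apply \<psi> (Z w)) \<partial>P) = exp (- (t\<^sup>2 * functional_var M Y \<psi>) / 2)" for \<psi> t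
    using char[of "t *\<^sub>R \<psi>"]
    by (simp add: char_fun_def functional_var_def scaleR_blinfun.rep_eq power_mult_distrib)
  have fv0: "functional_var M Y \<psi> \<ge> 0" for \<psi> unfolding functional_var_def by simp
  note mZ = measurable_blinfun_apply[OF L2_measurable[OF Z]]
  note G = P.gaussian_of_integral_iexp[OF mZ fv0 char_t]
  \<comment> \<open>Every functional of the Bochner mean vanishes, and functionals separate
    points.\<close>
  have mean_Z: "(\<integral>w. Z w \<partial>P) = 0"
  proof (rule ccontr)
    assume "(\<integral>w. Z w \<partial>P) \<noteq> 0"
    then obtain \<psi> :: "'w \<Rightarrow>\<^sub>L real" where \<psi>: "blinfun_apply \<psi> (\<integral>w. Z w \<partial>P) = 1"
      by (rule blinfun_separates)
    have "P.expectation (\<lambda>w. blinfun_apply \<psi> (Z w)) = blinfun_apply \<psi> (\<integral>w. Z w \<partial>P)"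
      by (intro integral_bounded_linear blinfun.bounded_linear_right P.L2_integrable Z)
    then show False using G(2)[of \<psi>] \<psi> by simp
  qed
  have "functional_var P Z \<psi> = functional_var M Y \<psi>" for \<psi>
    using G(3)[of \<psi>] unfolding functional_var_def .
  then have "covariance P Z = covariance M Y"
    by (intro ext) (simp add: covariance_polarization[OF Z mean_Z] covariance_polarization[OF Y mean])
  then show ?thesis
    unfolding normal_rv_def gaussian_def using P Z mean_Z G(1) L2_measurable[OF Z] by blast
qed

section \<open>Sums of independent identically distributed variables\<close>

lemma (in prob_space) indep_sets_reindex:
  assumes f: "inj_on f K" and F: "indep_sets F (f ` K)"
  shows "indep_sets (\<lambda>k. F (f k)) K"
proof (rule indep_setsI)
  show "F (f k) \<subseteq> events" if "k \<in> K" for k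
    using F that unfolding indep_sets_def by blast
  fix A J assume J: "J \<noteq> {}" "J \<subseteq> K" "finite J" and A: "\<forall>j\<in>J. A j \<in> F (f j)"
  define A' where "A' i = A (the_inv_into J f i)" for i
  have fJ: "inj_on f J" using f J(2) by (rule inj_on_subset)
  have A'f: "A' (f j) = A j" if "j \<in> J" for j
    using the_inv_into_f_f[OF fJ that] by (simp add: A'_def)
  have "prob (\<Inter>i\<in>f ` J. A' i) = (\<Prod>i\<in>f ` J. prob (A' i))"
    using J A A'f by (intro indep_setsD[OF F]) auto
  also have "(\<Prod>i\<in>f ` J. prob (A' i)) = (\<Prod>j\<in>J. prob (A' (f j)))"
    by (rule prod.reindex_cong[OF fJ]) simp_all
  finally show "prob (\<Inter>j\<in>J. A j) = (\<Prod>j\<in>J. prob (A j))"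
    using A'f by simp
qed

text \<open>Serves shifts: \<open>Suc\<close> turns indexing from 1 into indexing from 0, and
  \<open>(+) l\<close> moves a later block to start at 1, the form in which type 2 is
  stated.\<close>

lemma (in prob_space) indep_vars_reindex:
  assumes "inj_on f K" "indep_vars (\<lambda>_. N) X (f ` K)"
  shows "indep_vars (\<lambda>_. N) (\<lambda>k. X (f k)) K"
  using assms(2) indep_sets_reindex[OF assms(1), of "\<lambda>i. {X i -` A \<inter> space M |A. A \<in> sets N}"]
  unfolding indep_vars_def2 by simp

lemma iid_seq_measurable:
  assumes "prob_space M" "iid_seq M X" "k \<ge> 1"
  shows "X k \<in> borel_measurable M"
  using assms unfolding iid_seq_def prob_space.indep_vars_def[OF assms(1)] by simp

lemma iid_seq_compose:
  fixes X :: "nat \<Rightarrow> 'a \<Rightarrow> 'w::topological_space" and h :: "'w \<Rightarrow> 'v::topological_space"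
  assumes M: "prob_space M" and X: "iid_seq M X" and h[measurable]: "h \<in> borel_measurable borel"
  shows "iid_seq M (\<lambda>k w. h (X k w))"
  unfolding iid_seq_def
proof (intro conjI allI impI)
  interpret prob_space M by fact
  show "indep_vars (\<lambda>_. borel) (\<lambda>k w. h (X k w)) {1..}"
    using X h unfolding iid_seq_def
    by (intro indep_vars_compose2[of "\<lambda>_. borel" X "{1..}" "\<lambda>_. h" "\<lambda>_. borel"]) auto
  fix m :: nat assume m: "m \<ge> 1"
  have eq: "distr M borel (\<lambda>w. h (X k w)) = distr (distr M borel (X k)) borel h" if "k \<ge> 1" for k
    using iid_seq_measurable[OF M X that] by (subst distr_distr) (auto simp: o_def)
  have "distr M borel (X m) = distr M borel (X 1)"
    using X m unfolding iid_seq_def by blast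
  then show "distr M borel (\<lambda>w. h (X m w)) = distr M borel (\<lambda>w. h (X 1 w))"
    using eq[OF m] eq[of 1] by simp
qed

lemma iid_seq_integral:
  fixes g :: "'w::topological_space \<Rightarrow> 'c::{banach, second_countable_topology}"
  assumes M: "prob_space M" and X: "iid_seq M X" and m: "m \<ge> 1" and g[measurable]: "g \<in> borel_measurable borel"
  shows "integrable M (\<lambda>w. g (X m w)) \<longleftrightarrow> integrable M (\<lambda>w. g (X 1 w))"
    and "(\<integral>w. g (X m w) \<partial>M) = (\<integral>w. g (X 1 w) \<partial>M)"
proof -
  have d: "distr M borel (X m) = distr M borel (X 1)" using X m unfolding iid_seq_def by blast
  note mm = iid_seq_measurable[OF M X m] and m1 = iid_seq_measurable[OF M X order_refl]
  show "integrable M (\<lambda>w. g (X m w)) \<longleftrightarrow> integrable M (\<lambda>w. g (X 1 w))"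
    using integrable_distr_eq[OF mm g] integrable_distr_eq[OF m1 g] d by simp
  show "(\<integral>w. g (X m w) \<partial>M) = (\<integral>w. g (X 1 w) \<partial>M)"
    using integral_distr[OF mm g] integral_distr[OF m1 g] d by simp
qed

lemma iid_seq_L2:
  assumes M: "prob_space M" and X: "iid_seq M X" and L: "X 1 \<in> L2 M" and m: "m \<ge> 1"
  shows "X m \<in> L2 M"
  using iid_seq_integral(1)[OF M X m, of "\<lambda>x. (norm x)\<^sup>2"] L iid_seq_measurable[OF M X m]
  by (simp add: L2_def)

lemma iid_seq_mean:
  fixes X :: "nat \<Rightarrow> 'a \<Rightarrow> 'w::{banach, second_countable_topology}"
  assumes M: "prob_space M" and X: "iid_seq M X" and m: "m \<ge> 1"
  shows "(\<integral>w. X m w \<partial>M) = (\<integral>w. X 1 w \<partial>M)"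
  using iid_seq_integral(2)[OF M X m, of "\<lambda>x. x"] by simp

text \<open>The existential constant of \<open>type_2\<close> is made a parameter, since one and the
  same \<open>C\<close> runs through all later estimates, including the one carried over to Gaussian
  variables on another space.\<close>

definition type_2_bound :: "'a measure \<Rightarrow> 'w::{banach, second_countable_topology} itself \<Rightarrow> real \<Rightarrow> bool" where
  "type_2_bound M (_ :: 'w itself) C \<longleftrightarrow>
    C > 0 \<and> (\<forall>n\<ge>1. \<forall>X :: nat \<Rightarrow> 'a \<Rightarrow> 'w.
      (\<forall>k\<in>{1..n}. X k \<in> L2 M \<and> (\<integral>w. X k w \<partial>M) = 0) \<longrightarrow>
      prob_space.indep_vars M (\<lambda>_. borel) X {1..n} \<longrightarrow>
      (second_moment M (\<lambda>w. \<Sum>k=1..n. X k w)) \<le> C * (\<Sum>k=1..n. \<integral>w. (norm (X k w))\<^sup>2 \<partial>M))"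

lemma type_2_boundE:
  assumes "type_2 M TYPE('w::{banach, second_countable_topology})"
  obtains C where "type_2_bound M TYPE('w) C"
  using assms unfolding type_2_def type_2_bound_def by blast

text \<open>The offset \<open>l\<close> is there for the maximal inequality, which needs the bound
  for blocks starting in the middle of the sequence.\<close>

lemma type_2_bound_iid:
  fixes X :: "nat \<Rightarrow> 'a \<Rightarrow> 'w::{banach, second_countable_topology}"
  assumes M: "prob_space M" and C: "type_2_bound M TYPE('w) C"
    and X: "iid_seq M X" and L: "X 1 \<in> L2 M" and mean: "(\<integral>w. X 1 w \<partial>M) = 0"
  shows "second_moment M (\<lambda>w. \<Sum>k=1..n. X (l + k) w) \<le> C * real n * second_moment M (X 1)"
proof (cases "n = 0")
  case True
  then show ?thesis by simp
next
  case False
  interpret prob_space M by fact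
  have ind: "indep_vars (\<lambda>_. borel) (\<lambda>k. X (l + k)) {1..n}"
  proof (rule indep_vars_reindex)
    show "indep_vars (\<lambda>_. borel) X ((+) l ` {1..n})"
      using X unfolding iid_seq_def by (auto intro: indep_vars_subset)
  qed simp
  have "X (l + k) \<in> L2 M \<and> (\<integral>w. X (l + k) w \<partial>M) = 0" if "k \<in> {1..n}" for k
    using that iid_seq_L2[OF M X L, of "l + k"] iid_seq_mean[OF M X, of "l + k"] mean by simp
  then have "second_moment M (\<lambda>w. \<Sum>k=1..n. X (l + k) w) \<le> C * (\<Sum>k=1..n. \<integral>w. (norm (X (l + k) w))\<^sup>2 \<partial>M)"
    using C ind False unfolding type_2_bound_def by simp
  also have "(\<Sum>k=1..n. \<integral>w. (norm (X (l + k) w))\<^sup>2 \<partial>M) = (\<Sum>k=1..n. \<integral>w. (norm (X 1 w))\<^sup>2 \<partial>M)"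
    by (intro sum.cong refl iid_seq_integral(2)[OF M X, of _ "\<lambda>x. (norm x)\<^sup>2"]) auto
  finally show ?thesis by (simp add: mult.assoc)
qed

definition normalized_sum :: "(nat \<Rightarrow> 'a \<Rightarrow> 'w::real_normed_vector) \<Rightarrow> nat \<Rightarrow> 'a \<Rightarrow> 'w" where
  "normalized_sum X n w = (1 / sqrt (real n)) *\<^sub>R (\<Sum>k=1..n. X k w)"

lemma normalized_sum_L2:
  fixes X :: "nat \<Rightarrow> 'a \<Rightarrow> 'w::{banach, second_countable_topology}"
  assumes M: "prob_space M" and X: "iid_seq M X" and L: "X 1 \<in> L2 M"
  shows "normalized_sum X n \<in> L2 M"
proof -
  have S: "(\<lambda>w. \<Sum>k=1..n. X k w) \<in> L2 M"
    by (intro L2_sum iid_seq_L2[OF M X L]) simp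
  note [measurable] = L2_measurable[OF S]
  show ?thesis
  proof (rule L2_bound)
    show "normalized_sum X n \<in> borel_measurable M" unfolding normalized_sum_def by measurable
    show "integrable M (\<lambda>w. (1 / sqrt (real n))\<^sup>2 * (norm (\<Sum>k=1..n. X k w))\<^sup>2)"
      using L2_integrable_norm_power2[OF S] by simp
    show "(norm (normalized_sum X n w))\<^sup>2 \<le> (1 / sqrt (real n))\<^sup>2 * (norm (\<Sum>k=1..n. X k w))\<^sup>2" for w
      by (simp only: normalized_sum_def norm_scaleR power_mult_distrib power2_abs order_refl)
  qed
qed

lemma normalized_sum_second_moment:
  fixes X :: "nat \<Rightarrow> 'a \<Rightarrow> 'w::{banach, second_countable_topology}"
  assumes M: "prob_space M" and C: "type_2_bound M TYPE('w) C"
    and X: "iid_seq M X" and L: "X 1 \<in> L2 M" and mean: "(\<integral>w. X 1 w \<partial>M) = 0"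
  shows "second_moment M (\<lambda>w. normalized_sum X n w) \<le> C * second_moment M (X 1)"
proof -
  have "C > 0" using C unfolding type_2_bound_def by blast
  have "second_moment M (\<lambda>w. normalized_sum X n w) = (1 / real n) * second_moment M (\<lambda>w. \<Sum>k=1..n. X (0 + k) w)"
    by (simp add: normalized_sum_def power_mult_distrib power_divide)
  also have "\<dots> \<le> (1 / real n) * (C * real n * second_moment M (X 1))"
    by (intro mult_left_mono type_2_bound_iid[OF M C X L mean]) simp
  \<comment> \<open>An inequality only because of \<open>n = 0\<close>, where
    \<open>1 / 0 = 0\<close> makes the left side vanish.\<close>
  also have "\<dots> \<le> C * second_moment M (X 1)"
    using \<open>C > 0\<close> by simp
  finally show ?thesis .
qed

lemma (in prob_space) Chebyshev_norm:
  fixes V :: "'a \<Rightarrow> 'w::{banach, second_countable_topology}"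
  assumes V: "V \<in> L2 M" and a: "a > 0"
  shows "prob {w\<in>space M. norm (V w) > a} \<le> second_moment M V / a\<^sup>2"
proof -
  note [measurable] = L2_measurable[OF V]
  have "prob {w\<in>space M. norm (V w) > a} \<le> prob {w\<in>space M. (norm (V w))\<^sup>2 \<ge> a\<^sup>2}"
    using a by (intro finite_measure_mono) (auto intro: power_mono)
  also have "\<dots> \<le> second_moment M V / a\<^sup>2"
    using a by (intro integral_Markov_inequality_measure[where A = "space M"] L2_integrable_norm_power2 V) auto
  finally show ?thesis .
qed

lemma char_fun_normalized_sum:
  fixes X :: "nat \<Rightarrow> 'a \<Rightarrow> 'w::{banach, second_countable_topology}"
  assumes M: "prob_space M" and X: "iid_seq M X" and L: "X 1 \<in> L2 M" and mean: "(\<integral>w. X 1 w \<partial>M) = 0"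
  shows "(\<lambda>n. char_fun M (normalized_sum X n) \<psi>) \<longlonglongrightarrow> exp (- functional_var M (X 1) \<psi> / 2)"
proof -
  interpret prob_space M by fact
  \<comment> \<open>The scalar central limit theorem sums over \<open>i < n\<close>, hence the shift
    by one.\<close>
  define U where "U = (\<lambda>i w. blinfun_apply \<psi> (X (Suc i) w))"
  define v where "v = functional_var M (X 1) \<psi>"
  have iidU: "iid_seq M (\<lambda>k w. blinfun_apply \<psi> (X k w))"
    by (intro iid_seq_compose[OF M X]) measurable
  have mU[measurable]: "U i \<in> borel_measurable M" for i
    unfolding U_def using iid_seq_measurable[OF M iidU, of "Suc i"] by simp
  have U_sum: "blinfun_apply \<psi> (normalized_sum X n w) = (\<Sum>i<n. U i w) / sqrt (real n)" for n w
    by (simp add: normalized_sum_def U_def blinfun.scaleR_right blinfun.sum_right sum.atLeast1_atMost_eq)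
  have Ivar: "integrable M (\<lambda>w. (U i w)\<^sup>2)" for i
    using L2_integrable_mult[OF iid_seq_L2[OF M X L, of "Suc i"], of \<psi> \<psi>]
    by (simp add: U_def power2_eq_square)
  have var: "expectation (\<lambda>w. (U i w)\<^sup>2) = v" for i
    using iid_seq_integral(2)[OF M X, of "Suc i" "\<lambda>x. (blinfun_apply \<psi> x)\<^sup>2"]
    by (simp add: U_def v_def functional_var_def)
  have "expectation (\<lambda>w. blinfun_apply \<psi> (X 1 w)) = blinfun_apply \<psi> (\<integral>w. X 1 w \<partial>M)"
    by (intro integral_bounded_linear blinfun.bounded_linear_right L2_integrable L)
  also have "\<dots> = 0" by (simp only: mean blinfun.zero_right)
  finally have m0: "expectation (U i) = 0" for i
    using iid_seq_mean[OF M iidU, of "Suc i"] by (simp add: U_def)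
  have v0: "v \<ge> 0" unfolding v_def functional_var_def by simp
  have cf: "char_fun M (normalized_sum X n) \<psi> = (\<integral>w. iexp ((\<Sum>i<n. U i w) / sqrt (real n)) \<partial>M)" for n
    unfolding char_fun_def U_sum ..
  have "(\<lambda>n. char_fun M (normalized_sum X n) \<psi>) \<longlonglongrightarrow> exp (- v / 2)"
  \<comment> \<open>The scalar theorem requires positive variance; a degenerate functional vanishes
    almost surely along the whole sequence.\<close>
  proof (cases "v = 0")
    case True
    have "AE w in M. U i w = 0" for i
      using integral_nonneg_eq_0_iff_AE[OF Ivar[of i]] var[of i] True by simp
    then have ae: "AE w in M. \<forall>i. U i w = 0" by (simp add: AE_all_countable)
    have "char_fun M (normalized_sum X n) \<psi> = (\<integral>w. 1 \<partial>M)" for n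
      unfolding cf using ae by (intro integral_cong_AE) auto
    then show ?thesis using True by (simp add: prob_space)
  next
    case False
    define \<sigma> where "\<sigma> = sqrt v"
    have \<sigma>: "\<sigma> > 0" "\<sigma>\<^sup>2 = v" using False v0 by (auto simp: \<sigma>_def)
    have "indep_vars (\<lambda>_. borel) (\<lambda>k w. blinfun_apply \<psi> (X k w)) (Suc ` UNIV)"
      using iidU unfolding iid_seq_def by (auto intro: indep_vars_subset)
    then have ind: "indep_vars (\<lambda>_. borel) U UNIV"
      unfolding U_def by (intro indep_vars_reindex[of Suc UNIV borel "\<lambda>k w. blinfun_apply \<psi> (X k w)"]) auto
    have "weak_conv_m (\<lambda>n. distr M borel (\<lambda>x. (\<Sum>i<n. U i x) / sqrt (n * \<sigma>\<^sup>2))) std_normal_distribution"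
    proof (rule central_limit_theorem_zero_mean[OF ind m0 \<sigma>(1) Ivar])
      show "variance (U n) = \<sigma>\<^sup>2" for n using var[of n] m0[of n] \<sigma> by simp
      show "distr M borel (U n) = distr M borel (\<lambda>w. blinfun_apply \<psi> (X 1 w))" for n
      proof -
        have "\<And>m. m \<ge> 1 \<Longrightarrow> distr M borel (\<lambda>w. blinfun_apply \<psi> (X m w)) = distr M borel (\<lambda>w. blinfun_apply \<psi> (X 1 w))"
          using iidU unfolding iid_seq_def by blast
        from this[of "Suc n"] show ?thesis unfolding U_def by simp
      qed
    qed
    \<comment> \<open>The norming \<open>sqrt (n * \<sigma>\<^sup>2)\<close> is undone by evaluating
      at \<open>\<sigma>\<close>; other arguments of the characteristic function are covered by
      varying \<open>\<psi>\<close>.\<close>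
    then have "(\<lambda>n. char (distr M borel (\<lambda>x. (\<Sum>i<n. U i x) / sqrt (n * \<sigma>\<^sup>2))) \<sigma>) \<longlonglongrightarrow> char std_normal_distribution \<sigma>"
      by (intro levy_continuity1) (auto intro: real_dist_normal_dist)
    moreover have "char (distr M borel (\<lambda>x. (\<Sum>i<n. U i x) / sqrt (n * \<sigma>\<^sup>2))) \<sigma> = char_fun M (normalized_sum X n) \<psi>" for n
    proof -
      have eq: "\<sigma> * ((\<Sum>i<n. U i w) / sqrt (n * \<sigma>\<^sup>2)) = (\<Sum>i<n. U i w) / sqrt (real n)" for w
        using \<sigma>(1) by (simp add: real_sqrt_mult)
      have "char (distr M borel (\<lambda>x. (\<Sum>i<n. U i x) / sqrt (n * \<sigma>\<^sup>2))) \<sigma>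
          = (\<integral>w. iexp (\<sigma> * ((\<Sum>i<n. U i w) / sqrt (n * \<sigma>\<^sup>2))) \<partial>M)"
        unfolding char_def by (subst integral_distr) auto
      also have "\<dots> = (\<integral>w. iexp ((\<Sum>i<n. U i w) / sqrt (real n)) \<partial>M)"
        by (simp only: eq)
      finally show ?thesis unfolding cf .
    qed
    ultimately show ?thesis by (simp add: char_std_normal_distribution \<sigma>(2))
  qed
  then show ?thesis unfolding v_def .
qed

section \<open>Approximation by simple functions\<close>

text \<open>Jensen's inequality for the square, obtained from the nonnegative variance of
  \<open>norm (V w)\<close>.\<close>

lemma (in prob_space) norm_expectation_power2_le:
  fixes V :: "'a \<Rightarrow> 'w::{banach, second_countable_topology}"
  assumes V: "V \<in> L2 M"
  shows "(norm (expectation V))\<^sup>2 \<le> second_moment M V"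
proof -
  have "(norm (expectation V))\<^sup>2 \<le> (expectation (\<lambda>w. norm (V w)))\<^sup>2"
    by (intro power_mono integral_norm_bound norm_ge_zero)
  also have "\<dots> \<le> second_moment M V"
    using variance_eq[of "\<lambda>w. norm (V w)"] variance_positive[of "\<lambda>w. norm (V w)"]
      integrable_norm[OF L2_integrable[OF V]] L2_integrable_norm_power2[OF V] by simp
  finally show ?thesis .
qed

lemma (in prob_space) centered_second_moment_le:
  fixes V :: "'a \<Rightarrow> 'w::{banach, second_countable_topology}"
  assumes V: "V \<in> L2 M"
  shows "second_moment M (\<lambda>w. V w - expectation V) \<le> 4 * second_moment M V"
proof -
  have "second_moment M (\<lambda>w. V w - expectation V)
      \<le> expectation (\<lambda>w. 2 * (norm (V w))\<^sup>2 + 2 * (norm (expectation V))\<^sup>2)"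
    using L2_integrable_norm_power2[OF L2_diff[OF V L2_const]] L2_integrable_norm_power2[OF V] power2_norm_diff_le
    by (intro integral_mono) simp_all
  also have "\<dots> = 2 * second_moment M V + 2 * (norm (expectation V))\<^sup>2"
    using L2_integrable_norm_power2[OF V] by (simp add: prob_space)
  finally show ?thesis using norm_expectation_power2_le[OF V] by linarith
qed

text \<open>The simple maps act on \<open>'w\<close> and not on the sample space, so that one
  \<open>\<phi> j\<close> can be applied to every member of an i.i.d. sequence and yields an i.i.d.
  sequence again. The factor 9 of the dominating function is the square of \<open>1 + 2\<close>,
  from \<open>norm (\<phi> j x) \<le> 2 * norm x\<close>.\<close>

lemma (in prob_space) centered_simple_approximation:
  fixes X :: "'a \<Rightarrow> 'w::{banach, second_countable_topology}"
  assumes X: "X \<in> L2 M" and mean: "expectation X = 0"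
  obtains \<phi> :: "nat \<Rightarrow> 'w \<Rightarrow> 'w" where
    "\<And>j. \<phi> j \<in> borel_measurable borel" "\<And>j. finite (range (\<phi> j))"
    "(\<lambda>j. second_moment M (\<lambda>w. X w - (\<phi> j (X w) - expectation (\<lambda>w. \<phi> j (X w))))) \<longlonglongrightarrow> 0"
proof -
  note [measurable] = L2_measurable[OF X]
  obtain \<phi> :: "nat \<Rightarrow> 'w \<Rightarrow> 'w" where simple: "\<And>j. simple_function borel (\<phi> j)"
    and lim: "\<And>x. (\<lambda>j. \<phi> j x) \<longlonglongrightarrow> x" and le: "\<And>j x. dist (\<phi> j x) 0 \<le> 2 * dist x 0"
    using borel_measurable_implies_sequence_metric[of "\<lambda>x::'w. x" borel 0] by auto
  have [measurable]: "\<phi> j \<in> borel_measurable borel" for j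
    using simple by (rule borel_measurable_simple_function)
  have fin: "finite (range (\<phi> j))" for j
    using simple[of j] unfolding simple_function_def by simp
  define V where "V j w = X w - \<phi> j (X w)" for j w
  have bound: "(norm (x - \<phi> j x))\<^sup>2 \<le> 9 * (norm x)\<^sup>2" for j x
  proof -
    have "norm (x - \<phi> j x) \<le> norm x + norm (\<phi> j x)" by (rule norm_triangle_ineq4)
    also have "\<dots> \<le> 3 * norm x" using le[of j x] by simp
    finally have "(norm (x - \<phi> j x))\<^sup>2 \<le> (3 * norm x)\<^sup>2" by (intro power_mono) simp_all
    then show ?thesis by (simp add: power_mult_distrib)
  qed
  have VL: "V j \<in> L2 M" for j
  proof (rule L2_bound)
    show "V j \<in> borel_measurable M" unfolding V_def by measurable
    show "integrable M (\<lambda>w. 9 * (norm (X w))\<^sup>2)" using L2_integrable_norm_power2[OF X] by simp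
    show "(norm (V j w))\<^sup>2 \<le> 9 * (norm (X w))\<^sup>2" for w unfolding V_def by (rule bound)
  qed
  have "(\<lambda>j. second_moment M (V j)) \<longlonglongrightarrow> expectation (\<lambda>w. 0)"
  proof (rule integral_dominated_convergence)
    show "integrable M (\<lambda>w. 9 * (norm (X w))\<^sup>2)" using L2_integrable_norm_power2[OF X] by simp
    show "AE w in M. (\<lambda>j. (norm (V j w))\<^sup>2) \<longlonglongrightarrow> 0"
    proof (rule AE_I2)
      fix w
      have "(\<lambda>j. (norm (X w - \<phi> j (X w)))\<^sup>2) \<longlonglongrightarrow> (norm (X w - X w))\<^sup>2"
        by (intro tendsto_intros lim)
      then show "(\<lambda>j. (norm (V j w))\<^sup>2) \<longlonglongrightarrow> 0" by (simp add: V_def)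
    qed
    show "AE w in M. norm ((norm (V j w))\<^sup>2) \<le> 9 * (norm (X w))\<^sup>2" for j
      unfolding V_def using bound by (intro AE_I2) simp
    show "(\<lambda>w. (norm (V j w))\<^sup>2) \<in> borel_measurable M" for j unfolding V_def by measurable
  qed simp
  then have lim_V: "(\<lambda>j. 4 * second_moment M (V j)) \<longlonglongrightarrow> 0"
    by (intro tendsto_mult_right_zero) simp
  \<comment> \<open>Since \<open>X\<close> has mean zero, centring the simple part amounts to
    centring the error, which costs the factor 4.\<close>
  have centered: "X w - (\<phi> j (X w) - expectation (\<lambda>w. \<phi> j (X w))) = V j w - expectation (V j)" for j w
  proof -
    have "integrable M (\<lambda>w. X w - V j w)" by (intro Bochner_Integration.integrable_diff L2_integrable X VL)
    then have "integrable M (\<lambda>w. \<phi> j (X w))" by (simp add: V_def)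
    then have "expectation (V j) = - expectation (\<lambda>w. \<phi> j (X w))"
      unfolding V_def using L2_integrable[OF X] by (simp add: mean)
    then show ?thesis by (simp add: V_def)
  qed
  show ?thesis
  proof (rule that)
    show "(\<lambda>j. second_moment M (\<lambda>w. X w - (\<phi> j (X w) - expectation (\<lambda>w. \<phi> j (X w))))) \<longlonglongrightarrow> 0"
      unfolding centered
      by (rule tendsto_sandwich[OF _ _ tendsto_const lim_V])
         (simp_all add: centered_second_moment_le[OF VL])
  qed (simp_all add: fin)
qed

lemma sum_indicator_vimage:
  fixes \<phi> :: "'b \<Rightarrow> 'w::real_vector"
  assumes "finite (range \<phi>)"
  shows "\<phi> y = (\<Sum>x\<in>range \<phi>. (indicator (\<phi> -` {x}) y :: real) *\<^sub>R x)"
proof -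
  have "(\<Sum>x\<in>range \<phi>. (indicator (\<phi> -` {x}) y :: real) *\<^sub>R x) = (\<Sum>x\<in>range \<phi>. if \<phi> y = x then x else 0)"
    by (intro sum.cong) (auto simp: indicator_def)
  then show ?thesis using assms by simp
qed

text \<open>Finite range reduces the vector-valued problem to finitely many centred scalar
  coefficients on fixed vectors.\<close>

lemma (in prob_space) centered_simple_eq_sum:
  fixes \<phi> :: "'w::{banach, second_countable_topology} \<Rightarrow> 'w"
  assumes fin: "finite (range \<phi>)" and \<phi>[measurable]: "\<phi> \<in> borel_measurable borel" and X[measurable]: "X \<in> borel_measurable M"
  shows "\<phi> y - expectation (\<lambda>w. \<phi> (X w)) =
    (\<Sum>x\<in>range \<phi>. (indicator (\<phi> -` {x}) y - expectation (\<lambda>w. indicator (\<phi> -` {x}) (X w))) *\<^sub>R x)"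
proof -
  have [measurable]: "\<phi> -` {x} \<in> sets borel" for x
    using measurable_sets[OF \<phi>, of "{x}"] by simp
  have int: "integrable M (\<lambda>w. indicator (\<phi> -` {x}) (X w) :: real)" for x
    by (intro integrable_const_bound[of _ 1]) auto
  have "expectation (\<lambda>w. \<phi> (X w)) = expectation (\<lambda>w. \<Sum>x\<in>range \<phi>. (indicator (\<phi> -` {x}) (X w) :: real) *\<^sub>R x)"
    by (subst sum_indicator_vimage[OF fin]) simp
  also have "\<dots> = (\<Sum>x\<in>range \<phi>. expectation (\<lambda>w. indicator (\<phi> -` {x}) (X w)) *\<^sub>R x)"
    using int by (subst Bochner_Integration.integral_sum) auto
  finally show ?thesis
    by (subst sum_indicator_vimage[OF fin, of y]) (simp add: sum_subtractf scaleR_left_diff_distrib)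
qed

section \<open>Tightness of normalized sums\<close>

text \<open>Intersecting finite unions of closed balls over radii tending to 0 gives a closed,
  totally bounded set in a complete space; the failure probabilities \<open>q j\<close> are chosen
  to sum to \<open>e\<close>.\<close>

lemma (in prob_space) uniformly_tight_totally_bounded:
  fixes X :: "nat \<Rightarrow> 'a \<Rightarrow> 'w::{banach, second_countable_topology}"
  assumes X: "\<And>n. n \<ge> 1 \<Longrightarrow> X n \<in> borel_measurable M"
    and tb: "\<And>e d. e > 0 \<Longrightarrow> d > 0 \<Longrightarrow> \<exists>F. finite F \<and> (\<forall>n\<ge>1. prob {w\<in>space M. X n w \<notin> (\<Union>x\<in>F. cball x d)} \<le> e)"
  shows "uniformly_tight M X"
  unfolding uniformly_tight_def
proof (intro allI impI)
  fix e :: real assume e: "e > 0"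
  define d :: "nat \<Rightarrow> real" where "d j = inverse (real (Suc j))" for j
  define q :: "nat \<Rightarrow> real" where "q j = e * (1 / 2) ^ Suc j" for j
  have pos: "d j > 0" "q j > 0" for j using e by (auto simp: d_def q_def)
  have "\<forall>j. \<exists>F. finite F \<and> (\<forall>n\<ge>1. prob {w\<in>space M. X n w \<notin> (\<Union>x\<in>F. cball x (d j))} \<le> q j)"
    using tb pos by blast
  then obtain F where F: "\<And>j. finite (F j)"
    "\<And>j n. n \<ge> 1 \<Longrightarrow> prob {w\<in>space M. X n w \<notin> (\<Union>x\<in>F j. cball x (d j))} \<le> q j"
    by metis
  define U where "U j = (\<Union>x\<in>F j. cball x (d j))" for j
  have clU: "closed (U j)" for j unfolding U_def using F(1) by (intro closed_UN) auto
  have [measurable]: "U j \<in> sets borel" for j by (rule borel_closed[OF clU])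
  define K where "K = (\<Inter>j. U j)"
  have "compact K"
    unfolding compact_eq_totally_bounded complete_eq_closed
  proof (intro conjI allI impI)
    show "closed K" unfolding K_def using clU by (intro closed_INT) auto
    fix r :: real assume "r > 0"
    then obtain j where j: "d j < r" unfolding d_def using reals_Archimedean by blast
    have "U j \<subseteq> (\<Union>x\<in>F j. ball x r)" unfolding U_def using j by (intro UN_mono) auto
    then show "\<exists>k. finite k \<and> K \<subseteq> (\<Union>x\<in>k. ball x r)"
      using F(1)[of j] unfolding K_def by blast
  qed
  moreover have "prob {w\<in>space M. X n w \<notin> K} \<le> e" if n: "n \<ge> 1" for n
  proof -
    note [measurable] = X[OF n]
    have s: "q sums e" using sums_mult[OF power_half_series, of e] unfolding q_def by simp
    have le: "prob {w\<in>space M. X n w \<notin> U j} \<le> q j" for j using F(2)[OF n] unfolding U_def .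
    have sm: "summable (\<lambda>j. prob {w\<in>space M. X n w \<notin> U j})"
      by (rule summable_comparison_test'[OF sums_summable[OF s]]) (simp add: le)
    have "{w\<in>space M. X n w \<notin> K} = (\<Union>j. {w\<in>space M. X n w \<notin> U j})" unfolding K_def by auto
    also have "prob \<dots> \<le> (\<Sum>j. prob {w\<in>space M. X n w \<notin> U j})"
      by (intro finite_measure_subadditive_countably sm) auto
    also have "\<dots> \<le> (\<Sum>j. q j)" by (intro suminf_le le sm sums_summable[OF s])
    also have "\<dots> = e" using s by (rule sums_unique[symmetric])
    finally show ?thesis .
  qed
  ultimately show "\<exists>K. compact K \<and> (\<forall>n\<ge>1. prob {w\<in>space M. X n w \<notin> K} \<le> e)" by blast
qed

text \<open>The approximant may change with \<open>e\<close>, so its compact sets do not directly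
  provide one for \<open>X\<close>. At each accuracy they do provide a finite cover by small balls,
  which is what the criterion by total boundedness asks for.\<close>

lemma (in prob_space) uniformly_tight_approx:
  fixes X :: "nat \<Rightarrow> 'a \<Rightarrow> 'w::{banach, second_countable_topology}"
  assumes X: "\<And>n. n \<ge> 1 \<Longrightarrow> X n \<in> borel_measurable M"
    and ap: "\<And>e. e > 0 \<Longrightarrow> \<exists>V. uniformly_tight M V \<and> (\<forall>n\<ge>1. V n \<in> borel_measurable M \<and>
      prob {w\<in>space M. dist (V n w) (X n w) > e} \<le> e)"
  shows "uniformly_tight M X"
proof (rule uniformly_tight_totally_bounded[OF X])
  fix e d :: real assume ed: "e > 0" "d > 0"
  define r where "r = min (e / 2) (d / 2)"
  have r: "r > 0" "r \<le> e / 2" "r \<le> d / 2" using ed by (auto simp: r_def)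
  obtain V where V: "uniformly_tight M V" "\<And>n. n \<ge> 1 \<Longrightarrow> V n \<in> borel_measurable M"
    "\<And>n. n \<ge> 1 \<Longrightarrow> prob {w\<in>space M. dist (V n w) (X n w) > r} \<le> r"
    using ap[OF r(1)] by blast
  obtain K where K: "compact K" "\<And>n. n \<ge> 1 \<Longrightarrow> prob {w\<in>space M. V n w \<notin> K} \<le> e / 2"
    using V(1) half_gt_zero[OF ed(1)] unfolding uniformly_tight_def by blast
  have [measurable]: "K \<in> sets borel" using K(1) by (intro borel_closed compact_imp_closed)
  obtain F where F: "finite F" "K \<subseteq> (\<Union>x\<in>F. ball x (d / 2))"
    using K(1) half_gt_zero[OF ed(2)] unfolding compact_eq_totally_bounded by blast
  have "prob {w\<in>space M. X n w \<notin> (\<Union>x\<in>F. cball x d)} \<le> e" if n: "n \<ge> 1" for n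
  proof -
    note [measurable] = X[OF n] V(2)[OF n]
    have "{w\<in>space M. X n w \<notin> (\<Union>x\<in>F. cball x d)} \<subseteq>
        {w\<in>space M. V n w \<notin> K} \<union> {w\<in>space M. dist (V n w) (X n w) > r}"
    proof (rule subsetI, rule ccontr)
      fix w assume a: "w \<in> {w\<in>space M. X n w \<notin> (\<Union>x\<in>F. cball x d)}"
        and b: "w \<notin> {w\<in>space M. V n w \<notin> K} \<union> {w\<in>space M. dist (V n w) (X n w) > r}"
      have "V n w \<in> K" and c: "dist (V n w) (X n w) \<le> r" using a b by auto
      then obtain x where x: "x \<in> F" "dist x (V n w) < d / 2" using F(2) by auto
      have "dist x (X n w) \<le> dist x (V n w) + dist (V n w) (X n w)" by (rule dist_triangle)
      also have "\<dots> \<le> d" using x(2) c r(3) by linarith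
      finally show False using a x(1) by auto
    qed
    then have "prob {w\<in>space M. X n w \<notin> (\<Union>x\<in>F. cball x d)} \<le>
        prob ({w\<in>space M. V n w \<notin> K} \<union> {w\<in>space M. dist (V n w) (X n w) > r})"
      by (intro finite_measure_mono) measurable
    also have "\<dots> \<le> prob {w\<in>space M. V n w \<notin> K} + prob {w\<in>space M. dist (V n w) (X n w) > r}"
      by (intro measure_Un_le) measurable
    also have "\<dots> \<le> e" using K(2)[OF n] V(3)[OF n] r(2) by linarith
    finally show ?thesis .
  qed
  then show "\<exists>F. finite F \<and> (\<forall>n\<ge>1. prob {w\<in>space M. X n w \<notin> (\<Union>x\<in>F. cball x d)} \<le> e)"
    using F(1) by blast
qed

lemma (in prob_space) uniformly_tight_add:
  fixes X V :: "nat \<Rightarrow> 'a \<Rightarrow> 'w::{banach, second_countable_topology}"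
  assumes X: "\<And>n. n \<ge> 1 \<Longrightarrow> X n \<in> borel_measurable M" "uniformly_tight M X"
    and V: "\<And>n. n \<ge> 1 \<Longrightarrow> V n \<in> borel_measurable M" "uniformly_tight M V"
  shows "uniformly_tight M (\<lambda>n w. X n w + V n w)"
  unfolding uniformly_tight_def
proof (intro allI impI)
  fix e :: real assume "e > 0"
  then have e2: "e / 2 > 0" by simp
  obtain K where K: "compact K" "\<And>n. n \<ge> 1 \<Longrightarrow> prob {w\<in>space M. X n w \<notin> K} \<le> e / 2"
    using X(2) e2 unfolding uniformly_tight_def by blast
  obtain L where L: "compact L" "\<And>n. n \<ge> 1 \<Longrightarrow> prob {w\<in>space M. V n w \<notin> L} \<le> e / 2"
    using V(2) e2 unfolding uniformly_tight_def by blast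
  define S where "S = {x + y | x y. x \<in> K \<and> y \<in> L}"
  have S: "compact S" unfolding S_def by (rule compact_sums[OF K(1) L(1)])
  have [measurable]: "K \<in> sets borel" "L \<in> sets borel" "S \<in> sets borel"
    using K(1) L(1) S by (auto intro: borel_closed compact_imp_closed)
  have "prob {w\<in>space M. X n w + V n w \<notin> S} \<le> e" if n: "n \<ge> 1" for n
  proof -
    note [measurable] = X(1)[OF n] V(1)[OF n]
    have "prob {w\<in>space M. X n w + V n w \<notin> S} \<le> prob ({w\<in>space M. X n w \<notin> K} \<union> {w\<in>space M. V n w \<notin> L})"
      by (intro finite_measure_mono) (auto simp: S_def)
    also have "\<dots> \<le> prob {w\<in>space M. X n w \<notin> K} + prob {w\<in>space M. V n w \<notin> L}"
      by (intro measure_Un_le) measurable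
    also have "\<dots> \<le> e" using K(2)[OF n] L(2)[OF n] by linarith
    finally show ?thesis .
  qed
  then show "\<exists>K. compact K \<and> (\<forall>n\<ge>1. prob {w\<in>space M. X n w + V n w \<notin> K} \<le> e)"
    using S by blast
qed

lemma (in prob_space) uniformly_tight_sum:
  fixes X :: "'i \<Rightarrow> nat \<Rightarrow> 'a \<Rightarrow> 'w::{banach, second_countable_topology}"
  assumes "finite I" "\<And>i n. i \<in> I \<Longrightarrow> n \<ge> 1 \<Longrightarrow> X i n \<in> borel_measurable M"
    and "\<And>i. i \<in> I \<Longrightarrow> uniformly_tight M (X i)"
  shows "uniformly_tight M (\<lambda>n w. \<Sum>i\<in>I. X i n w)"
  using assms
proof (induction I)
  case empty
  show ?case by (auto simp: uniformly_tight_def intro!: exI[of _ "{0}"])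
next
  case (insert i I)
  have "uniformly_tight M (\<lambda>n w. X i n w + (\<Sum>i\<in>I. X i n w))"
  proof (rule uniformly_tight_add)
    show "(\<lambda>w. \<Sum>i\<in>I. X i n w) \<in> borel_measurable M" if "n \<ge> 1" for n
      using insert.prems(1) that by (intro borel_measurable_sum) auto
    show "uniformly_tight M (\<lambda>n w. \<Sum>i\<in>I. X i n w)" using insert by auto
  qed (use insert.prems in auto)
  then show ?case using insert.hyps by simp
qed

text \<open>The moment bound concerns the vectors \<open>t n w *\<^sub>R x\<close> and not the
  scalars, so that the type 2 inequality of \<open>'w\<close> can be used as it stands. Chebyshev
  then confines the variable to a segment of the line.\<close>

lemma (in prob_space) uniformly_tight_line:
  fixes x :: "'w::{banach, second_countable_topology}" and t :: "nat \<Rightarrow> 'a \<Rightarrow> real"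
  assumes t: "\<And>n. (\<lambda>w. t n w *\<^sub>R x) \<in> L2 M"
    and c: "\<And>n. second_moment M (\<lambda>w. t n w *\<^sub>R x) \<le> c"
  shows "uniformly_tight M (\<lambda>n w. t n w *\<^sub>R x)"
  unfolding uniformly_tight_def
proof (intro allI impI)
  fix e :: real assume e: "e > 0"
  show "\<exists>K. compact K \<and> (\<forall>n\<ge>1. prob {w\<in>space M. t n w *\<^sub>R x \<notin> K} \<le> e)"
  proof (cases "x = 0")
    case True
    then show ?thesis using e by (intro exI[of _ "{0}"]) simp
  next
    case False
    \<comment> \<open>Chosen so that the Chebyshev bound becomes \<open>e\<close>; the numerator
      \<open>\<bar>c\<bar> + 1\<close> keeps \<open>a\<close> positive for any
      \<open>c\<close>.\<close>
    define a where "a = sqrt ((\<bar>c\<bar> + 1) / e)"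
    have a: "a > 0" "a\<^sup>2 = (\<bar>c\<bar> + 1) / e" using e by (auto simp: a_def)
    define K where "K = (\<lambda>s. s *\<^sub>R x) ` {- (a / norm x)..a / norm x}"
    have K: "compact K" unfolding K_def by (intro compact_continuous_image continuous_intros) auto
    have [measurable]: "K \<in> sets borel" using K by (intro borel_closed compact_imp_closed)
    have "prob {w\<in>space M. t n w *\<^sub>R x \<notin> K} \<le> e" for n
    proof -
      note [measurable] = L2_measurable[OF t[of n]]
      have "s *\<^sub>R x \<in> K" if "\<not> norm (s *\<^sub>R x) > a" for s
      proof -
        have "\<bar>s\<bar> \<le> a / norm x" using that False by (simp add: field_simps)
        then show ?thesis unfolding K_def by (intro imageI) auto
      qed
      then have "prob {w\<in>space M. t n w *\<^sub>R x \<notin> K} \<le> prob {w\<in>space M. norm (t n w *\<^sub>R x) > a}"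
        by (intro finite_measure_mono) (blast, measurable)
      also have "\<dots> \<le> second_moment M (\<lambda>w. t n w *\<^sub>R x) / a\<^sup>2"
        by (rule Chebyshev_norm[OF t a(1)])
      also have "\<dots> \<le> (\<bar>c\<bar> + 1) / a\<^sup>2" using c[of n] by (intro divide_right_mono) auto
      also have "\<dots> = e" using a e by simp
      finally show ?thesis .
    qed
    then show ?thesis using K by blast
  qed
qed

section \<open>The central limit theorem in spaces of type 2\<close>

lemma normalized_sum_diff:
  "normalized_sum (\<lambda>k w. X k w - V k w) n w = normalized_sum X n w - normalized_sum V n w"
  by (simp add: normalized_sum_def sum_subtractf scaleR_diff_right)

lemma normalized_sum_sum:
  "normalized_sum (\<lambda>k w. \<Sum>i\<in>I. X i k w) n w = (\<Sum>i\<in>I. normalized_sum (X i) n w)"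
  by (simp add: normalized_sum_def scaleR_sum_right sum.swap[of _ I])

lemma normalized_sum_scaleR:
  "normalized_sum (\<lambda>k w. g k w *\<^sub>R x) n w = normalized_sum g n w *\<^sub>R x"
  unfolding normalized_sum_def scaleR_sum_left[symmetric] by simp

lemma uniformly_tight_normalized_sum_line:
  fixes X :: "nat \<Rightarrow> 'a \<Rightarrow> 'w::{banach, second_countable_topology}" and g :: "'w \<Rightarrow> real" and x :: 'w
  assumes M: "prob_space M" and C: "type_2_bound M TYPE('w) C" and X: "iid_seq M X"
    and g[measurable]: "g \<in> borel_measurable borel" and gL: "(\<lambda>w. g (X 1 w)) \<in> L2 M"
    and mean: "(\<integral>w. g (X 1 w) \<partial>M) = 0"
  shows "uniformly_tight M (normalized_sum (\<lambda>k w. g (X k w) *\<^sub>R x))"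
proof -
  interpret prob_space M by fact
  have iid: "iid_seq M (\<lambda>k w. g (X k w) *\<^sub>R x)"
    by (rule iid_seq_compose[OF M X, of "\<lambda>y. g y *\<^sub>R x"]) measurable
  have L: "(\<lambda>w. g (X 1 w) *\<^sub>R x) \<in> L2 M" by (rule L2_scaleR[OF gL])
  have m: "(\<integral>w. g (X 1 w) *\<^sub>R x \<partial>M) = 0"
    using L2_integrable[OF gL] mean by simp
  have eq: "normalized_sum (\<lambda>k w. g (X k w) *\<^sub>R x) n = (\<lambda>w. normalized_sum (\<lambda>k w. g (X k w)) n w *\<^sub>R x)" for n
    by (rule ext, rule normalized_sum_scaleR)
  have "uniformly_tight M (\<lambda>n w. normalized_sum (\<lambda>k w. g (X k w)) n w *\<^sub>R x)"
  proof (rule uniformly_tight_line)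
    show "(\<lambda>w. normalized_sum (\<lambda>k w. g (X k w)) n w *\<^sub>R x) \<in> L2 M" for n
      using normalized_sum_L2[OF M iid L, of n] unfolding eq .
    show "second_moment M (\<lambda>w. normalized_sum (\<lambda>k w. g (X k w)) n w *\<^sub>R x)
        \<le> C * second_moment M (\<lambda>w. g (X 1 w) *\<^sub>R x)" for n
      using normalized_sum_second_moment[OF M C iid L m, of n] unfolding eq .
  qed
  then show ?thesis unfolding eq[abs_def] .
qed

lemma uniformly_tight_normalized_sum_simple:
  fixes X :: "nat \<Rightarrow> 'a \<Rightarrow> 'w::{banach, second_countable_topology}" and \<phi> :: "'w \<Rightarrow> 'w"
  assumes M: "prob_space M" and C: "type_2_bound M TYPE('w) C" and X: "iid_seq M X"
    and \<phi>[measurable]: "\<phi> \<in> borel_measurable borel" and fin: "finite (range \<phi>)"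
  shows "uniformly_tight M (normalized_sum (\<lambda>k w. \<phi> (X k w) - (\<integral>w'. \<phi> (X 1 w') \<partial>M)))"
proof -
  interpret prob_space M by fact
  have [measurable]: "X 1 \<in> borel_measurable M" by (rule iid_seq_measurable[OF M X]) simp
  have [measurable]: "\<phi> -` {x} \<in> sets borel" for x
    using measurable_sets[OF \<phi>, of "{x}"] by simp
  define g :: "'w \<Rightarrow> 'w \<Rightarrow> real" where
    "g x y = indicator (\<phi> -` {x}) y - expectation (\<lambda>w. indicator (\<phi> -` {x}) (X 1 w))" for x y
  have gm[measurable]: "g x \<in> borel_measurable borel" for x unfolding g_def by measurable
  have indL: "(\<lambda>w. indicator (\<phi> -` {x}) (X 1 w) :: real) \<in> L2 M" for x
    by (rule L2_bound[where g = "\<lambda>_. 1"]) (measurable, simp_all add: indicator_def)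
  have gL: "(\<lambda>w. g x (X 1 w)) \<in> L2 M" for x
    unfolding g_def by (intro L2_diff indL L2_const)
  have gmean: "expectation (\<lambda>w. g x (X 1 w)) = 0" for x
    unfolding g_def using L2_integrable[OF indL[of x]] by (simp add: prob_space)
  have tight: "uniformly_tight M (normalized_sum (\<lambda>k w. g x (X k w) *\<^sub>R x))" for x
    by (rule uniformly_tight_normalized_sum_line[OF M C X gm gL gmean])
  have "uniformly_tight M (\<lambda>n w. \<Sum>x\<in>range \<phi>. normalized_sum (\<lambda>k w. g x (X k w) *\<^sub>R x) n w)"
  proof (rule uniformly_tight_sum[OF fin])
    fix x :: 'w and n :: nat
    have iid: "iid_seq M (\<lambda>k w. g x (X k w) *\<^sub>R x)"
      by (rule iid_seq_compose[OF M X, of "\<lambda>y. g x y *\<^sub>R x"]) measurable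
    show "normalized_sum (\<lambda>k w. g x (X k w) *\<^sub>R x) n \<in> borel_measurable M"
      by (rule L2_measurable[OF normalized_sum_L2[OF M iid L2_scaleR[OF gL]]])
  qed (rule tight)
  moreover have "\<phi> y - expectation (\<lambda>w'. \<phi> (X 1 w')) = (\<Sum>x\<in>range \<phi>. g x y *\<^sub>R x)" for y
    unfolding g_def by (rule centered_simple_eq_sum[OF fin \<phi>]) measurable
  then have "normalized_sum (\<lambda>k w. \<phi> (X k w) - expectation (\<lambda>w'. \<phi> (X 1 w'))) =
      (\<lambda>n w. \<Sum>x\<in>range \<phi>. normalized_sum (\<lambda>k w. g x (X k w) *\<^sub>R x) n w)"
    by (intro ext) (simp only: normalized_sum_sum)
  ultimately show ?thesis by (simp only:)
qed

lemma uniformly_tight_normalized_sum: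
  fixes X :: "nat \<Rightarrow> 'a \<Rightarrow> 'w::{banach, second_countable_topology}"
  assumes M: "prob_space M" and C: "type_2_bound M TYPE('w) C" and X: "iid_seq M X"
    and L: "X 1 \<in> L2 M" and mean: "(\<integral>w. X 1 w \<partial>M) = 0"
  shows "uniformly_tight M (normalized_sum X)"
proof -
  interpret prob_space M by fact
  have C0: "C > 0" using C unfolding type_2_bound_def by blast
  have mX: "normalized_sum X n \<in> borel_measurable M" for n
    by (rule L2_measurable[OF normalized_sum_L2[OF M X L]])
  obtain \<phi> :: "nat \<Rightarrow> 'w \<Rightarrow> 'w" where \<phi>: "\<And>j. \<phi> j \<in> borel_measurable borel" "\<And>j. finite (range (\<phi> j))"
    "(\<lambda>j. second_moment M (\<lambda>w. X 1 w - (\<phi> j (X 1 w) - expectation (\<lambda>w. \<phi> j (X 1 w))))) \<longlonglongrightarrow> 0"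
    using centered_simple_approximation[OF L mean] by blast
  show ?thesis
  proof (rule uniformly_tight_approx[OF mX])
    fix e :: real assume e: "e > 0"
    \<comment> \<open>After the factor \<open>C\<close> of type 2 and the division by
      \<open>e\<^sup>2\<close> in Chebyshev, this threshold leaves a probability of at most
      \<open>e\<close>.\<close>
    have "e * e\<^sup>2 / C > 0" using e C0 by simp
    from eventually_happens'[OF sequentially_bot order_tendstoD(2)[OF \<phi>(3) this]]
    obtain j where j: "second_moment M (\<lambda>w. X 1 w - (\<phi> j (X 1 w) - expectation (\<lambda>w. \<phi> j (X 1 w)))) < e * e\<^sup>2 / C"
      by blast
    define m where "m = expectation (\<lambda>w. \<phi> j (X 1 w))"
    define V where "V = (\<lambda>k w. \<phi> j (X k w) - m)"
    define D where "D = (\<lambda>k w. X k w - V k w)"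
    note [measurable] = \<phi>(1)[of j]
    have iidV: "iid_seq M V" unfolding V_def
      by (rule iid_seq_compose[OF M X, of "\<lambda>y. \<phi> j y - m"]) measurable
    have iidD: "iid_seq M D" unfolding D_def V_def
      by (rule iid_seq_compose[OF M X, of "\<lambda>y. y - (\<phi> j y - m)"]) measurable
    obtain B where B: "\<And>x. x \<in> range (\<phi> j) \<Longrightarrow> norm x \<le> B"
      using finite_imp_bounded[OF \<phi>(2)[of j]] unfolding bounded_iff by blast
    have [measurable]: "X 1 \<in> borel_measurable M" by (rule L2_measurable[OF L])
    have \<phi>L: "(\<lambda>w. \<phi> j (X 1 w)) \<in> L2 M"
      by (rule L2_bound[where g = "\<lambda>_. B\<^sup>2"]) (measurable, simp_all add: power_mono B)
    have VL: "V 1 \<in> L2 M" unfolding V_def by (intro L2_diff \<phi>L L2_const)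
    have DL: "D 1 \<in> L2 M" unfolding D_def by (intro L2_diff L VL)
    have Vmean: "expectation (V 1) = 0"
      unfolding V_def using L2_integrable[OF \<phi>L] by (simp add: m_def prob_space)
    have Dmean: "expectation (D 1) = 0"
      unfolding D_def using L2_integrable[OF VL] L2_integrable[OF L] Vmean mean by simp
    have "second_moment M (D 1) \<le> e * e\<^sup>2 / C"
      using j unfolding D_def V_def m_def by simp
    then have small: "C * second_moment M (D 1) \<le> e * e\<^sup>2"
      using C0 by (simp add: field_simps)
    have "uniformly_tight M (normalized_sum V)"
      unfolding V_def m_def by (rule uniformly_tight_normalized_sum_simple[OF M C X \<phi>(1) \<phi>(2)])
    moreover have "normalized_sum V n \<in> borel_measurable M" for n
      by (rule L2_measurable[OF normalized_sum_L2[OF M iidV VL]])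
    moreover have "prob {w\<in>space M. dist (normalized_sum V n w) (normalized_sum X n w) > e} \<le> e" for n
    proof -
      have "dist (normalized_sum V n w) (normalized_sum X n w) = norm (normalized_sum D n w)" for w
        unfolding D_def normalized_sum_diff by (simp add: dist_norm norm_minus_commute)
      then have "prob {w\<in>space M. dist (normalized_sum V n w) (normalized_sum X n w) > e} = prob {w\<in>space M. norm (normalized_sum D n w) > e}"
        by simp
      also have "\<dots> \<le> second_moment M (\<lambda>w. normalized_sum D n w) / e\<^sup>2"
        by (rule Chebyshev_norm[OF normalized_sum_L2[OF M iidD DL] e])
      also have "\<dots> \<le> (e * e\<^sup>2) / e\<^sup>2"
        by (intro divide_right_mono order_trans[OF normalized_sum_second_moment[OF M C iidD DL Dmean] small]) simp
      also have "\<dots> = e" using e by simp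
      finally show ?thesis .
    qed
    ultimately show "\<exists>V. uniformly_tight M V \<and> (\<forall>n\<ge>1. V n \<in> borel_measurable M \<and>
      prob {w\<in>space M. dist (V n w) (normalized_sum X n w) > e} \<le> e)" by blast
  qed
qed

theorem type_2_central_limit:
  fixes X :: "nat \<Rightarrow> 'a \<Rightarrow> 'w::{banach, second_countable_topology}"
  assumes M: "prob_space M" and C: "type_2_bound M TYPE('w) C" and X: "iid_seq M X"
    and L: "X 1 \<in> L2 M" and mean: "(\<integral>w. X 1 w \<partial>M) = 0"
    and Z: "normal_rv P Z 0 (covariance M (X 1))"
  shows "tendsto_in_distribution M (normalized_sum X) P Z"
proof (rule tendsto_in_distributionI[OF M])
  show "prob_space P" "Z \<in> borel_measurable P"
    using Z by (auto simp: normal_rv_def intro: L2_measurable)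
  show "normalized_sum X n \<in> borel_measurable M" for n
    by (rule L2_measurable[OF normalized_sum_L2[OF M X L]])
  show "uniformly_tight M (normalized_sum X)"
    by (rule uniformly_tight_normalized_sum[OF M C X L mean])
  show "(\<lambda>n. char_fun M (normalized_sum X n) \<psi>) \<longlonglongrightarrow> char_fun P Z \<psi>" for \<psi>
    unfolding char_fun_normal_rv[OF Z mean] by (rule char_fun_normalized_sum[OF M X L mean])
qed

text \<open>\<open>Z\<close> lives on \<open>P\<close>, where no type 2 inequality is assumed, so
  the bound is transported from \<open>M\<close> by weak convergence. The truncated squares are
  bounded continuous test functions; dominated convergence removes the truncation, as
  \<open>Z\<close> lies in \<open>L2\<close>.\<close>

corollary normal_rv_second_moment:
  fixes X :: "nat \<Rightarrow> 'a \<Rightarrow> 'w::{banach, second_countable_topology}"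
  assumes M: "prob_space M" and C: "type_2_bound M TYPE('w) C" and X: "iid_seq M X"
    and L: "X 1 \<in> L2 M" and mean: "(\<integral>w. X 1 w \<partial>M) = 0"
    and Z: "normal_rv P Z 0 (covariance M (X 1))"
  shows "second_moment P Z \<le> C * second_moment M (X 1)"
proof -
  interpret M: prob_space M by fact
  interpret P: prob_space P using Z by (simp add: normal_rv_def)
  have ZL: "Z \<in> L2 P" using Z by (simp add: normal_rv_def)
  note [measurable] = L2_measurable[OF ZL]
  have trunc: "(\<integral>w. min ((norm (Z w))\<^sup>2) (real b) \<partial>P) \<le> C * second_moment M (X 1)" for b :: nat
  proof (rule tendsto_upperbound)
    define f where "f x = min ((norm x)\<^sup>2) (real b)" for x :: 'w
    have f: "continuous_on UNIV f" unfolding f_def by (intro continuous_intros)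
    have f0: "\<bar>f x\<bar> \<le> real b" for x unfolding f_def by (simp add: abs_le_iff)
    then have "bounded (range f)" unfolding bounded_iff by (auto intro!: exI[of _ "real b"])
    with type_2_central_limit[OF M C X L mean Z] f
    show "(\<lambda>n. \<integral>w. min ((norm (normalized_sum X n w))\<^sup>2) (real b) \<partial>M) \<longlonglongrightarrow> (\<integral>w. min ((norm (Z w))\<^sup>2) (real b) \<partial>P)"
      unfolding tendsto_in_distribution_def f_def by blast
    show "\<forall>\<^sub>F n in sequentially. (\<integral>w. min ((norm (normalized_sum X n w))\<^sup>2) (real b) \<partial>M) \<le> C * second_moment M (X 1)"
    proof (intro always_eventually allI)
      fix n
      note NL = normalized_sum_L2[OF M X L, of n]
      note [measurable] = L2_measurable[OF NL]
      have "(\<integral>w. min ((norm (normalized_sum X n w))\<^sup>2) (real b) \<partial>M) \<le> second_moment M (\<lambda>w. normalized_sum X n w)"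
      proof (rule integral_mono)
        show "integrable M (\<lambda>w. min ((norm (normalized_sum X n w))\<^sup>2) (real b))"
          by (rule M.integrable_const_bound[where B = "real b"]) (auto simp: abs_le_iff)
      qed (simp_all add: L2_integrable_norm_power2[OF NL])
      also have "\<dots> \<le> C * second_moment M (X 1)"
        by (rule normalized_sum_second_moment[OF M C X L mean])
      finally show "(\<integral>w. min ((norm (normalized_sum X n w))\<^sup>2) (real b) \<partial>M) \<le> C * second_moment M (X 1)" .
    qed
  qed simp
  have "(\<lambda>b. \<integral>w. min ((norm (Z w))\<^sup>2) (real b) \<partial>P) \<longlonglongrightarrow> second_moment P Z"
  proof (rule integral_dominated_convergence)
    show "integrable P (\<lambda>w. (norm (Z w))\<^sup>2)" by (rule L2_integrable_norm_power2[OF ZL])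
    show "AE w in P. (\<lambda>b. min ((norm (Z w))\<^sup>2) (real b)) \<longlonglongrightarrow> (norm (Z w))\<^sup>2"
    proof (rule AE_I2)
      fix w
      have "\<forall>\<^sub>F b in sequentially. real b \<ge> (norm (Z w))\<^sup>2"
        using filterlim_real_sequentially unfolding filterlim_at_top by blast
      then have "\<forall>\<^sub>F b in sequentially. min ((norm (Z w))\<^sup>2) (real b) = (norm (Z w))\<^sup>2"
        by eventually_elim simp
      then show "(\<lambda>b. min ((norm (Z w))\<^sup>2) (real b)) \<longlonglongrightarrow> (norm (Z w))\<^sup>2"
        by (rule tendsto_eventually)
    qed
    show "AE w in P. norm (min ((norm (Z w))\<^sup>2) (real b)) \<le> (norm (Z w))\<^sup>2" for b
      by (intro AE_I2) (simp add: abs_le_iff)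
  qed measurable
  then show ?thesis by (rule tendsto_upperbound) (rule always_eventually, rule allI, rule trunc, simp)
qed

section \<open>Gaussian sequences with prescribed covariance\<close>

fun gram_schmidt :: "'a measure \<Rightarrow> (nat \<Rightarrow> 'a \<Rightarrow> real) \<Rightarrow> nat \<Rightarrow> 'a \<Rightarrow> real" where
  "gram_schmidt M f l =
    (let r = (\<lambda>w. f l w - (\<Sum>i<l. (\<integral>w'. f l w' * gram_schmidt M f i w' \<partial>M) * gram_schmidt M f i w))
     in (\<lambda>w. r w / sqrt (\<integral>w'. r w' * r w' \<partial>M)))"

declare gram_schmidt.simps [simp del]

lemma L2_mult_integrable:
  fixes f g :: "'a \<Rightarrow> real"
  assumes f: "f \<in> L2 M" and g: "g \<in> L2 M"
  shows "integrable M (\<lambda>w. f w * g w)"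
proof (rule Bochner_Integration.integrable_bound)
  note [measurable] = L2_measurable[OF f] L2_measurable[OF g]
  show "(\<lambda>w. f w * g w) \<in> borel_measurable M" by measurable
  show "integrable M (\<lambda>w. (norm (f w))\<^sup>2 + (norm (g w))\<^sup>2)"
    using L2_integrable_norm_power2[OF f] L2_integrable_norm_power2[OF g] by (rule Bochner_Integration.integrable_add)
  have "norm (x * y) \<le> norm ((norm x)\<^sup>2 + (norm y)\<^sup>2)" for x y :: real
  proof -
    have "2 * (\<bar>x\<bar> * \<bar>y\<bar>) \<le> \<bar>x\<bar>\<^sup>2 + \<bar>y\<bar>\<^sup>2" using sum_squares_bound[of "\<bar>x\<bar>" "\<bar>y\<bar>"] by simp
    moreover have "0 \<le> \<bar>x\<bar> * \<bar>y\<bar>" by simp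
    ultimately have "\<bar>x\<bar> * \<bar>y\<bar> \<le> \<bar>x\<bar>\<^sup>2 + \<bar>y\<bar>\<^sup>2" by linarith
    then show ?thesis by (simp add: abs_mult)
  qed
  then show "AE w in M. norm (f w * g w) \<le> norm ((norm (f w))\<^sup>2 + (norm (g w))\<^sup>2)" by (intro AE_I2)
qed

lemma L2_mult_const:
  fixes g :: "'a \<Rightarrow> real"
  assumes "g \<in> L2 M"
  shows "(\<lambda>w. c * g w) \<in> L2 M"
  using L2_scaleR[OF assms, of c] by (simp add: mult.commute)

text \<open>A Cholesky factorization of the Gram matrix of \<open>f\<close>, with a lower triangular
  \<open>c\<close> that is the same for all lengths \<open>L\<close>. Triangularity lets each
  Gaussian counterpart depend on finitely many independent normals.\<close>

lemma gram_schmidt_factorization: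
  fixes f :: "nat \<Rightarrow> 'a \<Rightarrow> real"
  assumes f: "\<And>l. f l \<in> L2 M"
  obtains c :: "nat \<Rightarrow> nat \<Rightarrow> real" where
    "\<And>a L. (\<integral>w. (\<Sum>l<L. a l * f l w)\<^sup>2 \<partial>M) = (\<Sum>i<L. (\<Sum>l<L. a l * c l i)\<^sup>2)"
    "\<And>l i. i > l \<Longrightarrow> c l i = 0"
proof -
  define e where "e = gram_schmidt M f"
  define ip where "ip u v = (\<integral>w. u w * v w \<partial>M)" for u v :: "'a \<Rightarrow> real"
  define r where "r l = (\<lambda>w. f l w - (\<Sum>i<l. ip (f l) (e i) * e i w))" for l
  have e_eq: "e l = (\<lambda>w. r l w / sqrt (ip (r l) (r l)))" for l
    unfolding e_def r_def ip_def by (subst gram_schmidt.simps) (simp add: Let_def)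
  have eL: "e l \<in> L2 M" for l
  proof (induction l rule: less_induct)
    case (less l)
    have "r l \<in> L2 M" unfolding r_def by (intro L2_diff f L2_sum L2_mult_const less) simp
    from L2_mult_const[OF this, of "1 / sqrt (ip (r l) (r l))"] show ?case by (subst e_eq) simp
  qed
  have rL: "r l \<in> L2 M" for l unfolding r_def by (intro L2_diff f L2_sum L2_mult_const eL)
  have ip_nonneg: "ip u u \<ge> 0" for u unfolding ip_def by simp
  have ee: "ip (e l) (e l) = 1 \<or> e l = (\<lambda>_. 0)" for l
  proof (cases "ip (r l) (r l) = 0")
    case True
    then show ?thesis by (subst (3) e_eq) simp
  next
    case False
    define n where "n = sqrt (ip (r l) (r l))"
    have n: "n * n = ip (r l) (r l)" "n \<noteq> 0" using False ip_nonneg[of "r l"] by (auto simp: n_def)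
    have "ip (e l) (e l) = (\<integral>w. r l w * r l w / (n * n) \<partial>M)"
      unfolding e_eq n_def[symmetric] by (simp add: ip_def)
    also have "\<dots> = ip (r l) (r l) / (n * n)" unfolding ip_def by simp
    also have "\<dots> = 1" unfolding n(1) using False by simp
    finally show ?thesis ..
  qed
  have ip_sub: "ip (r l) (e j) = ip (f l) (e j) - (\<Sum>i<l. ip (f l) (e i) * ip (e i) (e j))" for l j
  proof -
    have "ip (r l) (e j) = (\<integral>w. f l w * e j w - (\<Sum>i<l. ip (f l) (e i) * (e i w * e j w)) \<partial>M)"
      by (subst ip_def) (simp add: r_def left_diff_distrib sum_distrib_right mult.assoc)
    also have "\<dots> = ip (f l) (e j) - (\<Sum>i<l. ip (f l) (e i) * ip (e i) (e j))"
      unfolding ip_def[of "f l" "e j"] ip_def[of _ "e j"]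
      using L2_mult_integrable[OF f eL] L2_mult_integrable[OF eL eL]
      by (subst Bochner_Integration.integral_diff) (simp_all add: Bochner_Integration.integral_sum)
    finally show ?thesis .
  qed
  have orth: "\<forall>j<l. ip (e l) (e j) = 0" for l
  proof (induction l rule: less_induct)
    case (less l)
    show ?case
    proof (intro allI impI)
      fix j assume j: "j < l"
      have sym: "ip (e i) (e j) = ip (e j) (e i)" for i by (simp add: ip_def mult.commute)
      have z: "ip (e i) (e j) = 0" if "i < l" "i \<noteq> j" for i
      proof (cases "j < i")
        case True
        then show ?thesis using less[OF that(1)] by simp
      next
        case False
        then show ?thesis using less[OF j] that(2) sym[of i] by simp
      qed
      have "(\<Sum>i<l. ip (f l) (e i) * ip (e i) (e j)) = (\<Sum>i<l. if i = j then ip (f l) (e j) * ip (e j) (e j) else 0)"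
        by (intro sum.cong refl) (auto simp: z)
      also have "\<dots> = ip (f l) (e j) * ip (e j) (e j)" using j by simp
      also have "\<dots> = ip (f l) (e j)" using ee[of j] by (auto simp: ip_def)
      finally have "ip (r l) (e j) = 0" unfolding ip_sub by simp
      then show "ip (e l) (e j) = 0" by (subst e_eq) (simp add: ip_def)
    qed
  qed
  have orth': "ip (e i) (e j) = 0" if "i \<noteq> j" for i j
  proof (cases "j < i")
    case True
    then show ?thesis using orth[of i] by simp
  next
    case False
    then have "ip (e j) (e i) = 0" using orth[of j] that by simp
    then show ?thesis by (simp add: ip_def mult.commute)
  qed
  define c where "c l i = (if i < l then ip (f l) (e i) else if i = l then sqrt (ip (r l) (r l)) else 0)" for l i
  \<comment> \<open>Coefficients in front of a zero vector vanish too, so the squared norm of a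
    combination is still the sum of the squared coefficients.\<close>
  have c_null: "c l i * ip (e i) (e i) = c l i" for l i
    using ee[of i]
  proof
    assume z: "e i = (\<lambda>_. 0)"
    have "c l i = 0"
    proof (cases "i = l")
      case True
      have "ip (r l) (r l) = 0"
      proof (rule ccontr)
        assume nz: "ip (r l) (r l) \<noteq> 0"
        then have "r l = (\<lambda>_. 0)" using z True e_eq[of l] ip_nonneg[of "r l"] by (auto simp: fun_eq_iff)
        then show False using nz by (simp add: ip_def)
      qed
      then show ?thesis using True by (simp add: c_def)
    qed (simp add: c_def z ip_def)
    then show ?thesis by simp
  qed simp
  \<comment> \<open>Only almost everywhere: a residual of norm zero need not vanish pointwise,
    although \<open>e l\<close> does.\<close>
  have expand: "AE w in M. f l w = (\<Sum>i<L. c l i * e i w)" if "l < L" for l L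
  proof -
    have "AE w in M. r l w = c l l * e l w"
    proof (cases "ip (r l) (r l) = 0")
      case True
      have "AE w in M. r l w * r l w = 0"
        using integral_nonneg_eq_0_iff_AE[OF L2_mult_integrable[OF rL rL], of l l] True by (simp add: ip_def)
      then show ?thesis using True by (simp add: c_def)
    next
      case False
      then show ?thesis using ip_nonneg[of "r l"] by (subst e_eq) (simp add: c_def)
    qed
    moreover have "(\<Sum>i<L. c l i * e i w) = (\<Sum>i<l. ip (f l) (e i) * e i w) + c l l * e l w" for w
    proof -
      have "(\<Sum>i<L. c l i * e i w) = (\<Sum>i<Suc l. c l i * e i w)"
        using that by (intro sum.mono_neutral_right) (auto simp: c_def)
      then show ?thesis by (simp add: c_def)
    qed
    ultimately show ?thesis by (simp add: r_def algebra_simps)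
  qed
  have main: "(\<integral>w. (\<Sum>l<L. a l * f l w)\<^sup>2 \<partial>M) = (\<Sum>i<L. (\<Sum>l<L. a l * c l i)\<^sup>2)" for a L
  proof -
    define b where "b i = (\<Sum>l<L. a l * c l i)" for i
    have sL: "(\<lambda>w. \<Sum>l<L. a l * f l w) \<in> L2 M" by (intro L2_sum L2_mult_const f)
    have bL: "(\<lambda>w. \<Sum>i<L. b i * e i w) \<in> L2 M" by (intro L2_sum L2_mult_const eL)
    have "AE w in M. \<forall>l\<in>{..<L}. f l w = (\<Sum>i<L. c l i * e i w)"
      by (intro AE_finite_allI expand) auto
    then have ae: "AE w in M. (\<Sum>l<L. a l * f l w) = (\<Sum>i<L. b i * e i w)"
    proof (rule AE_mp, intro AE_I2 impI)
      fix w assume *: "\<forall>l\<in>{..<L}. f l w = (\<Sum>i<L. c l i * e i w)"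
      have "(\<Sum>l<L. a l * f l w) = (\<Sum>l<L. \<Sum>i<L. a l * c l i * e i w)"
        using * by (intro sum.cong) (simp_all add: sum_distrib_left mult.assoc)
      also have "\<dots> = (\<Sum>i<L. b i * e i w)"
        unfolding b_def sum_distrib_right by (rule sum.swap)
      finally show "(\<Sum>l<L. a l * f l w) = (\<Sum>i<L. b i * e i w)" .
    qed
    have "(\<integral>w. (\<Sum>l<L. a l * f l w)\<^sup>2 \<partial>M) = (\<integral>w. (\<Sum>i<L. b i * e i w)\<^sup>2 \<partial>M)"
      using ae L2_measurable[OF sL] L2_measurable[OF bL] by (intro integral_cong_AE) auto
    also have "\<dots> = (\<integral>w. (\<Sum>i<L. \<Sum>j<L. (b i * b j) * (e i w * e j w)) \<partial>M)"
      by (simp add: power2_eq_square sum_product mult_ac)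
    also have "\<dots> = (\<Sum>i<L. \<Sum>j<L. (b i * b j) * ip (e i) (e j))"
      using L2_mult_integrable[OF eL eL] by (simp add: Bochner_Integration.integral_sum ip_def)
    also have "\<dots> = (\<Sum>i<L. \<Sum>j<L. if j = i then (b i)\<^sup>2 else 0)"
    proof (intro sum.cong refl)
      fix i j
      have "b i * ip (e i) (e i) = b i"
        unfolding b_def sum_distrib_right by (simp add: mult.assoc c_null)
      then show "b i * b j * ip (e i) (e j) = (if j = i then (b i)\<^sup>2 else 0)"
        by (auto simp: orth' power2_eq_square)
    qed
    also have "\<dots> = (\<Sum>i<L. (b i)\<^sup>2)" by simp
    finally show ?thesis unfolding b_def .
  qed
  show ?thesis by (rule that[OF main]) (simp add: c_def)
qed

section \<open>Independent standard normals and Gaussian sequences\<close>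

definition gaussian_sequence_space :: "(nat \<Rightarrow> real) measure" where
  "gaussian_sequence_space = PiM UNIV (\<lambda>_. std_normal_distribution)"

lemma prob_space_gaussian_sequence_space: "prob_space gaussian_sequence_space"
proof -
  interpret real_distribution std_normal_distribution by (rule real_dist_normal_dist)
  show ?thesis unfolding gaussian_sequence_space_def by (intro prob_space_PiM) unfold_locales
qed

lemma measurable_gaussian_sequence_coordinate:
  "(\<lambda>w. w i) \<in> borel_measurable gaussian_sequence_space"
proof -
  have "(\<lambda>w. w i) \<in> gaussian_sequence_space \<rightarrow>\<^sub>M std_normal_distribution"
    unfolding gaussian_sequence_space_def by (rule measurable_component_singleton) simp
  then show ?thesis by (simp cong: measurable_cong_sets)
qed

lemma distr_gaussian_sequence_coordinate:
  "distr gaussian_sequence_space std_normal_distribution (\<lambda>w. w i) = std_normal_distribution"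
proof -
  interpret real_distribution std_normal_distribution by (rule real_dist_normal_dist)
  show ?thesis unfolding gaussian_sequence_space_def
    by (intro distr_PiM_component) (unfold_locales, simp)
qed

lemma integral_iexp_gaussian_sequence:
  "(\<integral>w. iexp (\<Sum>i<L. a i * w i) \<partial>gaussian_sequence_space) = exp (- (\<Sum>i<L. (a i)\<^sup>2) / 2)"
proof -
  let ?N = std_normal_distribution and ?P = gaussian_sequence_space
  interpret P: prob_space ?P by (rule prob_space_gaussian_sequence_space)
  note [measurable] = measurable_gaussian_sequence_coordinate
  have m: "(\<lambda>w. w i) \<in> ?P \<rightarrow>\<^sub>M ?N" for i
    by (simp cong: measurable_cong_sets)
  have "P.indep_vars (\<lambda>_. ?N) (\<lambda>i w. w i) UNIV"
  proof (subst P.indep_vars_iff_distr_eq_PiM)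
    show "distr ?P (PiM UNIV (\<lambda>_. ?N)) (\<lambda>x. \<lambda>i\<in>UNIV. x i) = PiM UNIV (\<lambda>i. distr ?P ?N (\<lambda>w. w i))"
      unfolding distr_gaussian_sequence_coordinate
      by (simp add: gaussian_sequence_space_def distr_id[unfolded id_def] restrict_UNIV)
  qed (simp_all add: m)
  then have "P.indep_vars (\<lambda>_. borel) (\<lambda>i w. a i * w i) UNIV"
    by (rule P.indep_vars_compose2[where Y = "\<lambda>i x. a i * x"]) (simp cong: measurable_cong_sets)
  then have "P.indep_vars (\<lambda>_. borel) (\<lambda>i w. a i * w i) {..<L}"
    by (rule P.indep_vars_subset) simp
  \<comment> \<open>The coefficients \<open>a i\<close> are absorbed into the variables, so
    characteristic functions are needed at 1 only.\<close>
  note sum = P.char_distr_sum[OF this, of 1]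
  have "char (distr ?P borel (\<lambda>w. a i * w i)) 1 = exp (- (a i)\<^sup>2 / 2)" for i
  proof -
    have "char (distr ?P borel (\<lambda>w. a i * w i)) 1 = (\<integral>w. iexp (a i * w i) \<partial>?P)"
      unfolding char_def by (subst integral_distr) simp_all
    also have "\<dots> = (\<integral>x. iexp (a i * x) \<partial>distr ?P ?N (\<lambda>w. w i))"
      by (subst integral_distr[OF m]) (simp_all cong: measurable_cong_sets)
    also have "\<dots> = char ?N (a i)" unfolding distr_gaussian_sequence_coordinate char_def ..
    finally show ?thesis by (simp add: char_std_normal_distribution)
  qed
  then have "char (distr ?P borel (\<lambda>w. \<Sum>i<L. a i * w i)) 1 = (\<Prod>i<L. complex_of_real (exp (- (a i)\<^sup>2 / 2)))"
    unfolding sum by simp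
  also have "\<dots> = exp (- (\<Sum>i<L. (a i)\<^sup>2) / 2)"
    by (simp add: exp_sum[symmetric] sum_negf sum_divide_distrib flip: of_real_prod)
  also have "char (distr ?P borel (\<lambda>w. \<Sum>i<L. a i * w i)) 1 = (\<integral>w. iexp (\<Sum>i<L. a i * w i) \<partial>?P)"
    unfolding char_def by (subst integral_distr) simp_all
  finally show ?thesis .
qed

lemma gaussian_sequence_coordinate_L2: "(\<lambda>w. w i) \<in> L2 gaussian_sequence_space"
proof -
  let ?P = gaussian_sequence_space
  interpret P: prob_space ?P by (rule prob_space_gaussian_sequence_space)
  note [measurable] = measurable_gaussian_sequence_coordinate
  have "integrable std_normal_distribution (\<lambda>x. x ^ 2)"
    by (rule integrable_std_normal_distribution_moment)
  then have "integrable (distr ?P std_normal_distribution (\<lambda>w. w i)) (\<lambda>x. x\<^sup>2)"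
    unfolding distr_gaussian_sequence_coordinate .
  then have "integrable ?P (\<lambda>w. (w i)\<^sup>2)"
    by (subst (asm) integrable_distr_eq) (simp_all cong: measurable_cong_sets)
  then show ?thesis by (simp add: L2_def)
qed

lemma gaussian_sequence_exists:
  fixes f :: "nat \<Rightarrow> 'a \<Rightarrow> real"
  assumes f: "\<And>l. f l \<in> L2 M"
  obtains G :: "nat \<Rightarrow> (nat \<Rightarrow> real) \<Rightarrow> real" where
    "\<And>l. G l \<in> L2 gaussian_sequence_space"
    "\<And>a L. (\<integral>w. iexp (\<Sum>l<L. a l * G l w) \<partial>gaussian_sequence_space) = exp (- (\<integral>w. (\<Sum>l<L. a l * f l w)\<^sup>2 \<partial>M) / 2)"
proof -
  obtain c :: "nat \<Rightarrow> nat \<Rightarrow> real" where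
    c: "\<And>a L. (\<integral>w. (\<Sum>l<L. a l * f l w)\<^sup>2 \<partial>M) = (\<Sum>i<L. (\<Sum>l<L. a l * c l i)\<^sup>2)"
    and c0: "\<And>l i. i > l \<Longrightarrow> c l i = 0"
    by (rule gram_schmidt_factorization[of f M, OF f]) (rule that)
  \<comment> \<open>By triangularity the sum stops at \<open>l\<close>, so one and the same
    \<open>G l\<close> can be padded to \<open>L\<close> coordinates for every
    \<open>L > l\<close>.\<close>
  define G where "G l w = (\<Sum>i<Suc l. c l i * w i)" for l and w :: "nat \<Rightarrow> real"
  have G_eq: "(\<Sum>l<L. a l * G l w) = (\<Sum>i<L. (\<Sum>l<L. a l * c l i) * w i)" for a L w
  proof -
    have "G l w = (\<Sum>i<L. c l i * w i)" if "l < L" for l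
      unfolding G_def using that c0 by (intro sum.mono_neutral_left) auto
    then have "(\<Sum>l<L. a l * G l w) = (\<Sum>l<L. \<Sum>i<L. a l * c l i * w i)"
      by (intro sum.cong) (simp_all add: sum_distrib_left mult.assoc)
    also have "\<dots> = (\<Sum>i<L. (\<Sum>l<L. a l * c l i) * w i)"
      unfolding sum_distrib_right by (rule sum.swap)
    finally show ?thesis .
  qed
  show ?thesis
  proof (rule that)
    show "G l \<in> L2 gaussian_sequence_space" for l
      unfolding G_def by (intro L2_sum L2_mult_const gaussian_sequence_coordinate_L2)
    show "(\<integral>w. iexp (\<Sum>l<L. a l * G l w) \<partial>gaussian_sequence_space) = exp (- (\<integral>w. (\<Sum>l<L. a l * f l w)\<^sup>2 \<partial>M) / 2)" for a L
      unfolding G_eq c by (rule integral_iexp_gaussian_sequence)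
  qed
qed

section \<open>Existence of the Gaussian limit\<close>

text \<open>Almost sure convergence is what lets characteristic functionals pass to the limit by
  dominated convergence; Fatou's lemma keeps the limit in \<open>L2\<close>.\<close>

lemma (in prob_space) L2_limit_exists:
  fixes Z :: "nat \<Rightarrow> 'a \<Rightarrow> 'w::{banach, second_countable_topology}"
  assumes Z: "\<And>j. Z j \<in> L2 M"
    and step: "\<And>j. second_moment M (\<lambda>w. Z (Suc j) w - Z j w) \<le> B * (1 / 4) ^ j"
    and bound: "\<And>j. second_moment M (Z j) \<le> B"
  obtains Y where "Y \<in> L2 M" "AE w in M. (\<lambda>j. Z j w) \<longlonglongrightarrow> Y w"
proof -
  note [measurable] = L2_measurable[OF Z]
  \<comment> \<open>The ratio 3/4 lies between 1/2 and 1: the thresholds are summable, and Chebyshev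
    still gives summable probabilities, since \<open>(1 / 4) / (9 / 16) = 4 / 9\<close>.\<close>
  define A where "A j = {w\<in>space M. norm (Z (Suc j) w - Z j w) > (3 / 4) ^ j}" for j
  have [measurable]: "A j \<in> events" for j unfolding A_def by measurable
  have prob_A: "prob (A j) \<le> B * (4 / 9) ^ j" for j
  proof -
    have "prob (A j) \<le> second_moment M (\<lambda>w. Z (Suc j) w - Z j w) / ((3 / 4) ^ j)\<^sup>2"
      unfolding A_def by (rule Chebyshev_norm[OF L2_diff[OF Z Z]]) simp
    also have "\<dots> \<le> B * (1 / 4) ^ j / ((3 / 4) ^ j)\<^sup>2"
      by (intro divide_right_mono step) simp
    also have "((3 / 4) ^ j)\<^sup>2 = (9 / 16 :: real) ^ j"
      by (simp add: power2_eq_square flip: power_mult_distrib)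
    also have "B * (1 / 4) ^ j / (9 / 16) ^ j = B * ((1 / 4) / (9 / 16)) ^ j"
      by (simp only: power_divide[symmetric] times_divide_eq_right[symmetric])
    also have "(1 / 4) / (9 / 16) = (4 / 9 :: real)" by simp
    finally show ?thesis .
  qed
  have "summable (\<lambda>j. B * (4 / 9) ^ j)" by (intro summable_mult summable_geometric) simp
  then have "summable (\<lambda>j. prob (A j))"
    by (rule summable_comparison_test') (simp add: prob_A)
  then have "AE w in M. \<forall>\<^sub>F j in sequentially. w \<in> space M - A j"
    by (intro borel_cantelli_AE1) (auto simp: emeasure_eq_measure)
  then have conv: "AE w in M. (\<lambda>j. Z j w) \<longlonglongrightarrow> lim (\<lambda>j. Z j w)"
  proof (rule AE_mp, intro AE_I2 impI)
    fix w assume "w \<in> space M" and ev: "\<forall>\<^sub>F j in sequentially. w \<in> space M - A j"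
    have "\<forall>\<^sub>F j in sequentially. norm (Z (Suc j) w - Z j w) \<le> (3 / 4) ^ j"
      using ev by eventually_elim (auto simp: A_def)
    moreover have "summable (\<lambda>j. (3 / 4 :: real) ^ j)" by (rule summable_geometric) simp
    ultimately have "summable (\<lambda>j. Z (Suc j) w - Z j w)"
      by (rule summable_comparison_test_ev)
    then have "convergent (\<lambda>n. \<Sum>j<n. Z (Suc j) w - Z j w)"
      by (simp add: summable_iff_convergent)
    then have "convergent (\<lambda>n. Z n w - Z 0 w)"
      by (simp add: sum_lessThan_telescope[of "\<lambda>j. Z j w"])
    then have "convergent (\<lambda>n. (Z n w - Z 0 w) + Z 0 w)"
      by (rule convergent_add[OF _ convergent_const])
    then show "(\<lambda>j. Z j w) \<longlonglongrightarrow> lim (\<lambda>j. Z j w)" by (simp add: convergent_LIMSEQ_iff)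
  qed
  define Y where "Y w = lim (\<lambda>j. Z j w)" for w
  have [measurable]: "Y \<in> borel_measurable M" unfolding Y_def by measurable
  have "(\<integral>\<^sup>+w. ennreal ((norm (Y w))\<^sup>2) \<partial>M) = (\<integral>\<^sup>+w. liminf (\<lambda>j. ennreal ((norm (Z j w))\<^sup>2)) \<partial>M)"
  proof (rule nn_integral_cong_AE, rule AE_mp[OF conv], intro AE_I2 impI)
    fix w assume "(\<lambda>j. Z j w) \<longlonglongrightarrow> lim (\<lambda>j. Z j w)"
    then have "(\<lambda>j. ennreal ((norm (Z j w))\<^sup>2)) \<longlonglongrightarrow> ennreal ((norm (Y w))\<^sup>2)"
      unfolding Y_def by (intro tendsto_ennrealI tendsto_intros)
    then show "ennreal ((norm (Y w))\<^sup>2) = liminf (\<lambda>j. ennreal ((norm (Z j w))\<^sup>2))"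
      by (rule lim_imp_Liminf[OF sequentially_bot, symmetric])
  qed
  also have "\<dots> \<le> liminf (\<lambda>j. \<integral>\<^sup>+w. ennreal ((norm (Z j w))\<^sup>2) \<partial>M)"
    by (rule nn_integral_liminf) measurable
  also have "\<dots> \<le> liminf (\<lambda>j. ennreal B)"
  proof (rule Liminf_mono, rule always_eventually, rule allI)
    fix j
    have "(\<integral>\<^sup>+w. ennreal ((norm (Z j w))\<^sup>2) \<partial>M) = ennreal (second_moment M (Z j))"
      by (intro nn_integral_eq_integral L2_integrable_norm_power2 Z) simp
    then show "(\<integral>\<^sup>+w. ennreal ((norm (Z j w))\<^sup>2) \<partial>M) \<le> ennreal B"
      using bound[of j] by (simp add: ennreal_leI)
  qed
  also have "\<dots> = ennreal B" by (simp add: Liminf_const)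
  also have "\<dots> < \<infinity>" by simp
  finally have fin: "(\<integral>\<^sup>+w. ennreal ((norm (Y w))\<^sup>2) \<partial>M) < \<infinity>" .
  have "integrable M (\<lambda>w. (norm (Y w))\<^sup>2)"
  proof (rule integrableI_bounded)
    show "(\<lambda>w. (norm (Y w))\<^sup>2) \<in> borel_measurable M" by measurable
    show "(\<integral>\<^sup>+w. ennreal (norm ((norm (Y w))\<^sup>2)) \<partial>M) < \<infinity>" using fin by simp
  qed
  then have "Y \<in> L2 M" by (simp add: L2_def)
  then show ?thesis using conv unfolding Y_def[symmetric] by (rule that)
qed

text \<open>The difference of squares is split by Young's inequality with weight
  \<open>s = (1 / 2) ^ j\<close>, the square root of the assumed rate: then
  \<open>(1 / s) * (1 / 4) ^ j\<close> and \<open>s\<close> times a fixed variance are both of order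
  \<open>s\<close>.\<close>

lemma functional_var_tendsto:
  fixes X :: "'a \<Rightarrow> 'w::{banach, second_countable_topology}"
  assumes X: "X \<in> L2 M" and D: "\<And>j. D j \<in> L2 M"
    and close: "\<And>j. (second_moment M (\<lambda>w. X w - D j w)) \<le> (1 / 4) ^ j"
  shows "(\<lambda>j. functional_var M (D j) \<psi>) \<longlonglongrightarrow> functional_var M X \<psi>"
proof -
  define c where "c = 2 * (norm \<psi>)\<^sup>2 + functional_var M X \<psi>"
  have le: "norm (functional_var M (D j) \<psi> - functional_var M X \<psi>) \<le> c * (1 / 2) ^ j" for j
  proof -
    define s :: real where "s = (1 / 2) ^ j"
    have s: "s > 0" "s \<le> 1" "s * s = (1 / 4) ^ j"
      by (auto simp: s_def power_le_one power_mult_distrib[symmetric])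
    define a where "a w = blinfun_apply \<psi> (D j w)" for w
    define b where "b w = blinfun_apply \<psi> (X w)" for w
    have ia: "integrable M (\<lambda>w. (a w)\<^sup>2)" and ib: "integrable M (\<lambda>w. (b w)\<^sup>2)"
      using L2_integrable_mult[OF D[of j], of \<psi> \<psi>] L2_integrable_mult[OF X, of \<psi> \<psi>]
      by (simp_all add: a_def b_def power2_eq_square)
    have id: "integrable M (\<lambda>w. (norm (X w - D j w))\<^sup>2)"
      by (rule L2_integrable_norm_power2[OF L2_diff[OF X D]])
    have pw: "\<bar>(a w)\<^sup>2 - (b w)\<^sup>2\<bar> \<le> (1 + 1 / s) * ((norm \<psi>)\<^sup>2 * (norm (X w - D j w))\<^sup>2) + s * (b w)\<^sup>2" for w
    proof -
      define d where "d = \<bar>b w - a w\<bar>"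
      have "d \<le> norm \<psi> * norm (X w - D j w)"
        unfolding d_def a_def b_def using norm_blinfun[of \<psi> "X w - D j w"] by (simp add: blinfun.diff_right)
      then have "d\<^sup>2 \<le> (norm \<psi> * norm (X w - D j w))\<^sup>2" by (intro power_mono) (simp_all add: d_def)
      then have d2: "d\<^sup>2 \<le> (norm \<psi>)\<^sup>2 * (norm (X w - D j w))\<^sup>2" by (simp add: power_mult_distrib)
      have "(a w)\<^sup>2 - (b w)\<^sup>2 = (b w - a w)\<^sup>2 - 2 * b w * (b w - a w)" by (simp add: power2_eq_square algebra_simps)
      then have "\<bar>(a w)\<^sup>2 - (b w)\<^sup>2\<bar> \<le> \<bar>(b w - a w)\<^sup>2\<bar> + \<bar>2 * b w * (b w - a w)\<bar>"
        by (simp only: abs_triangle_ineq4)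
      also have "\<dots> = d\<^sup>2 + 2 * (\<bar>b w\<bar> * d)" by (simp add: d_def abs_mult)
      also have "2 * (\<bar>b w\<bar> * d) \<le> s * (b w)\<^sup>2 + d\<^sup>2 / s"
      proof -
        have "0 \<le> (s * \<bar>b w\<bar> - d)\<^sup>2" by simp
        then have "s * (2 * (\<bar>b w\<bar> * d)) \<le> s * (s * (b w)\<^sup>2) + d\<^sup>2"
          by (simp add: power2_diff power_mult_distrib power2_eq_square[of s] mult_ac)
        also have "\<dots> = s * (s * (b w)\<^sup>2 + d\<^sup>2 / s)" using s(1) by (simp add: distrib_left)
        finally show ?thesis using s(1) by simp
      qed
      also have "d\<^sup>2 + (s * (b w)\<^sup>2 + d\<^sup>2 / s) = (1 + 1 / s) * d\<^sup>2 + s * (b w)\<^sup>2" by (simp add: distrib_right)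
      also have "\<dots> \<le> (1 + 1 / s) * ((norm \<psi>)\<^sup>2 * (norm (X w - D j w))\<^sup>2) + s * (b w)\<^sup>2"
        using s(1) d2 by (intro add_right_mono mult_left_mono) simp_all
      finally show ?thesis by simp
    qed
    have "norm (functional_var M (D j) \<psi> - functional_var M X \<psi>) = \<bar>\<integral>w. (a w)\<^sup>2 - (b w)\<^sup>2 \<partial>M\<bar>"
      using ia ib by (simp add: functional_var_def a_def b_def)
    also have "\<dots> \<le> (\<integral>w. \<bar>(a w)\<^sup>2 - (b w)\<^sup>2\<bar> \<partial>M)" by (rule integral_abs_bound)
    also have "\<dots> \<le> (\<integral>w. (1 + 1 / s) * ((norm \<psi>)\<^sup>2 * (norm (X w - D j w))\<^sup>2) + s * (b w)\<^sup>2 \<partial>M)"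
      using ia ib id by (intro integral_mono pw) simp_all
    also have "\<dots> = (1 + 1 / s) * ((norm \<psi>)\<^sup>2 * second_moment M (\<lambda>w. X w - D j w)) + s * functional_var M X \<psi>"
      using ib id by (simp add: functional_var_def b_def)
    also have "\<dots> \<le> (1 + 1 / s) * ((norm \<psi>)\<^sup>2 * (s * s)) + s * functional_var M X \<psi>"
      using s(1) close[of j] by (intro add_right_mono mult_left_mono) (simp_all add: s(3))
    also have "(1 + 1 / s) * ((norm \<psi>)\<^sup>2 * (s * s)) = (s + 1) * ((norm \<psi>)\<^sup>2 * s)"
      using s(1) by (simp add: field_simps)
    also have "\<dots> \<le> 2 * ((norm \<psi>)\<^sup>2 * s)"
      using s by (intro mult_right_mono) simp_all
    finally show ?thesis unfolding c_def s_def[symmetric] by (simp add: algebra_simps)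
  qed
  have "(\<lambda>j. c * (1 / 2) ^ j) \<longlonglongrightarrow> 0" by (intro tendsto_mult_right_zero LIMSEQ_power_zero) simp
  then have "(\<lambda>j. functional_var M (D j) \<psi> - functional_var M X \<psi>) \<longlonglongrightarrow> 0"
    by (rule tendsto_0_le[where K = 1]) (use le order_trans[OF le abs_ge_self] in \<open>auto intro!: always_eventually\<close>)
  then show ?thesis by (simp add: LIM_zero_iff)
qed

text \<open>
  A single sequence of real coefficient functions \<open>F\<close> represents all the simple functions \<open>\<phi> j\<close> at
  once, so that Gaussian counterparts of the \<open>\<phi> j\<close> can be built on one probability space.
\<close>

lemma (in prob_space) simple_functions_common_expansion:
  fixes \<phi> :: "nat \<Rightarrow> 'w::{banach, second_countable_topology} \<Rightarrow> 'w"
  assumes X[measurable]: "X \<in> borel_measurable M" and \<phi>: "\<And>j. \<phi> j \<in> borel_measurable borel"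
    and fin: "\<And>j. finite (range (\<phi> j))"
  obtains F :: "nat \<Rightarrow> 'w \<Rightarrow> real" and v :: "nat \<Rightarrow> nat \<Rightarrow> 'w" and L :: "nat \<Rightarrow> nat" where
    "\<And>l. F l \<in> borel_measurable borel" "\<And>l. (\<lambda>w. F l (X w)) \<in> L2 M" "\<And>l. expectation (\<lambda>w. F l (X w)) = 0"
    "\<And>j y. \<phi> j y - expectation (\<lambda>w. \<phi> j (X w)) = (\<Sum>l<L j. F l y *\<^sub>R v j l)"
    "\<And>j l. l \<ge> L j \<Longrightarrow> v j l = 0"
proof -
  define n where "n j = card (range (\<phi> j))" for j
  have "\<forall>j. \<exists>b. bij_betw b {0..<n j} (range (\<phi> j))"
    unfolding n_def using ex_bij_betw_nat_finite[OF fin] by blast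
  then obtain b where b: "\<And>j. bij_betw (b j) {0..<n j} (range (\<phi> j))" by metis
  \<comment> \<open>The code \<open>l\<close> of a pair \<open>(j, i)\<close> stands for the value
    number \<open>i\<close> of \<open>\<phi> j\<close>. For \<open>i \<ge> n j\<close> that value is
    unspecified, which is harmless because \<open>v\<close> is zero there.\<close>
  define x where "x l = b (fst (prod_decode l)) (snd (prod_decode l))" for l
  define A where "A l = \<phi> (fst (prod_decode l)) -` {x l}" for l
  have [measurable]: "A l \<in> sets borel" for l
    unfolding A_def using measurable_sets[OF \<phi>, of "{x l}"] by simp
  define F :: "nat \<Rightarrow> 'w \<Rightarrow> real" where
    "F l y = indicator (A l) y - expectation (\<lambda>w. indicator (A l) (X w))" for l y
  define v where "v j l = (if fst (prod_decode l) = j \<and> snd (prod_decode l) < n j then x l else 0)" for j l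
  define S where "S j = (\<lambda>i. prod_encode (j, i)) ` {0..<n j}" for j
  \<comment> \<open>The codes belonging to one \<open>j\<close> are not consecutive; an upper bound
    suffices, since \<open>v j\<close> vanishes at every other index below it.\<close>
  have "\<forall>j. \<exists>k. S j \<subseteq> {..<k}" unfolding S_def by (intro allI finite_nat_bounded) simp
  then obtain L where L: "\<And>j. S j \<subseteq> {..<L j}" by metis
  have vS: "v j l = 0" if "l \<notin> S j" for j l
  proof (rule ccontr)
    assume "v j l \<noteq> 0"
    then have d: "fst (prod_decode l) = j" "snd (prod_decode l) < n j" unfolding v_def by (auto split: if_splits)
    have "l = prod_encode (j, snd (prod_decode l))" using d(1) by (metis prod.collapse prod_decode_inverse)
    then show False using that d(2) unfolding S_def by (metis atLeastLessThan_iff imageI le0)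
  qed
  have indL: "(\<lambda>w. indicator (A l) (X w) :: real) \<in> L2 M" for l
    by (rule L2_bound[where g = "\<lambda>_. 1"]) (measurable, simp_all add: indicator_def)
  show ?thesis
  proof (rule that[of F v L])
    show "F l \<in> borel_measurable borel" for l unfolding F_def by measurable
    show "(\<lambda>w. F l (X w)) \<in> L2 M" for l unfolding F_def by (intro L2_diff indL L2_const)
    show "expectation (\<lambda>w. F l (X w)) = 0" for l
      unfolding F_def using L2_integrable[OF indL[of l]] by (simp add: prob_space)
    show "v j l = 0" if "l \<ge> L j" for j l
      using that L[of j] by (intro vS) auto
    fix j y
    have "(\<Sum>l<L j. F l y *\<^sub>R v j l) = (\<Sum>l\<in>S j. F l y *\<^sub>R v j l)"
      using L[of j] by (intro sum.mono_neutral_right) (auto simp: vS)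
    also have "\<dots> = (\<Sum>i\<in>{0..<n j}. F (prod_encode (j, i)) y *\<^sub>R v j (prod_encode (j, i)))"
      unfolding S_def by (subst sum.reindex) (auto simp: inj_on_def)
    also have "\<dots> = (\<Sum>i\<in>{0..<n j}. (indicator (\<phi> j -` {b j i}) y - expectation (\<lambda>w. indicator (\<phi> j -` {b j i}) (X w))) *\<^sub>R b j i)"
      by (intro sum.cong refl) (simp add: F_def v_def A_def x_def)
    also have "\<dots> = (\<Sum>x\<in>range (\<phi> j). (indicator (\<phi> j -` {x}) y - expectation (\<lambda>w. indicator (\<phi> j -` {x}) (X w))) *\<^sub>R x)"
      by (rule sum.reindex_bij_betw[OF b])
    also have "\<dots> = \<phi> j y - expectation (\<lambda>w. \<phi> j (X w))"
      by (rule centered_simple_eq_sum[OF fin \<phi> X, symmetric])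
    finally show "\<phi> j y - expectation (\<lambda>w. \<phi> j (X w)) = (\<Sum>l<L j. F l y *\<^sub>R v j l)" ..
  qed
qed

text \<open>Replaces \<open>Z\<close> by the identity under its own law, so that the sample space in
  the existence statement can be \<open>'w\<close> itself.\<close>

lemma normal_rv_distr:
  fixes Z :: "'b \<Rightarrow> 'w::{banach, second_countable_topology}" and Y :: "'a \<Rightarrow> 'w"
  assumes Z: "normal_rv P Z 0 (covariance M Y)" and Y: "Y \<in> L2 M" and mean: "(\<integral>w. Y w \<partial>M) = 0"
  shows "normal_rv (distr P borel Z) (\<lambda>x. x) 0 (covariance M Y)"
proof (rule normal_rvI[OF _ _ Y mean])
  interpret P: prob_space P using Z by (simp add: normal_rv_def)
  have ZL: "Z \<in> L2 P" using Z by (simp add: normal_rv_def)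
  note [measurable] = L2_measurable[OF ZL]
  show "prob_space (distr P borel Z)" by (rule P.prob_space_distr) measurable
  show "(\<lambda>x. x) \<in> L2 (distr P borel Z)"
    using L2_integrable_norm_power2[OF ZL] by (simp add: L2_def integrable_distr_eq)
  fix \<psi> :: "'w \<Rightarrow>\<^sub>L real"
  have "char_fun (distr P borel Z) (\<lambda>x. x) \<psi> = char_fun P Z \<psi>"
    unfolding char_fun_def
    by (intro integral_distr L2_measurable[OF ZL] borel_measurable_continuous_onI continuous_intros)
  then show "char_fun (distr P borel Z) (\<lambda>x. x) \<psi> = exp (- functional_var M Y \<psi> / 2)"
    by (simp only: char_fun_normal_rv[OF Z mean])
qed

theorem normal_rv_exists:
  fixes X :: "nat \<Rightarrow> 'a \<Rightarrow> 'w::{banach, second_countable_topology}"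
  assumes M: "prob_space M" and C: "type_2_bound M TYPE('w) C" and X: "iid_seq M X"
    and XL: "X 1 \<in> L2 M" and mean: "(\<integral>w. X 1 w \<partial>M) = 0"
  shows "\<exists>(P :: 'w measure) (Z :: 'w \<Rightarrow> 'w). normal_rv P Z 0 (covariance M (X 1))"
proof -
  interpret prob_space M by fact
  let ?P = gaussian_sequence_space
  interpret P: prob_space ?P by (rule prob_space_gaussian_sequence_space)
  have C0: "C > 0" using C unfolding type_2_bound_def by blast
  have mX[measurable]: "X 1 \<in> borel_measurable M" by (rule L2_measurable[OF XL])
  obtain \<phi>0 :: "nat \<Rightarrow> 'w \<Rightarrow> 'w" where \<phi>0: "\<And>j. \<phi>0 j \<in> borel_measurable borel" "\<And>j. finite (range (\<phi>0 j))"
    "(\<lambda>j. second_moment M (\<lambda>w. X 1 w - (\<phi>0 j (X 1 w) - expectation (\<lambda>w. \<phi>0 j (X 1 w))))) \<longlonglongrightarrow> 0"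
    using centered_simple_approximation[OF XL mean] by blast
  \<comment> \<open>Indices \<open>r j\<close> are selected to obtain a geometric rate, as required
    for almost sure convergence by Borel--Cantelli.\<close>
  have "\<forall>j. \<exists>i. second_moment M (\<lambda>w. X 1 w - (\<phi>0 i (X 1 w) - expectation (\<lambda>w. \<phi>0 i (X 1 w)))) < (1 / 4) ^ j"
  proof
    fix j :: nat
    have "(0::real) < (1 / 4) ^ j" by simp
    from eventually_happens'[OF sequentially_bot order_tendstoD(2)[OF \<phi>0(3) this]]
    show "\<exists>i. second_moment M (\<lambda>w. X 1 w - (\<phi>0 i (X 1 w) - expectation (\<lambda>w. \<phi>0 i (X 1 w)))) < (1 / 4) ^ j" .
  qed
  then obtain r where r: "\<And>j. second_moment M (\<lambda>w. X 1 w - (\<phi>0 (r j) (X 1 w) - expectation (\<lambda>w. \<phi>0 (r j) (X 1 w)))) < (1 / 4) ^ j"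
    by metis
  obtain F :: "nat \<Rightarrow> 'w \<Rightarrow> real" and v :: "nat \<Rightarrow> nat \<Rightarrow> 'w" and L :: "nat \<Rightarrow> nat" where
    Fm: "\<And>l. F l \<in> borel_measurable borel" and FL: "\<And>l. (\<lambda>w. F l (X 1 w)) \<in> L2 M"
    and Fmean: "\<And>l. expectation (\<lambda>w. F l (X 1 w)) = 0"
    and F_eq: "\<And>j y. \<phi>0 (r j) y - expectation (\<lambda>w. \<phi>0 (r j) (X 1 w)) = (\<Sum>l<L j. F l y *\<^sub>R v j l)"
    and v0: "\<And>j l. l \<ge> L j \<Longrightarrow> v j l = 0"
    by (rule simple_functions_common_expansion[of "X 1" "\<lambda>j. \<phi>0 (r j)", OF mX \<phi>0(1) \<phi>0(2)]) (rule that)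
  obtain G :: "nat \<Rightarrow> (nat \<Rightarrow> real) \<Rightarrow> real" where GL: "\<And>l. G l \<in> L2 ?P"
    and G: "\<And>a K. (\<integral>w. iexp (\<Sum>l<K. a l * G l w) \<partial>?P) = exp (- (\<integral>w. (\<Sum>l<K. a l * F l (X 1 w))\<^sup>2 \<partial>M) / 2)"
    by (rule gaussian_sequence_exists[of "\<lambda>l w. F l (X 1 w)" M, OF FL]) (rule that)

  \<comment> \<open>Arbitrary vectors \<open>u\<close> are allowed, so that normality and the moment
    bound apply to differences of approximants as well.\<close>
  define Zs where "Zs u K = (\<lambda>w. \<Sum>l<K. G l w *\<^sub>R u l)" for u :: "nat \<Rightarrow> 'w" and K :: nat
  define h where "h u K = (\<lambda>y. \<Sum>l<K. F l y *\<^sub>R u l)" for u :: "nat \<Rightarrow> 'w" and K :: nat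
  have hm: "h u K \<in> borel_measurable borel" for u K
    unfolding h_def by (intro borel_measurable_sum borel_measurable_scaleR Fm borel_measurable_const)
  have h_iid: "iid_seq M (\<lambda>k w. h u K (X k w))" for u K
    by (rule iid_seq_compose[OF M X hm])
  have hL: "(\<lambda>w. h u K (X 1 w)) \<in> L2 M" for u K
    unfolding h_def by (intro L2_sum L2_scaleR FL)
  have hmean: "expectation (\<lambda>w. h u K (X 1 w)) = 0" for u K
    unfolding h_def using L2_integrable[OF FL] Fmean by (simp add: Bochner_Integration.integral_sum)
  have ZL: "Zs u K \<in> L2 ?P" for u K
    unfolding Zs_def by (intro L2_sum L2_scaleR GL)
  have Z_normal: "normal_rv ?P (Zs u K) 0 (covariance M (\<lambda>w. h u K (X 1 w)))" for u K
  proof (rule normal_rvI[OF P.prob_space_axioms ZL hL hmean])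
    fix \<psi> :: "'w \<Rightarrow>\<^sub>L real"
    have "char_fun ?P (Zs u K) \<psi> = (\<integral>w. iexp (\<Sum>l<K. blinfun_apply \<psi> (u l) * G l w) \<partial>?P)"
      by (simp add: char_fun_def Zs_def blinfun.sum_right blinfun.scaleR_right mult.commute)
    also have "\<dots> = exp (- (\<integral>w. (\<Sum>l<K. blinfun_apply \<psi> (u l) * F l (X 1 w))\<^sup>2 \<partial>M) / 2)" by (rule G)
    also have "(\<integral>w. (\<Sum>l<K. blinfun_apply \<psi> (u l) * F l (X 1 w))\<^sup>2 \<partial>M) = functional_var M (\<lambda>w. h u K (X 1 w)) \<psi>"
      by (simp add: functional_var_def h_def blinfun.sum_right blinfun.scaleR_right mult.commute)
    finally show "char_fun ?P (Zs u K) \<psi> = exp (- functional_var M (\<lambda>w. h u K (X 1 w)) \<psi> / 2)" .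
  qed
  have Z_moment: "second_moment ?P (Zs u K) \<le> C * second_moment M (\<lambda>w. h u K (X 1 w))" for u K
    by (rule normal_rv_second_moment[OF M C h_iid hL hmean Z_normal])

  define Z where "Z j = Zs (v j) (L j)" for j
  define D where "D j = (\<lambda>w. h (v j) (L j) (X 1 w))" for j
  have D: "D j \<in> L2 M" for j unfolding D_def by (rule hL)
  have close: "second_moment M (\<lambda>w. X 1 w - D j w) \<le> (1 / 4) ^ j" for j
    using r[of j] unfolding F_eq D_def h_def by (rule less_imp_le)
  have close1: "second_moment M (\<lambda>w. X 1 w - D j w) \<le> 1" for j
    by (rule order_trans[OF close]) (simp add: power_le_one)
  have ID: "integrable M (\<lambda>w. (norm (X 1 w - D j w))\<^sup>2)" for j
    by (rule L2_integrable_norm_power2[OF L2_diff[OF XL D]])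
  \<comment> \<open>Serves two needs: the summand 4 comes from increments, where two errors of size
    \<open>(1 / 4) ^ j\<close> each enter with factor 2, and the whole bounds the approximants
    themselves uniformly.\<close>
  define B where "B = C * (4 + 2 * second_moment M (X 1))"
  have EX0: "second_moment M (X 1) \<ge> 0" by simp
  have extend: "(\<Sum>l<L j. c l *\<^sub>R v j l) = (\<Sum>l<K. c l *\<^sub>R v j l)" if "L j \<le> K" for j K and c :: "nat \<Rightarrow> real"
    using that by (intro sum.mono_neutral_left) (auto simp: v0)
  have step: "second_moment ?P (\<lambda>w. Z (Suc j) w - Z j w) \<le> B * (1 / 4) ^ j" for j
  proof -
    \<comment> \<open>Both expansions are padded with zero vectors to a common length, so that the
      increment has the form \<open>Zs u K\<close>.\<close>
    define K where "K = max (L j) (L (Suc j))"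
    define u where "u l = v (Suc j) l - v j l" for l
    have K: "L j \<le> K" "L (Suc j) \<le> K" by (auto simp: K_def)
    have Zd: "Z (Suc j) w - Z j w = Zs u K w" for w
      unfolding Z_def Zs_def u_def extend[OF K(1)] extend[OF K(2)]
      by (simp add: scaleR_diff_right sum_subtractf)
    have Dd: "D (Suc j) w - D j w = h u K (X 1 w)" for w
      unfolding D_def h_def u_def extend[OF K(1)] extend[OF K(2)]
      by (simp add: scaleR_diff_right sum_subtractf)
    have "second_moment M (\<lambda>w. D (Suc j) w - D j w)
        \<le> expectation (\<lambda>w. 2 * (norm (X 1 w - D j w))\<^sup>2 + 2 * (norm (X 1 w - D (Suc j) w))\<^sup>2)"
    proof (rule integral_mono)
      show "(norm (D (Suc j) w - D j w))\<^sup>2 \<le> 2 * (norm (X 1 w - D j w))\<^sup>2 + 2 * (norm (X 1 w - D (Suc j) w))\<^sup>2" for w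
        using power2_norm_diff_le[of "X 1 w - D j w" "X 1 w - D (Suc j) w"] by simp
    qed (use ID L2_integrable_norm_power2[OF L2_diff[OF D D]] in simp_all)
    also have "\<dots> = 2 * second_moment M (\<lambda>w. X 1 w - D j w) + 2 * second_moment M (\<lambda>w. X 1 w - D (Suc j) w)"
      using ID[of j] ID[of "Suc j"] by simp
    also have "\<dots> \<le> 4 * (1 / 4) ^ j"
    proof -
      have "(1 / 4 :: real) ^ Suc j \<le> (1 / 4) ^ j" by simp
      then show ?thesis using close[of j] close[of "Suc j"] by linarith
    qed
    finally have "C * second_moment M (\<lambda>w. h u K (X 1 w)) \<le> C * (4 * (1 / 4) ^ j)"
      unfolding Dd using C0 by (intro mult_left_mono) simp_all
    also have "\<dots> \<le> B * (1 / 4) ^ j"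
      unfolding B_def mult.assoc[symmetric] using C0 EX0 by (intro mult_right_mono) simp_all
    finally show ?thesis using Z_moment[of u K] unfolding Zd by linarith
  qed
  have bound: "second_moment ?P (Z j) \<le> B" for j
  proof -
    have "second_moment M (D j)
        \<le> expectation (\<lambda>w. 2 * (norm (X 1 w))\<^sup>2 + 2 * (norm (X 1 w - D j w))\<^sup>2)"
    proof (rule integral_mono)
      show "(norm (D j w))\<^sup>2 \<le> 2 * (norm (X 1 w))\<^sup>2 + 2 * (norm (X 1 w - D j w))\<^sup>2" for w
        using power2_norm_diff_le[of "X 1 w" "X 1 w - D j w"] by simp
    qed (use ID L2_integrable_norm_power2[OF D] L2_integrable_norm_power2[OF XL] in simp_all)
    also have "\<dots> = 2 * second_moment M (X 1) + 2 * second_moment M (\<lambda>w. X 1 w - D j w)"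
      using ID[of j] L2_integrable_norm_power2[OF XL] by simp
    also have "\<dots> \<le> 4 + 2 * second_moment M (X 1)" using close1[of j] by linarith
    finally have "C * second_moment M (D j) \<le> B"
      unfolding B_def using C0 by (intro mult_left_mono) simp_all
    then show ?thesis using Z_moment[of "v j" "L j"] unfolding Z_def D_def by linarith
  qed
  obtain Y where YL: "Y \<in> L2 ?P" and Ylim: "AE w in ?P. (\<lambda>j. Z j w) \<longlonglongrightarrow> Y w"
  proof (rule P.L2_limit_exists[of Z B])
    show "Z j \<in> L2 ?P" for j unfolding Z_def by (rule ZL)
  qed (use step bound in blast)+
  have "normal_rv ?P Y 0 (covariance M (X 1))"
  proof (rule normal_rvI[OF P.prob_space_axioms YL XL mean])
    fix \<psi> :: "'w \<Rightarrow>\<^sub>L real"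
    have "(\<lambda>j. char_fun ?P (Z j) \<psi>) \<longlonglongrightarrow> char_fun ?P Y \<psi>"
      unfolding char_fun_def
    proof (rule integral_dominated_convergence[where w = "\<lambda>_. 1"])
      show "AE w in ?P. (\<lambda>j. iexp (blinfun_apply \<psi> (Z j w))) \<longlonglongrightarrow> iexp (blinfun_apply \<psi> (Y w))"
        using Ylim
      proof (rule AE_mp, intro AE_I2 impI)
        fix w assume "(\<lambda>j. Z j w) \<longlonglongrightarrow> Y w"
        then show "(\<lambda>j. iexp (blinfun_apply \<psi> (Z j w))) \<longlonglongrightarrow> iexp (blinfun_apply \<psi> (Y w))"
          by (intro tendsto_intros)
      qed
      note [measurable] = measurable_blinfun_apply[OF L2_measurable[OF ZL]] measurable_blinfun_apply[OF L2_measurable[OF YL]]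
      show "(\<lambda>w. iexp (blinfun_apply \<psi> (Y w))) \<in> borel_measurable ?P" by measurable
      show "(\<lambda>w. iexp (blinfun_apply \<psi> (Z j w))) \<in> borel_measurable ?P" for j unfolding Z_def by measurable
    qed simp_all
    moreover have "(\<lambda>j. char_fun ?P (Z j) \<psi>) \<longlonglongrightarrow> complex_of_real (exp (- functional_var M (X 1) \<psi> / 2))"
    proof -
      have "char_fun ?P (Z j) \<psi> = exp (- functional_var M (D j) \<psi> / 2)" for j
        unfolding Z_def D_def by (rule char_fun_normal_rv[OF Z_normal hmean])
      moreover have "(\<lambda>j. complex_of_real (exp (- functional_var M (D j) \<psi> / 2))) \<longlonglongrightarrow> complex_of_real (exp (- functional_var M (X 1) \<psi> / 2))"
        by (intro tendsto_intros functional_var_tendsto[OF XL D close]) simp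
      ultimately show ?thesis by simp
    qed
    ultimately show "char_fun ?P Y \<psi> = exp (- functional_var M (X 1) \<psi> / 2)"
      by (rule LIMSEQ_unique)
  qed
  from normal_rv_distr[OF this XL mean] show ?thesis by blast
qed

section \<open>A maximal inequality\<close>

text \<open>First passage at \<open>j\<close> is decided by the indices \<open>l + 1..l + j\<close>,
  the remaining increment by later ones; restrictions of the sequence to disjoint blocks are
  independent.\<close>

lemma (in prob_space) indep_partial_sums:
  fixes X :: "nat \<Rightarrow> 'a \<Rightarrow> 'w::{banach, second_countable_topology}"
  assumes ind: "indep_vars (\<lambda>_. borel) X {1..}"
    and S_def: "S = (\<lambda>j w. \<Sum>k=1..j. X (l + k) w)"
  shows "prob {w\<in>space M. (norm (S j w) > b \<and> (\<forall>i<j. norm (S i w) \<le> b)) \<and> norm (\<Sum>k=1..n. X (l + j + k) w) > a} =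
    prob {w\<in>space M. norm (S j w) > b \<and> (\<forall>i<j. norm (S i w) \<le> b)} *
    prob {w\<in>space M. norm (\<Sum>k=1..n. X (l + j + k) w) > a}"
proof -
  define A where "A = {l + 1..l + j}"
  define B where "B = {l + j + 1..l + j + n}"
  let ?PA = "PiM A (\<lambda>_. borel :: 'w measure)" and ?PB = "PiM B (\<lambda>_. borel :: 'w measure)"
  let ?RA = "\<lambda>w. restrict (\<lambda>i. X i w) A" and ?RB = "\<lambda>w. restrict (\<lambda>i. X i w) B"
  have iv: "indep_var ?PA ?RA ?PB ?RB"
    by (rule indep_var_restrict[OF ind]) (auto simp: A_def B_def)
  \<comment> \<open>The value 0 for \<open>i > j\<close> makes every \<open>U i\<close> measurable
    on the block \<open>A\<close>, not only those that read coordinates inside it.\<close>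
  define U where "U i g = (if i \<le> j then \<Sum>k=1..i. g (l + k) else 0)" for i and g :: "nat \<Rightarrow> 'w"
  define V where "V g = (\<Sum>k=1..n. g (l + j + k))" for g :: "nat \<Rightarrow> 'w"
  have U[measurable]: "U i \<in> borel_measurable ?PA" for i
  proof (cases "i \<le> j")
    case True
    have "(\<lambda>g. \<Sum>k=1..i. g (l + k)) \<in> borel_measurable ?PA"
      using True by (intro borel_measurable_sum measurable_component_singleton) (auto simp: A_def)
    then show ?thesis using True by (simp add: U_def[abs_def])
  qed (simp add: U_def[abs_def])
  have V[measurable]: "V \<in> borel_measurable ?PB"
    unfolding V_def by (intro borel_measurable_sum measurable_component_singleton) (auto simp: B_def)
  define QA where "QA = {g\<in>space ?PA. norm (U j g) > b \<and> (\<forall>i. i < j \<longrightarrow> norm (U i g) \<le> b)}"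
  define QB where "QB = {g\<in>space ?PB. norm (V g) > a}"
  have QA: "QA \<in> sets ?PA" unfolding QA_def by measurable
  have QB: "QB \<in> sets ?PB" unfolding QB_def by measurable
  have SU: "U i (?RA w) = S i w" if "i \<le> j" for i w
    using that unfolding U_def S_def by (auto simp: A_def intro!: sum.cong)
  have VS: "V (?RB w) = (\<Sum>k=1..n. X (l + j + k) w)" for w
    unfolding V_def by (auto simp: B_def intro!: sum.cong)
  have sp: "?RA w \<in> space ?PA" "?RB w \<in> space ?PB" for w by (simp_all add: space_PiM)
  have a: "?RA w \<in> QA \<longleftrightarrow> norm (S j w) > b \<and> (\<forall>i<j. norm (S i w) \<le> b)" for w
    unfolding QA_def using sp by (simp add: SU)
  have b: "?RB w \<in> QB \<longleftrightarrow> norm (\<Sum>k=1..n. X (l + j + k) w) > a" for w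
    unfolding QB_def using sp by (simp add: VS)
  have "prob ((\<lambda>x. (?RA x, ?RB x)) -` (QA \<times> QB) \<inter> space M) = prob (?RA -` QA \<inter> space M) * prob (?RB -` QB \<inter> space M)"
    by (rule indep_varD[OF iv QA QB])
  moreover have "(\<lambda>x. (?RA x, ?RB x)) -` (QA \<times> QB) \<inter> space M =
      {w\<in>space M. (norm (S j w) > b \<and> (\<forall>i<j. norm (S i w) \<le> b)) \<and> norm (\<Sum>k=1..n. X (l + j + k) w) > a}"
    using a b by blast
  moreover have "?RA -` QA \<inter> space M = {w\<in>space M. norm (S j w) > b \<and> (\<forall>i<j. norm (S i w) \<le> b)}"
    using a by blast
  moreover have "?RB -` QB \<inter> space M = {w\<in>space M. norm (\<Sum>k=1..n. X (l + j + k) w) > a}"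
    using b by blast
  ultimately show ?thesis by (simp only:)
qed

text \<open>Ottaviani's argument: decompose according to the first passage over the level \<open>2 * a\<close>.\<close>

lemma partial_sums_maximal_inequality:
  fixes X :: "nat \<Rightarrow> 'a \<Rightarrow> 'w::{banach, second_countable_topology}"
  assumes M: "prob_space M" and C: "type_2_bound M TYPE('w) C" and X: "iid_seq M X"
    and L: "X 1 \<in> L2 M" and mean: "(\<integral>w. X 1 w \<partial>M) = 0" and a: "a > 0"
  shows "measure M {w\<in>space M. \<exists>j\<le>m. norm (\<Sum>k=1..j. X (l + k) w) > 2 * a}
    \<le> 2 * (C * real m * second_moment M (X 1) / a\<^sup>2)"
proof -
  interpret prob_space M by fact
  have C0: "C > 0" using C unfolding type_2_bound_def by blast
  define s2 where "s2 = second_moment M (X 1)"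
  have s2: "s2 \<ge> 0" unfolding s2_def by simp
  define \<beta> where "\<beta> = C * real m * s2 / a\<^sup>2"
  define S where "S = (\<lambda>j w. \<Sum>k=1..j. X (l + k) w)"
  have SL: "(\<lambda>w. \<Sum>k=1..n. X (i + k) w) \<in> L2 M" for i n
    by (intro L2_sum iid_seq_L2[OF M X L]) simp
  have S_meas[measurable]: "S j \<in> borel_measurable M" for j
    unfolding S_def by (rule L2_measurable[OF SL])
  have tail: "prob {w\<in>space M. norm (\<Sum>k=1..n. X (i + k) w) > a} \<le> \<beta>" if "n \<le> m" for n i
  proof -
    have "prob {w\<in>space M. norm (\<Sum>k=1..n. X (i + k) w) > a} \<le> second_moment M (\<lambda>w. \<Sum>k=1..n. X (i + k) w) / a\<^sup>2"
      by (rule Chebyshev_norm[OF SL a])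
    also have "\<dots> \<le> (C * real n * s2) / a\<^sup>2"
      unfolding s2_def by (intro divide_right_mono type_2_bound_iid[OF M C X L mean]) simp
    also have "\<dots> \<le> \<beta>" unfolding \<beta>_def
      using that C0 s2 by (intro divide_right_mono mult_right_mono mult_left_mono) simp_all
    finally show ?thesis .
  qed
  define E where "E = {w\<in>space M. \<exists>j\<le>m. norm (S j w) > 2 * a}"
  have "prob E \<le> 2 * \<beta>"
  \<comment> \<open>For \<open>\<beta> \<ge> 1 / 2\<close> the claimed bound is at least 1;
    otherwise \<open>1 - \<beta> \<ge> 1 / 2\<close>, which is the origin of the factor 2.\<close>
  proof (cases "\<beta> < 1 / 2")
    case False
    then show ?thesis using prob_le_1[of E] by linarith
  next
    case True
    define A where "A j = {w\<in>space M. norm (S j w) > 2 * a \<and> (\<forall>i<j. norm (S i w) \<le> 2 * a)}" for j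
    define F where "F = {w\<in>space M. norm (S m w) > a}"
    have Am[measurable]: "A j \<in> events" for j unfolding A_def by measurable
    have Fm[measurable]: "F \<in> events" unfolding F_def by measurable
    have disj: "disjoint_family_on A {..m}"
      unfolding disjoint_family_on_def
    proof (intro ballI impI)
      fix i j :: nat assume "i \<noteq> j"
      then consider "i < j" | "j < i" by linarith
      then show "A i \<inter> A j = {}" by cases (auto simp: A_def)
    qed
    have E_eq: "E = (\<Union>j\<in>{..m}. A j)"
    proof
      show "E \<subseteq> (\<Union>j\<in>{..m}. A j)"
      proof
        fix w assume "w \<in> E"
        then obtain j where j: "w \<in> space M" "j \<le> m" "norm (S j w) > 2 * a" unfolding E_def by blast
        define i where "i = (LEAST i. norm (S i w) > 2 * a)"
        have "norm (S i w) > 2 * a" unfolding i_def by (rule LeastI) (rule j(3))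
        moreover have "i \<le> j" unfolding i_def by (rule Least_le) (rule j(3))
        moreover have "norm (S i' w) \<le> 2 * a" if "i' < i" for i'
          using not_less_Least[OF that[unfolded i_def]] by simp
        ultimately show "w \<in> (\<Union>j\<in>{..m}. A j)" using j unfolding A_def by auto
      qed
      show "(\<Union>j\<in>{..m}. A j) \<subseteq> E" unfolding A_def E_def by blast
    qed
    \<comment> \<open>After first passage above \<open>2 * a\<close>, either the remaining increment
      exceeds \<open>a\<close>, independently of \<open>A j\<close> and with probability at most
      \<open>\<beta>\<close>, or the final sum still exceeds \<open>a\<close>.\<close>
    have step: "prob (A j) * (1 - \<beta>) \<le> prob (A j \<inter> F)" if j: "j \<le> m" for j
    proof -
      define n where "n = m - j"
      have Sm: "S m w = S j w + (\<Sum>k=1..n. X (l + j + k) w)" for w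
      proof -
        have "S m w = (\<Sum>k=1..j + n. X (l + k) w)" using j by (simp add: S_def n_def)
        also have "\<dots> = S j w + (\<Sum>k=j+1..j+n. X (l + k) w)"
          unfolding S_def by (rule sum.ub_add_nat) simp
        also have "(\<Sum>k=j+1..j+n. X (l + k) w) = (\<Sum>k=1..n. X (l + j + k) w)"
          using sum.shift_bounds_cl_nat_ivl[of "\<lambda>k. X (l + k) w" 1 j n] by (simp add: ac_simps)
        finally show ?thesis .
      qed
      define B where "B = {w\<in>space M. norm (\<Sum>k=1..n. X (l + j + k) w) > a}"
      note [measurable] = L2_measurable[OF SL]
      have Bm[measurable]: "B \<in> events" unfolding B_def by measurable
      have "prob (A j \<inter> B) = prob (A j) * prob B"
      proof -
        have ind: "indep_vars (\<lambda>_. borel) X {1..}" using X unfolding iid_seq_def by blast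
        have "A j \<inter> B = {w\<in>space M. (norm (S j w) > 2 * a \<and> (\<forall>i<j. norm (S i w) \<le> 2 * a)) \<and> norm (\<Sum>k=1..n. X (l + j + k) w) > a}"
          unfolding A_def B_def by blast
        then show ?thesis
          using indep_partial_sums[OF ind S_def, where j = j and b = "2 * a" and n = n and a = a] by (simp only: A_def B_def)
      qed
      also have "\<dots> \<le> prob (A j) * \<beta>"
        unfolding B_def using tail[of n "l + j"] by (intro mult_left_mono) (simp_all add: n_def)
      finally have AB: "prob (A j \<inter> B) \<le> prob (A j) * \<beta>" .
      have "A j \<subseteq> (A j \<inter> B) \<union> (A j \<inter> F)"
      proof (rule subsetI, rule ccontr)
        fix w assume w: "w \<in> A j" and n: "w \<notin> (A j \<inter> B) \<union> (A j \<inter> F)"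
        have 1: "norm (\<Sum>k=1..n. X (l + j + k) w) \<le> a" using w n unfolding B_def A_def by auto
        have 2: "norm (S m w) \<le> a" using w n unfolding F_def A_def by auto
        have "norm (S j w) = norm (S m w - (\<Sum>k=1..n. X (l + j + k) w))" by (simp add: Sm)
        also have "\<dots> \<le> norm (S m w) + norm (\<Sum>k=1..n. X (l + j + k) w)" by (rule norm_triangle_ineq4)
        also have "\<dots> \<le> 2 * a" using 1 2 by linarith
        finally show False using w unfolding A_def by simp
      qed
      then have "prob (A j) \<le> prob ((A j \<inter> B) \<union> (A j \<inter> F))" by (intro finite_measure_mono) auto
      also have "\<dots> \<le> prob (A j \<inter> B) + prob (A j \<inter> F)" by (intro measure_Un_le) auto
      finally show ?thesis using AB by (simp add: algebra_simps)
    qed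
    have "prob E = (\<Sum>j\<le>m. prob (A j))"
      unfolding E_eq by (rule finite_measure_finite_Union) (use disj in auto)
    then have "prob E * (1 - \<beta>) = (\<Sum>j\<le>m. prob (A j) * (1 - \<beta>))" by (simp add: sum_distrib_right)
    also have "\<dots> \<le> (\<Sum>j\<le>m. prob (A j \<inter> F))" by (intro sum_mono step) simp
    also have "\<dots> = prob (\<Union>j\<in>{..m}. A j \<inter> F)"
      using disj by (intro finite_measure_finite_Union[symmetric]) (auto simp: disjoint_family_on_def)
    also have "\<dots> \<le> prob F" by (intro finite_measure_mono) auto
    also have "\<dots> \<le> \<beta>" unfolding F_def S_def by (rule tail) simp
    finally have "prob E * (1 - \<beta>) \<le> \<beta>" .
    moreover have "prob E * (1 / 2) \<le> prob E * (1 - \<beta>)" using True by (intro mult_left_mono) simp_all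
    ultimately show ?thesis by linarith
  qed
  then show ?thesis unfolding E_def \<beta>_def S_def s2_def .
qed

section \<open>Random indices\<close>

lemma tendsto_zero_of_eventually_le:
  fixes p :: "nat \<Rightarrow> real"
  assumes le: "\<And>\<eta>. \<eta> > 0 \<Longrightarrow> \<forall>\<^sub>F n in sequentially. p n \<le> \<eta>" and nonneg: "\<And>n. p n \<ge> 0"
  shows "p \<longlonglongrightarrow> 0"
proof (rule tendstoI)
  fix e :: real assume e: "e > 0"
  have "\<forall>\<^sub>F n in sequentially. p n \<le> e / 2" using e by (intro le) simp
  then show "\<forall>\<^sub>F n in sequentially. dist (p n) 0 < e"
  proof eventually_elim
    case (elim n)
    then show ?case using nonneg[of n] e by simp
  qed
qed

text \<open>Both sums are compared with the sum at the left end \<open>l\<close> of the window, so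
  one maximal inequality handles the random and the deterministic index. The maximum over the whole
  window also disposes of any dependence between \<open>N\<close> and \<open>X\<close>.\<close>

lemma random_sum_gap_tendsto_zero:
  fixes X :: "nat \<Rightarrow> 'a \<Rightarrow> 'w::{banach, second_countable_topology}" and N :: "nat \<Rightarrow> 'a \<Rightarrow> nat"
  assumes M: "prob_space M" and C: "type_2_bound M TYPE('w) C" and X: "iid_seq M X"
    and XL: "X 1 \<in> L2 M" and mean: "(\<integral>w. X 1 w \<partial>M) = 0"
    and \<theta>: "filterlim \<theta> at_top sequentially"
    and N\<theta>: "tendsto_in_prob M (\<lambda>n w. real (N n w) / \<theta> n) 1"
    and e: "e > 0"
    and S_def: "S = (\<lambda>n w. \<Sum>k=1..n. X k w)" and K_def: "K = (\<lambda>n. max 1 (nat \<lfloor>\<theta> n\<rfloor>))"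
  shows "(\<lambda>n. measure M {w\<in>space M. norm (S (N n w) w - S (K n) w) > e * sqrt (\<theta> n)}) \<longlonglongrightarrow> 0"
proof (rule tendsto_zero_of_eventually_le)
  interpret prob_space M by fact
  have C0: "C > 0" using C unfolding type_2_bound_def by blast
  define s2 where "s2 = second_moment M (X 1)"
  have s2: "s2 \<ge> 0" unfolding s2_def by simp
  fix \<eta> :: real assume \<eta>: "\<eta> > 0"
  \<comment> \<open>The factor 128 collects 2 from the maximal inequality, 4 from the window length
    \<open>4 * (\<delta> * t)\<close> and 16 from
    \<open>a\<^sup>2 = e\<^sup>2 * t / 16\<close>.\<close>
  define c where "c = 128 * C * s2"
  have c: "c \<ge> 0" unfolding c_def using C0 s2 by simp
  define \<delta> where "\<delta> = min (1 / 2) (\<eta> * e\<^sup>2 / (2 * (c + 1)))"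
  have \<delta>: "\<delta> > 0" "\<delta> \<le> 1 / 2" "\<delta> \<le> \<eta> * e\<^sup>2 / (2 * (c + 1))"
    using \<eta> e c unfolding \<delta>_def by (simp_all only: min_less_iff_conj min.cobounded1 min.cobounded2) simp
  have "c * \<delta> \<le> (c + 1) * (\<eta> * e\<^sup>2 / (2 * (c + 1)))"
    using c \<delta>(1,3) by (intro mult_mono) simp_all
  also have "\<dots> = \<eta> / 2 * e\<^sup>2" using c by (simp add: field_simps)
  finally have c\<delta>: "c * \<delta> / e\<^sup>2 \<le> \<eta> / 2" using e by (simp add: field_simps)
  have ev1: "\<forall>\<^sub>F n in sequentially. \<theta> n \<ge> 1 / \<delta>"
    using \<theta> unfolding filterlim_at_top by blast
  have "(\<lambda>n. prob {w\<in>space M. \<bar>real (N n w) / \<theta> n - 1\<bar> > \<delta>}) \<longlonglongrightarrow> 0"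
    using N\<theta> \<delta>(1) unfolding tendsto_in_prob_def by blast
  from order_tendstoD(2)[OF this, of "\<eta> / 2"] \<eta>
  have ev2: "\<forall>\<^sub>F n in sequentially. prob {w\<in>space M. \<bar>real (N n w) / \<theta> n - 1\<bar> > \<delta>} < \<eta> / 2" by simp
  show "\<forall>\<^sub>F n in sequentially. prob {w\<in>space M. norm (S (N n w) w - S (K n) w) > e * sqrt (\<theta> n)} \<le> \<eta>"
    using ev1 ev2 eventually_ge_at_top[of 1]
  proof eventually_elim
    case (elim n)
    define t where "t = \<theta> n"
    have dt: "\<delta> * t \<ge> 1" using elim(1) \<delta>(1) by (simp add: t_def field_simps)
    have t2: "t \<ge> 2"
    proof -
      have "2 \<le> 1 / \<delta>" using \<delta> by (simp add: field_simps)
      then show ?thesis using elim(1) unfolding t_def by linarith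
    qed
    define l where "l = nat \<lfloor>(1 - \<delta>) * t\<rfloor>"
    \<comment> \<open>The final \<open>+ 1\<close> makes up for the floor in \<open>l\<close>; it
      and the ceiling are absorbed into \<open>4 * (\<delta> * t)\<close> thanks to
      \<open>\<delta> * t \<ge> 1\<close>.\<close>
    define m where "m = nat \<lceil>2 * (\<delta> * t)\<rceil> + 1"
    have lt: "(1 - \<delta>) * t \<ge> 0" using \<delta> t2 by simp
    have l: "real l \<le> (1 - \<delta>) * t" "real l > (1 - \<delta>) * t - 1"
      unfolding l_def using lt by simp_all
    have m: "real m \<ge> 2 * (\<delta> * t) + 1" "real m \<le> 4 * (\<delta> * t)"
    proof -
      have "real m = real_of_int \<lceil>2 * (\<delta> * t)\<rceil> + 1" unfolding m_def using dt by simp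
      then show "real m \<ge> 2 * (\<delta> * t) + 1" "real m \<le> 4 * (\<delta> * t)" using dt by linarith+
    qed
    have window: "l \<le> q \<and> q \<le> l + m" if "(1 - \<delta>) * t \<le> real q" "real q \<le> (1 + \<delta>) * t" for q :: nat
    proof -
      have "real l \<le> real q" using that(1) l(1) by linarith
      moreover have "real q \<le> real (l + m)"
        using that(2) l(2) m(1) by (simp add: algebra_simps)
      ultimately show ?thesis by (simp only: of_nat_le_iff)
    qed
    have Kr: "(1 - \<delta>) * t \<le> real (K n)" "real (K n) \<le> (1 + \<delta>) * t"
    proof -
      have "K n = nat \<lfloor>t\<rfloor>" using t2 unfolding K_def t_def by (simp add: max_def) linarith
      then have "real (K n) \<le> t" "real (K n) \<ge> t - 1" using t2 by simp_all
      then show "(1 - \<delta>) * t \<le> real (K n)" "real (K n) \<le> (1 + \<delta>) * t"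
        using dt by (simp_all add: algebra_simps)
    qed
    \<comment> \<open>Two deviations of at most \<open>2 * a\<close> add up to
      \<open>e * sqrt t\<close>.\<close>
    define a where "a = e * sqrt t / 4"
    have a: "a > 0" unfolding a_def using e t2 by simp
    let ?A = "{w\<in>space M. \<bar>real (N n w) / t - 1\<bar> > \<delta>}"
    let ?B = "{w\<in>space M. \<exists>j\<le>m. norm (\<Sum>k=1..j. X (l + k) w) > 2 * a}"
    have diff: "S q w - S l w = (\<Sum>k=1..q - l. X (l + k) w)" if "l \<le> q" for q w
    proof -
      have "S q w = (\<Sum>k=1..l + (q - l). X k w)" using that by (simp add: S_def)
      also have "\<dots> = S l w + (\<Sum>k=l+1..l+(q-l). X k w)"
        unfolding S_def by (rule sum.ub_add_nat) simp
      also have "(\<Sum>k=l+1..l+(q-l). X k w) = (\<Sum>k=1..q - l. X (l + k) w)"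
        using sum.shift_bounds_cl_nat_ivl[of "\<lambda>k. X k w" 1 l "q - l"] by (simp add: ac_simps)
      finally show ?thesis by simp
    qed
    have sub: "{w\<in>space M. norm (S (N n w) w - S (K n) w) > e * sqrt (\<theta> n)} \<subseteq> ?A \<union> ?B"
    proof (rule subsetI, rule ccontr)
      fix w assume w: "w \<in> {w\<in>space M. norm (S (N n w) w - S (K n) w) > e * sqrt (\<theta> n)}" and n: "w \<notin> ?A \<union> ?B"
      have small: "norm (\<Sum>k=1..j. X (l + k) w) \<le> 2 * a" if "j \<le> m" for j
        using w n that by (auto simp: not_less)
      have "\<bar>real (N n w) / t - 1\<bar> \<le> \<delta>" using w n by auto
      then have "1 - \<delta> \<le> real (N n w) / t" "real (N n w) / t \<le> 1 + \<delta>" by linarith+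
      then have Nr: "(1 - \<delta>) * t \<le> real (N n w)" "real (N n w) \<le> (1 + \<delta>) * t"
        using t2 by (simp_all add: field_simps)
      have 1: "norm (S (N n w) w - S l w) \<le> 2 * a"
        using window[OF Nr] by (simp only: diff) (rule small, linarith)
      have 2: "norm (S (K n) w - S l w) \<le> 2 * a"
        using window[OF Kr] by (simp only: diff) (rule small, linarith)
      have "norm (S (N n w) w - S (K n) w) = norm ((S (N n w) w - S l w) - (S (K n) w - S l w))" by simp
      also have "\<dots> \<le> norm (S (N n w) w - S l w) + norm (S (K n) w - S l w)" by (rule norm_triangle_ineq4)
      also have "\<dots> \<le> e * sqrt (\<theta> n)" using 1 2 unfolding a_def t_def by linarith
      finally show False using w by simp
    qed
    have [measurable]: "X (l + Suc k) \<in> borel_measurable M" for k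
      by (rule iid_seq_measurable[OF M X]) simp
    have PS[measurable]: "(\<lambda>w. \<Sum>k=1..j. X (l + k) w) \<in> borel_measurable M" for j
      by (intro borel_measurable_sum iid_seq_measurable[OF M X]) simp
    have [measurable]: "(\<lambda>w. real (N n w) / t) \<in> borel_measurable M"
      using N\<theta> elim(3) unfolding tendsto_in_prob_def t_def by blast
    have B: "?B \<in> events" by measurable
    have A: "?A \<in> events" by measurable
    have "prob {w\<in>space M. norm (S (N n w) w - S (K n) w) > e * sqrt (\<theta> n)} \<le> prob (?A \<union> ?B)"
      by (rule finite_measure_mono[OF sub sets.Un[OF A B]])
    also have "\<dots> \<le> prob ?A + prob ?B" using A B by (rule measure_Un_le)
    also have "prob ?B \<le> \<eta> / 2"
    proof -
      have "prob ?B \<le> 2 * (C * real m * s2 / a\<^sup>2)"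
        unfolding s2_def by (rule partial_sums_maximal_inequality[OF M C X XL mean a])
      also have "\<dots> \<le> 2 * (C * (4 * (\<delta> * t)) * s2 / a\<^sup>2)"
        using C0 s2 m(2) by (intro mult_left_mono divide_right_mono mult_right_mono) simp_all
      also have "\<dots> = c * \<delta> / e\<^sup>2"
      proof -
        have a2: "a\<^sup>2 = e\<^sup>2 * t / 16" using t2 by (simp add: a_def power_divide power_mult_distrib)
        show ?thesis unfolding a2 c_def using t2 e by (simp add: field_simps)
      qed
      finally show ?thesis using c\<delta> by linarith
    qed
    also have "prob ?A + \<eta> / 2 \<le> \<eta>" using elim(2) unfolding t_def by linarith
    finally show ?case by simp
  qed
qed simp

lemma abs_inverse_sqrt_diff_le:
  fixes t :: real
  assumes "\<bar>t - 1\<bar> \<le> 1 / 2"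
  shows "\<bar>1 / sqrt t - 1\<bar> \<le> \<bar>t - 1\<bar>"
proof -
  define u where "u = sqrt t"
  have t: "t \<ge> 1 / 2" using assms by linarith
  have u: "u\<^sup>2 = t" "u > 0" using t by (simp_all add: u_def)
  have "1 / 2 \<le> u" unfolding u_def using t by (intro real_le_rsqrt) (simp add: power2_eq_square)
  \<comment> \<open>Both \<open>u\<^sup>2\<close> and \<open>u\<close> are at least
    \<open>1 / 2\<close>. The inequality trades division by \<open>u\<close> for multiplication by
    \<open>u + 1\<close>, which completes \<open>u - 1\<close> to \<open>t - 1\<close>.\<close>
  have 1: "1 \<le> u * (u + 1)" using u t \<open>1 / 2 \<le> u\<close> by (simp add: power2_eq_square distrib_left)
  have "\<bar>1 / u - 1\<bar> = \<bar>u - 1\<bar> / u"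
  proof -
    have "1 / u - 1 = - ((u - 1) / u)" using u(2) by (simp add: field_simps)
    then show ?thesis using u(2) by simp
  qed
  also have "\<dots> \<le> \<bar>u - 1\<bar> * (u + 1)"
  proof -
    have "\<bar>u - 1\<bar> * 1 \<le> \<bar>u - 1\<bar> * (u * (u + 1))" using 1 by (intro mult_left_mono) simp_all
    then show ?thesis using u(2) by (simp add: divide_le_eq mult_ac)
  qed
  also have "\<dots> = \<bar>(u - 1) * (u + 1)\<bar>" using u(2) by (simp add: abs_mult)
  also have "(u - 1) * (u + 1) = t - 1" by (simp add: u(1)[symmetric] power2_eq_square algebra_simps)
  finally show ?thesis unfolding u_def .
qed

lemma L2_scaleR_const:
  assumes "V \<in> L2 M"
  shows "(\<lambda>w. c *\<^sub>R V w) \<in> L2 M"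
proof (rule L2_bound)
  note [measurable] = L2_measurable[OF assms]
  show "(\<lambda>w. c *\<^sub>R V w) \<in> borel_measurable M" by measurable
  show "integrable M (\<lambda>w. c\<^sup>2 * (norm (V w))\<^sup>2)" using L2_integrable_norm_power2[OF assms] by simp
qed (simp add: power_mult_distrib)

text \<open>\<open>K\<close> is only asked to tend to infinity: it will be a rounding of
  \<open>\<theta>\<close>, which may fail to be monotone.\<close>

lemma tendsto_in_distribution_subsequence:
  fixes Z :: "'b \<Rightarrow> 'w::topological_space"
  assumes "tendsto_in_distribution M X P Z" "filterlim K at_top sequentially" "\<And>n. K n \<ge> 1"
  shows "tendsto_in_distribution M (\<lambda>n. X (K n)) P Z"
  unfolding tendsto_in_distribution_def
proof (intro conjI allI impI)
  fix f :: "'w \<Rightarrow> real" assume f: "continuous_on UNIV f" "bounded (range f)"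
  have "(\<lambda>n. \<integral>w. f (X n w) \<partial>M) \<longlonglongrightarrow> (\<integral>w. f (Z w) \<partial>P)"
    using assms(1) f unfolding tendsto_in_distribution_def by blast
  from filterlim_compose[OF this assms(2)]
  show "(\<lambda>n. \<integral>w. f (X (K n) w) \<partial>M) \<longlonglongrightarrow> (\<integral>w. f (Z w) \<partial>P)" .
qed (use assms in \<open>auto simp: tendsto_in_distribution_def\<close>)

theorem random_index_central_limit:
  fixes X :: "nat \<Rightarrow> 'a \<Rightarrow> 'w::{banach, second_countable_topology}" and N :: "nat \<Rightarrow> 'a \<Rightarrow> nat"
  assumes M: "prob_space M" and C: "type_2_bound M TYPE('w) C" and X: "iid_seq M X"
    and XL: "X 1 \<in> L2 M" and mean: "(\<integral>w. X 1 w \<partial>M) = 0"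
    and N: "\<And>n. n \<ge> 1 \<Longrightarrow> N n \<in> M \<rightarrow>\<^sub>M count_space {1..}"
    and \<theta>: "filterlim \<theta> at_top sequentially"
    and N\<theta>: "tendsto_in_prob M (\<lambda>n w. real (N n w) / \<theta> n) 1"
    and Z: "normal_rv P Z 0 (covariance M (X 1))"
  shows "tendsto_in_distribution M (\<lambda>n w. (1 / sqrt (\<theta> n)) *\<^sub>R (\<Sum>k=1..N n w. X k w)) P Z"
    and "tendsto_in_distribution M (\<lambda>n w. (1 / sqrt (real (N n w))) *\<^sub>R (\<Sum>k=1..N n w. X k w)) P Z"
proof -
  interpret prob_space M by fact
  have C0: "C > 0" using C unfolding type_2_bound_def by blast
  define s2 where "s2 = second_moment M (X 1)"
  have s2: "s2 \<ge> 0" unfolding s2_def by simp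
  define S where "S = (\<lambda>n w. \<Sum>k=1..n. X k w)"
  \<comment> \<open>The maximum with 1 keeps the index in the range to which uniform tightness
    refers; it is inactive once \<open>\<theta> n \<ge> 1\<close>.\<close>
  define K where "K = (\<lambda>n. max 1 (nat \<lfloor>\<theta> n\<rfloor>))"
  define W where "W n = normalized_sum X (K n)" for n
  define V1 where "V1 n w = (1 / sqrt (\<theta> n)) *\<^sub>R S (N n w) w" for n w
  define V2 where "V2 n w = (1 / sqrt (real (N n w))) *\<^sub>R S (N n w) w" for n w
  have K1: "K n \<ge> 1" for n unfolding K_def by simp
  have S_meas: "S n \<in> borel_measurable M" for n
    unfolding S_def by (intro borel_measurable_sum iid_seq_measurable[OF M X]) simp
  have WL: "W n \<in> L2 M" for n unfolding W_def by (rule normalized_sum_L2[OF M X XL])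
  have W_moment: "second_moment M (W n) \<le> C * s2" for n
    unfolding W_def s2_def by (rule normalized_sum_second_moment[OF M C X XL mean])
  note W_meas[measurable] = L2_measurable[OF WL]
  have V1_meas: "V1 n \<in> borel_measurable M" if "n \<ge> 1" for n
  proof -
    have "(\<lambda>w. (\<lambda>i w. (1 / sqrt (\<theta> n)) *\<^sub>R S i w) (N n w) w) \<in> borel_measurable M"
      by (rule measurable_compose_countable'[OF _ N[OF that]])
         (auto intro!: borel_measurable_scaleR borel_measurable_const S_meas)
    then show ?thesis unfolding V1_def .
  qed
  have V2_meas: "V2 n \<in> borel_measurable M" if "n \<ge> 1" for n
  proof -
    have "(\<lambda>w. (\<lambda>i w. (1 / sqrt (real i)) *\<^sub>R S i w) (N n w) w) \<in> borel_measurable M"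
      by (rule measurable_compose_countable'[OF _ N[OF that]])
         (auto intro!: borel_measurable_scaleR borel_measurable_const S_meas)
    then show ?thesis unfolding V2_def .
  qed
  have K_top: "filterlim K at_top sequentially"
    unfolding filterlim_at_top
  proof
    fix q :: nat
    have "\<forall>\<^sub>F n in sequentially. \<theta> n \<ge> real q" using \<theta> unfolding filterlim_at_top by blast
    then show "\<forall>\<^sub>F n in sequentially. q \<le> K n"
    proof eventually_elim
      case (elim n)
      then have "q \<le> nat \<lfloor>\<theta> n\<rfloor>" by (simp add: le_nat_iff le_floor_iff)
      then show ?case unfolding K_def by simp
    qed
  qed
  have W_tight: "uniformly_tight M W"
    unfolding uniformly_tight_def
  proof (intro allI impI)
    fix e :: real assume "e > 0"
    then obtain T where T: "compact T" "\<And>n. n \<ge> 1 \<Longrightarrow> prob {w\<in>space M. normalized_sum X n w \<notin> T} \<le> e"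
      using uniformly_tight_normalized_sum[OF M C X XL mean] unfolding uniformly_tight_def by blast
    then show "\<exists>T. compact T \<and> (\<forall>n\<ge>1. prob {w\<in>space M. W n w \<notin> T} \<le> e)"
      unfolding W_def using T(2)[OF K1] by (intro exI[of _ T]) simp
  qed
  have W_lim: "tendsto_in_distribution M W P Z"
    unfolding W_def by (rule tendsto_in_distribution_subsequence[OF type_2_central_limit[OF M C X XL mean Z] K_top K1])

  have c_lim: "(\<lambda>n. sqrt (real (K n) / \<theta> n) - 1) \<longlonglongrightarrow> 0"
  proof -
    have "(\<lambda>n. real (K n) / \<theta> n) \<longlonglongrightarrow> 1"
    proof (rule tendsto_sandwich)
      have "(\<lambda>n. inverse (\<theta> n)) \<longlonglongrightarrow> 0" by (rule tendsto_inverse_0_at_top[OF \<theta>])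
      from tendsto_diff[OF tendsto_const this, of 1] show "(\<lambda>n. 1 - inverse (\<theta> n)) \<longlonglongrightarrow> 1" by simp
      have big: "\<forall>\<^sub>F n in sequentially. \<theta> n \<ge> 1" using \<theta> unfolding filterlim_at_top by blast
      have Kb: "t - 1 \<le> real (max 1 (nat \<lfloor>t\<rfloor>)) \<and> real (max 1 (nat \<lfloor>t\<rfloor>)) \<le> t" if "t \<ge> 1" for t :: real
      proof -
        have "max 1 (nat \<lfloor>t\<rfloor>) = nat \<lfloor>t\<rfloor>" using that by (simp add: max_def) linarith
        then show ?thesis using that by simp
      qed
      show "\<forall>\<^sub>F n in sequentially. 1 - inverse (\<theta> n) \<le> real (K n) / \<theta> n"
        using big
      proof eventually_elim
        case (elim n)
        have "1 - inverse (\<theta> n) = (\<theta> n - 1) / \<theta> n" using elim by (simp add: diff_divide_distrib inverse_eq_divide)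
        also have "\<dots> \<le> real (K n) / \<theta> n"
          using Kb[OF elim] elim unfolding K_def by (intro divide_right_mono) simp_all
        finally show ?case .
      qed
      show "\<forall>\<^sub>F n in sequentially. real (K n) / \<theta> n \<le> 1"
        using big
      proof eventually_elim
        case (elim n)
        have "real (K n) / \<theta> n \<le> \<theta> n / \<theta> n"
          using Kb[OF elim] elim unfolding K_def by (intro divide_right_mono) simp_all
        then show ?case using elim by simp
      qed
    qed simp
    from tendsto_diff[OF tendsto_real_sqrt[OF this] tendsto_const, of 1] show ?thesis by simp
  qed

  have close1: "(\<lambda>n. prob {w\<in>space M. dist (V1 n w) (W n w) > e}) \<longlonglongrightarrow> 0" if e: "e > 0" for e
  proof (rule tendsto_sandwich[OF _ _ tendsto_const])
    define c where "c n = sqrt (real (K n) / \<theta> n) - 1" for n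
    define p where "p n = prob {w\<in>space M. norm (S (N n w) w - S (K n) w) > e / 2 * sqrt (\<theta> n)}" for n
    define q where "q n = (c n)\<^sup>2 * (C * s2) / (e / 2)\<^sup>2" for n
    have "p \<longlonglongrightarrow> 0" unfolding p_def
      by (rule random_sum_gap_tendsto_zero[OF M C X XL mean \<theta> N\<theta> half_gt_zero[OF e] S_def K_def])
    moreover have "q \<longlonglongrightarrow> 0"
    proof -
      have "(\<lambda>n. (c n)\<^sup>2 * (C * s2) / (e / 2)\<^sup>2) \<longlonglongrightarrow> 0\<^sup>2 * (C * s2) / (e / 2)\<^sup>2"
        using e c_lim unfolding c_def by (intro tendsto_intros) simp_all
      then show ?thesis unfolding q_def by simp
    qed
    ultimately show "(\<lambda>n. p n + q n) \<longlonglongrightarrow> 0" using tendsto_add[of p 0 sequentially q 0] by simp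
    show "\<forall>\<^sub>F n in sequentially. prob {w\<in>space M. dist (V1 n w) (W n w) > e} \<le> p n + q n"
    proof -
      have "\<forall>\<^sub>F n in sequentially. \<theta> n \<ge> 1" using \<theta> unfolding filterlim_at_top by blast
      then show ?thesis
        using eventually_ge_at_top[of 1]
      proof eventually_elim
        case (elim n)
        let ?A = "{w\<in>space M. norm (S (N n w) w - S (K n) w) > e / 2 * sqrt (\<theta> n)}"
        let ?B = "{w\<in>space M. norm (c n *\<^sub>R W n w) > e / 2}"
        have \<theta>0: "sqrt (\<theta> n) > 0" using elim(1) by simp
        \<comment> \<open>Two errors: the gap between the sums at \<open>N n w\<close> and at
          \<open>K n\<close>, and the change of norming from \<open>sqrt (K n)\<close> to
          \<open>sqrt (\<theta> n)\<close>, whose factor \<open>c n\<close> tends to 0 while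
          \<open>W n\<close> is bounded in \<open>L2\<close>.\<close>
        have split: "V1 n w - W n w = (1 / sqrt (\<theta> n)) *\<^sub>R (S (N n w) w - S (K n) w) + c n *\<^sub>R W n w" for w
        proof -
          have "c n * (1 / sqrt (real (K n))) = 1 / sqrt (\<theta> n) - 1 / sqrt (real (K n))"
            using \<theta>0 K1[of n] by (simp add: c_def real_sqrt_divide field_simps)
          then have "c n *\<^sub>R W n w = (1 / sqrt (\<theta> n)) *\<^sub>R S (K n) w - W n w"
            unfolding W_def normalized_sum_def S_def by (simp only: scaleR_scaleR scaleR_left_diff_distrib)
          then show ?thesis by (simp add: V1_def scaleR_diff_right)
        qed
        have sub: "{w\<in>space M. dist (V1 n w) (W n w) > e} \<subseteq> ?A \<union> ?B"
        proof (rule subsetI, rule ccontr)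
          fix w assume w: "w \<in> {w\<in>space M. dist (V1 n w) (W n w) > e}" and n: "w \<notin> ?A \<union> ?B"
          have "norm (S (N n w) w - S (K n) w) \<le> e / 2 * sqrt (\<theta> n)" using w n by auto
          then have 1: "norm ((1 / sqrt (\<theta> n)) *\<^sub>R (S (N n w) w - S (K n) w)) \<le> e / 2"
            using \<theta>0 by (simp add: divide_le_eq)
          have 2: "norm (c n *\<^sub>R W n w) \<le> e / 2" using w n by auto
          have "dist (V1 n w) (W n w) \<le> norm ((1 / sqrt (\<theta> n)) *\<^sub>R (S (N n w) w - S (K n) w)) + norm (c n *\<^sub>R W n w)"
            unfolding dist_norm split by (rule norm_triangle_ineq)
          also have "\<dots> \<le> e" using 1 2 by linarith
          finally show False using w by simp
        qed
        have A: "?A \<in> events"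
        proof -
          have "(\<lambda>w. S (N n w) w) \<in> borel_measurable M"
            by (rule measurable_compose_countable'[OF _ N[OF elim(2)]]) (auto intro: S_meas)
          with S_meas[of "K n"] show ?thesis by measurable
        qed
        have B: "?B \<in> events" by measurable
        have "prob {w\<in>space M. dist (V1 n w) (W n w) > e} \<le> prob (?A \<union> ?B)"
          by (rule finite_measure_mono[OF sub sets.Un[OF A B]])
        also have "\<dots> \<le> prob ?A + prob ?B" using A B by (rule measure_Un_le)
        also have "prob ?B \<le> q n"
        proof -
          have "prob ?B \<le> second_moment M (\<lambda>w. c n *\<^sub>R W n w) / (e / 2)\<^sup>2"
            by (rule Chebyshev_norm[OF L2_scaleR_const[OF WL] half_gt_zero[OF e]])
          also have "\<dots> = (c n)\<^sup>2 * second_moment M (W n) / (e / 2)\<^sup>2"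
            by (simp add: power_mult_distrib)
          also have "\<dots> \<le> q n"
            unfolding q_def by (intro divide_right_mono mult_left_mono W_moment) simp_all
          finally show ?thesis .
        qed
        finally show ?case unfolding p_def by simp
      qed
    qed
  qed simp

  have close2: "(\<lambda>n. prob {w\<in>space M. dist (V2 n w) (W n w) > e}) \<longlonglongrightarrow> 0" if e: "e > 0" for e
  proof (rule tendsto_zero_of_eventually_le)
    fix \<eta> :: real assume \<eta>: "\<eta> > 0"
    \<comment> \<open>The level at which Chebyshev bounds the probability of
      \<open>norm (W n w) > R\<close> by \<open>\<eta> / 3\<close>; the \<open>+ 1\<close> keeps it
      positive when the moment bound is zero.\<close>
    define R where "R = sqrt ((C * s2 + 1) / (\<eta> / 3))"
    have Cs: "C * s2 \<ge> 0" using C0 s2 by simp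
    have R: "R > 0" "R\<^sup>2 = (C * s2 + 1) / (\<eta> / 3)" using \<eta> Cs by (auto simp: R_def)
    \<comment> \<open>On the good event \<open>norm (V1 n w) \<le> R + 1\<close>, so a relative
      change of norming by \<open>\<delta>\<close> costs at most \<open>e / 2\<close>; the cap
      \<open>1 / 2\<close> is the range of the square root estimate.\<close>
    define \<delta> where "\<delta> = min (1 / 2) (e / (2 * (R + 1)))"
    have \<delta>: "\<delta> > 0" "\<delta> \<le> 1 / 2" "\<delta> \<le> e / (2 * (R + 1))"
      using e R(1) unfolding \<delta>_def by (simp_all only: min_less_iff_conj min.cobounded1 min.cobounded2) simp
    have "\<delta> * (R + 1) \<le> e / (2 * (R + 1)) * (R + 1)"
      using R(1) \<delta>(3) by (intro mult_right_mono) simp_all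
    also have "\<dots> = e / 2" using R(1) by (simp add: field_simps)
    finally have \<delta>R: "\<delta> * (R + 1) \<le> e / 2" .
    \<comment> \<open>The cap 1 gives the bound \<open>R + 1\<close> on \<open>V1\<close>, the cap
      \<open>e / 2\<close> the other half of the error.\<close>
    define r where "r = min 1 (e / 2)"
    have r: "r > 0" "r \<le> 1" "r \<le> e / 2" using e by (auto simp: r_def)
    have "(\<lambda>n. prob {w\<in>space M. \<bar>real (N n w) / \<theta> n - 1\<bar> > \<delta>}) \<longlonglongrightarrow> 0"
      using N\<theta> \<delta>(1) unfolding tendsto_in_prob_def by blast
    from order_tendstoD(2)[OF this, of "\<eta> / 3"] \<eta>
    have ev1: "\<forall>\<^sub>F n in sequentially. prob {w\<in>space M. \<bar>real (N n w) / \<theta> n - 1\<bar> > \<delta>} < \<eta> / 3" by simp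
    from order_tendstoD(2)[OF close1[OF r(1)], of "\<eta> / 3"] \<eta>
    have ev2: "\<forall>\<^sub>F n in sequentially. prob {w\<in>space M. dist (V1 n w) (W n w) > r} < \<eta> / 3" by simp
    have ev3: "\<forall>\<^sub>F n in sequentially. \<theta> n \<ge> 1" using \<theta> unfolding filterlim_at_top by blast
    show "\<forall>\<^sub>F n in sequentially. prob {w\<in>space M. dist (V2 n w) (W n w) > e} \<le> \<eta>"
      using ev1 ev2 ev3 eventually_ge_at_top[of 1]
    proof eventually_elim
      case (elim n)
      let ?A = "{w\<in>space M. \<bar>real (N n w) / \<theta> n - 1\<bar> > \<delta>}"
      let ?B = "{w\<in>space M. dist (V1 n w) (W n w) > r}"
      let ?D = "{w\<in>space M. norm (W n w) > R}"
      have sub: "{w\<in>space M. dist (V2 n w) (W n w) > e} \<subseteq> (?A \<union> ?B) \<union> ?D"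
      proof (rule subsetI, rule ccontr)
        fix w assume w: "w \<in> {w\<in>space M. dist (V2 n w) (W n w) > e}" and nn: "w \<notin> (?A \<union> ?B) \<union> ?D"
        define t where "t = real (N n w) / \<theta> n"
        have t: "\<bar>t - 1\<bar> \<le> \<delta>" using w nn unfolding t_def by auto
        have B: "dist (V1 n w) (W n w) \<le> r" and D: "norm (W n w) \<le> R" using w nn by auto
        have "\<bar>1 / sqrt t - 1\<bar> \<le> \<bar>t - 1\<bar>"
          by (rule abs_inverse_sqrt_diff_le) (use t \<delta>(2) in linarith)
        with t have s: "\<bar>1 / sqrt t - 1\<bar> \<le> \<delta>" by linarith
        have "V2 n w = (1 / sqrt t) *\<^sub>R V1 n w"
          using elim(3) by (simp add: V2_def V1_def t_def real_sqrt_divide)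
        then have "V2 n w - V1 n w = (1 / sqrt t - 1) *\<^sub>R V1 n w" by (simp add: scaleR_left_diff_distrib)
        then have "dist (V2 n w) (V1 n w) = \<bar>1 / sqrt t - 1\<bar> * norm (V1 n w)" by (simp add: dist_norm)
        also have "\<dots> \<le> \<delta> * (R + 1)"
        proof (rule mult_mono[OF s])
          have "norm (V1 n w) \<le> norm (W n w) + dist (V1 n w) (W n w)"
            using norm_triangle_ineq[of "W n w" "V1 n w - W n w"] by (simp add: dist_norm)
          then show "norm (V1 n w) \<le> R + 1" using B D r(2) by linarith
        qed (use \<delta>(1) in simp_all)
        finally have "dist (V2 n w) (V1 n w) \<le> e / 2" using \<delta>R by linarith
        with dist_triangle[of "V2 n w" "W n w" "V1 n w"] B r(3)
        have "dist (V2 n w) (W n w) \<le> e" by linarith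
        then show False using w by simp
      qed
      have A: "?A \<in> events"
      proof -
        have "(\<lambda>w. real (N n w) / \<theta> n) \<in> borel_measurable M"
          using N\<theta> elim(4) unfolding tendsto_in_prob_def by blast
        then show ?thesis by measurable
      qed
      have B: "?B \<in> events" using V1_meas[OF elim(4)] by measurable
      have D: "?D \<in> events" by measurable
      have "prob {w\<in>space M. dist (V2 n w) (W n w) > e} \<le> prob ((?A \<union> ?B) \<union> ?D)"
        by (rule finite_measure_mono[OF sub sets.Un[OF sets.Un[OF A B] D]])
      also have "\<dots> \<le> prob (?A \<union> ?B) + prob ?D" by (rule measure_Un_le[OF sets.Un[OF A B] D])
      also have "prob (?A \<union> ?B) \<le> prob ?A + prob ?B" using A B by (rule measure_Un_le)
      also have "prob ?D \<le> \<eta> / 3"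
      proof -
        have "prob ?D \<le> second_moment M (W n) / R\<^sup>2" by (rule Chebyshev_norm[OF WL R(1)])
        also have "\<dots> \<le> (C * s2 + 1) / R\<^sup>2"
          using W_moment[of n] by (intro divide_right_mono) simp_all
        also have "\<dots> = \<eta> / 3" unfolding R(2) using Cs \<eta> by (simp add: field_simps)
        finally show ?thesis .
      qed
      finally show ?case using elim(1,2) by linarith
    qed
  qed simp

  have "tendsto_in_distribution M V1 P Z"
    by (rule tendsto_in_distribution_perturb[OF M V1_meas W_tight W_lim close1])
  then show "tendsto_in_distribution M (\<lambda>n w. (1 / sqrt (\<theta> n)) *\<^sub>R (\<Sum>k=1..N n w. X k w)) P Z"
    unfolding V1_def[abs_def] S_def .
  have "tendsto_in_distribution M V2 P Z"
    by (rule tendsto_in_distribution_perturb[OF M V2_meas W_tight W_lim close2])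
  then show "tendsto_in_distribution M (\<lambda>n w. (1 / sqrt (real (N n w))) *\<^sub>R (\<Sum>k=1..N n w. X k w)) P Z"
    unfolding V2_def[abs_def] S_def .
qed

text \<open>The first conjunct rules out a vacuous reading of the second. Since only the law of the
  limit matters, the second is claimed for every realization on any sample space type
  \<open>'b\<close>.\<close>

theorem theorem0p3p20:
  fixes M :: "'a measure"
    and Y :: "nat \<Rightarrow> 'a \<Rightarrow> 'w::{banach, second_countable_topology}"
    and N :: "nat \<Rightarrow> 'a \<Rightarrow> nat"
    and \<theta> :: "nat \<Rightarrow> real"
  assumes "prob_space M" and "complete_measure M"
    and "type_2 M TYPE('w)"
    and "\<And>m. m \<ge> 1 \<Longrightarrow> Y m \<in> L2 M"
    and "\<And>n. n \<ge> 1 \<Longrightarrow> N n \<in> M \<rightarrow>\<^sub>M count_space {1..}"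
    and "\<And>n. n \<ge> 1 \<Longrightarrow> \<theta> n > 0"
    and "iid_seq M Y" and "(\<integral>\<omega>. Y 1 \<omega> \<partial>M) = 0"
    and "filterlim \<theta> at_top sequentially"
    and "tendsto_in_prob M (\<lambda>n \<omega>. real (N n \<omega>) / \<theta> n) 1"
  shows "(\<exists>(P :: 'w measure) (Z :: 'w \<Rightarrow> 'w). normal_rv P Z 0 (covariance M (Y 1))) \<and>
    (\<forall>(P :: 'b measure) (Z :: 'b \<Rightarrow> 'w). normal_rv P Z 0 (covariance M (Y 1)) \<longrightarrow>
      tendsto_in_distribution M
        (\<lambda>n \<omega>. (1 / sqrt (\<theta> n)) *\<^sub>R (\<Sum>k=1..N n \<omega>. Y k \<omega>)) P Z \<and>
      tendsto_in_distribution M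
        (\<lambda>n \<omega>. (1 / sqrt (real (N n \<omega>))) *\<^sub>R (\<Sum>k=1..N n \<omega>. Y k \<omega>)) P Z)"
proof -
  obtain C where C: "type_2_bound M TYPE('w) C" using assms(3) by (rule type_2_boundE)
  have Y1: "Y 1 \<in> L2 M" by (rule assms(4)) simp
  show ?thesis
    using normal_rv_exists[OF assms(1) C assms(7) Y1 assms(8)]
      random_index_central_limit[OF assms(1) C assms(7) Y1 assms(8) assms(5) assms(9) assms(10)]
    by blast
qed

end
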